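(* Let $P$ be a rational convex polyhedron with at least one vertex in a finite-dimensional real vector space $N_{\mathbb R}$. Then $[p_C:\widetilde C(P)\to C(P)\ni\underline1]$ is a terminal object of the category $\mathcal F_P$. That is, for any object $[p_+:\widetilde C\to C\ni e(1)]$ of $\mathcal F_P$ there is a unique linear map $e':C\to C(P)$ such that $p_+$ is induced from $p_C$ via base change along $e'$ (i.e. there is a linear map of cones $\widetilde C\to\widetilde C(P)$ over $e'$ making the square Cartesian) and $e'(e(1))=\underline1$, where the map $\widetilde C\to\widetilde C(P)$ is required to induce the identity $\mathrm{id}_P:p_+^{-1}(e(1))=P\to P_{\underline1}=P$ on the two distinguished fibers.
   Context: $\mathrm{tail}(P)=\{a:a+P\subseteq P\}$. $\mathrm{cone}(P)\subseteq N_{\mathbb R}\oplus\mathbb R$ is the closure of the cone over $P\times\{1\}$, with height function $R:\mathrm{cone}(P)\to\mathbb R_{\ge0}$ (last coordinate). Maps of polyhedral cones are restrictions of linear maps of the spanned vector spaces. **Category $\mathcal F_P$.** Objects are pairs $(p_+,e)$ consisting of a surjective homomorphism of polyhedral cones $p_+:\widetilde C\to C$ and a linear embedding $e:\mathbb R_{\ge0}\hookrightarrow C$ with $e(1)$ in the interior of $C$ (relative to its span), such that (i) $p_+^{-1}(\xi)+p_+^{-1}(\xi')=p_+^{-1}(\xi+\xi')$ for all $\xi,\xi'\in C$ (Minkowski sum), and (ii) $R:\mathrm{cone}(P)\to\mathbb R_{\ge0}$ is obtained from $p_+$ by base change along $e$, i.e. an identification $\mathrm{cone}(P)=\widetilde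 C\times_C\mathbb R_{\ge0}$ over $\mathbb R_{\ge 0}$ is given; in particular $p_+^{-1}(e(1))=P$. **$C(P)$ and $\widetilde C(P)$.** Let $v^i$ be the vertices of $P$ and $d_{ij}=v^j-v^i$ its compact edges, $r$ in number. $C(P)\subseteq\mathbb R^r_{\ge0}$ is the cone of all $\xi=(t_{ij})$ (with $t_{ij}=t_{ji}\geq 0$) satisfying $\sum_i t_{i,i+1}d_{i,i+1}=0$ along the oriented boundary of every compact 2-dimensional face of $P$. Fix a vertex $v_*$ of $P$. For $\xi\in C(P)$ and a vertex $v$, $v_\xi$ is defined by $(v_* )_\xi=0$ and $v^j_\xi-v^i_\xi=t_{ij}(\xi)(v^j-v^i)$ for compact edges; $P_\xi=\mathrm{conv}\{v_\xi\}+\mathrm{tail}(P)$. The points $\xi\in C(P)$ parametrize the translation classes of Minkowski summands of nonnegative multiples of $P$. $\widetilde C(P)=\{(\xi,w):\xi\in C(P),w\in P_\xi\}$, and $p_C$ is the projection to $C(P)$. $\underline1\in C(P)$ has all $t_{ij}=1$; $P_{\underline1}$ is the translate $P-v_*$ of $P$ and is identified with $P$ via this translation. The embedding belonging to $p_C$ is $e_C:\mathbb R_{\ge0}\to C(P)$, $1\mapsto\underline1$.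
   Formalization: If P has no compact edge then C(P)=0 and e_C is not an embedding, so [p_C] is not literally an object; membership in F_P is claimed only when P has a compact edge, while all other object conditions and the universal property are proved for every P. *)

theory Defs
  imports "HOL-Analysis.Analysis" "HOL-Analysis.Finite_Function_Topology"
begin

section \<open>Rational polyhedra\<close>

text \<open>
  The vector space \<open>N\<^sub>\<real>\<close> is \<^term>\<open>span N\<close> for a lattice \<open>N\<close> in a Euclidean space.  The lattice need
  not have full rank, so the case \<open>N\<^sub>\<real> = 0\<close> is included.  The inner product only serves to write
  linear functionals.
\<close>

definition is_lattice :: "'a::euclidean_space set \<Rightarrow> bool" where
  "is_lattice N \<longleftrightarrow>
     (\<exists>B. independent B \<and> N = {\<Sum>b\<in>B. of_int (k b) *\<^sub>R b | k :: 'a \<Rightarrow> int. True})"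

definition rational_polyhedron :: "'a::euclidean_space set \<Rightarrow> 'a set \<Rightarrow> bool" where
  "rational_polyhedron N P \<longleftrightarrow>
     (\<exists>H :: ('a \<times> real) set. finite H \<and>
        (\<forall>(u, b)\<in>H. (\<forall>x\<in>N. u \<bullet> x \<in> \<int>) \<and> b \<in> \<rat>) \<and>
        P = {x \<in> span N. \<forall>(u, b)\<in>H. u \<bullet> x \<le> b})"

definition vertices :: "'a::real_vector set \<Rightarrow> 'a set" where
  "vertices P = {v. v extreme_point_of P}"

definition compact_edges :: "'a::euclidean_space set \<Rightarrow> 'a set set" where
  "compact_edges P = {E. E edge_of P \<and> compact E}"

definition compact_2_faces :: "'a::euclidean_space set \<Rightarrow> 'a set set" where
  "compact_2_faces P = {F. F face_of P \<and> aff_dim F = 2 \<and> compact F}"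

definition tail :: "'a::real_vector set \<Rightarrow> 'a set" where
  "tail P = {a. (\<lambda>x. a + x) ` P \<subseteq> P}"

definition cone_over :: "'a::real_normed_vector set \<Rightarrow> ('a \<times> real) set" where
  "cone_over P = closure (cone hull (P \<times> {1}))"


section \<open>Polyhedral cones\<close>

definition polyhedral_cone :: "'b::real_vector set \<Rightarrow> bool" where
  "polyhedral_cone C \<longleftrightarrow> (\<exists>S. finite S \<and> C = convex_cone hull S)"

text \<open>
  A linear map on the span of \<open>C\<close> always extends to the ambient space, so \<open>g\<close> is taken there.
  Homomorphisms are extensional functions (\<^const>\<open>undefined\<close> off \<open>C\<close>): equality of functions is then
  equality of homomorphisms.
\<close>

definition cone_hom :: "'b::real_vector set \<Rightarrow> 'c::real_vector set \<Rightarrow> ('b \<Rightarrow> 'c) set" where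
  "cone_hom C D = {f \<in> C \<rightarrow>\<^sub>E D. \<exists>g. linear g \<and> (\<forall>x\<in>C. f x = g x)}"

text \<open>
  The square with upper edge \<open>f : A \<rightarrow> B\<close>, left edge \<open>g : A \<rightarrow> C\<close>, right edge \<open>h : B \<rightarrow> D\<close> and lower
  edge \<open>k : C \<rightarrow> D\<close> identifies \<open>A\<close> with the fibre product of \<open>B\<close> and \<open>C\<close> over \<open>D\<close>.  A bijective
  homomorphism of convex cones is an isomorphism: it stays injective on the spans.
\<close>

definition cartesian_square ::
  "'a set \<Rightarrow> 'b set \<Rightarrow> 'c set \<Rightarrow> ('a \<Rightarrow> 'b) \<Rightarrow> ('a \<Rightarrow> 'c) \<Rightarrow> ('b \<Rightarrow> 'd) \<Rightarrow> ('c \<Rightarrow> 'd) \<Rightarrow> bool" where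
  "cartesian_square A B C f g h k \<longleftrightarrow>
     bij_betw (\<lambda>x. (f x, g x)) A {(b, c). b \<in> B \<and> c \<in> C \<and> h b = k c}"


section \<open>The category of Minkowski-additive extensions of P\<close>

text \<open>
  \<open>tot \<rightarrow> base\<close> is the homomorphism \<open>proj\<close>, \<open>emb\<close> embeds the half-line into \<open>base\<close>, and \<open>ident\<close>
  is the map \<open>cone(P) \<rightarrow> tot\<close> that gives the identification of \<open>cone(P)\<close> with the base change.
  Every finite-dimensional real vector space carries a norm, and all norms induce the same topology,
  so normed ambient spaces are no restriction.
\<close>

record ('a, 'b, 'c) cone_family =
  tot :: "'b set"
  base :: "'c set"
  proj :: "'b \<Rightarrow> 'c"
  emb :: "real \<Rightarrow> 'c"
  ident :: "'a \<times> real \<Rightarrow> 'b"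

definition fibre :: "('a, 'b, 'c) cone_family \<Rightarrow> 'c \<Rightarrow> 'b set" where
  "fibre X \<xi> = {x \<in> tot X. proj X x = \<xi>}"

text \<open>All requirements on an object except that \<open>emb\<close> is injective.\<close>

definition F_family ::
  "'a::euclidean_space set \<Rightarrow> ('a, 'b::real_normed_vector, 'c::real_normed_vector) cone_family \<Rightarrow> bool"
where
  "F_family P X \<longleftrightarrow>
     polyhedral_cone (tot X) \<and> polyhedral_cone (base X) \<and>
     proj X \<in> cone_hom (tot X) (base X) \<and> proj X ` tot X = base X \<and>
     emb X \<in> cone_hom {0..} (base X) \<and> emb X 1 \<in> rel_interior (base X) \<and>
     (\<forall>\<xi>\<in>base X. \<forall>\<xi>'\<in>base X. fibre X \<xi> + fibre X \<xi>' = fibre X (\<xi> + \<xi>')) \<and>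
     ident X \<in> cone_hom (cone_over P) (tot X) \<and>
     cartesian_square (cone_over P) (tot X) {0..} (ident X) snd (proj X) (emb X)"

definition F_object ::
  "'a::euclidean_space set \<Rightarrow> ('a, 'b::real_normed_vector, 'c::real_normed_vector) cone_family \<Rightarrow> bool"
where
  "F_object P X \<longleftrightarrow> F_family P X \<and> inj_on (emb X) {0..}"

text \<open>
  A morphism \<open>X \<rightarrow> Y\<close> is a pair \<open>f\<close> on the bases, \<open>g\<close> on the total cones; \<open>ident (x, 1)\<close> is
  the point of the distinguished fibre that corresponds to \<open>x \<in> P\<close>.
\<close>

definition F_morphism ::
  "'a::euclidean_space set \<Rightarrow> ('a, 'b::real_normed_vector, 'c::real_normed_vector) cone_family \<Rightarrow>
   ('a, 'd::real_normed_vector, 'e::real_normed_vector) cone_family \<Rightarrow>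
   ('c \<Rightarrow> 'e) \<Rightarrow> ('b \<Rightarrow> 'd) \<Rightarrow> bool"
where
  "F_morphism P X Y f g \<longleftrightarrow>
     f \<in> cone_hom (base X) (base Y) \<and> g \<in> cone_hom (tot X) (tot Y) \<and>
     cartesian_square (tot X) (tot Y) (base X) g (proj X) (proj Y) f \<and>
     f (emb X 1) = emb Y 1 \<and>
     (\<forall>x\<in>P. g (ident X (x, 1)) = ident Y (x, 1))"


section \<open>The tautological family of Minkowski summands\<close>

text \<open>
  \<open>\<real>\<^sup>r\<close> is the space of finitely supported functions with support in the set of compact edges;
  the coordinate \<open>t\<^sub>i\<^sub>j\<close> is the value at the segment from \<open>v\<^sup>i\<close> to \<open>v\<^sup>j\<close>.
\<close>

abbreviation tcoord :: "('a::real_vector set \<Rightarrow>\<^sub>0 real) \<Rightarrow> 'a \<Rightarrow> 'a \<Rightarrow> real" where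
  "tcoord \<xi> v w \<equiv> Poly_Mapping.lookup \<xi> (closed_segment v w)"

text \<open>
  Cyclic enumeration of the vertices of a polygon along its boundary.  It is unique up to rotation
  and reversal, and neither affects the closing condition below.
\<close>

definition boundary_cycle :: "'a::euclidean_space set \<Rightarrow> 'a list \<Rightarrow> bool" where
  "boundary_cycle F vs \<longleftrightarrow>
     distinct vs \<and> set vs = vertices F \<and>
     (\<forall>i<length vs. closed_segment (vs ! i) (vs ! (Suc i mod length vs)) edge_of F)"

definition CP :: "'a::euclidean_space set \<Rightarrow> ('a set \<Rightarrow>\<^sub>0 real) set" where
  "CP P = {\<xi>. Poly_Mapping.keys \<xi> \<subseteq> compact_edges P \<and>
     (\<forall>E\<in>compact_edges P. 0 \<le> Poly_Mapping.lookup \<xi> E) \<and>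
     (\<forall>F\<in>compact_2_faces P. \<forall>vs. boundary_cycle F vs \<longrightarrow>
        (\<Sum>i<length vs. tcoord \<xi> (vs ! i) (vs ! (Suc i mod length vs)) *\<^sub>R
           (vs ! (Suc i mod length vs) - vs ! i)) = 0)}"

text \<open>The map \<open>v \<mapsto> v\<^sub>\<xi>\<close> on the vertices of \<open>P\<close>, normalised at the vertex \<open>v0\<close>.\<close>

definition vertex_at :: "'a::euclidean_space set \<Rightarrow> 'a \<Rightarrow> ('a set \<Rightarrow>\<^sub>0 real) \<Rightarrow> 'a \<Rightarrow> 'a" where
  "vertex_at P v0 \<xi> = (THE \<phi>. \<phi> \<in> extensional (vertices P) \<and> \<phi> v0 = 0 \<and>
     (\<forall>v\<in>vertices P. \<forall>w\<in>vertices P. closed_segment v w \<in> compact_edges P \<longrightarrow>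
        \<phi> w - \<phi> v = tcoord \<xi> v w *\<^sub>R (w - v)))"

definition summand :: "'a::euclidean_space set \<Rightarrow> 'a \<Rightarrow> ('a set \<Rightarrow>\<^sub>0 real) \<Rightarrow> 'a set" where
  "summand P v0 \<xi> = convex hull (vertex_at P v0 \<xi> ` vertices P) + tail P"

definition CtP :: "'a::euclidean_space set \<Rightarrow> 'a \<Rightarrow> (('a set \<Rightarrow>\<^sub>0 real) \<times> 'a) set" where
  "CtP P v0 = {(\<xi>, w). \<xi> \<in> CP P \<and> w \<in> summand P v0 \<xi>}"

definition one_CP :: "'a::euclidean_space set \<Rightarrow> 'a set \<Rightarrow>\<^sub>0 real" where
  "one_CP P = (\<Sum>E\<in>compact_edges P. Poly_Mapping.single E 1)"

text \<open>
  On \<open>P \<times> {1}\<close> the component \<open>ident\<close> is the translation of \<open>P\<close> by \<open>-v0\<close> onto the fibre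
  over \<^const>\<open>one_CP\<close>; it is extended linearly to \<open>cone(P)\<close>.
\<close>

definition tautological_family ::
  "'a::euclidean_space set \<Rightarrow> 'a \<Rightarrow> ('a, ('a set \<Rightarrow>\<^sub>0 real) \<times> 'a, 'a set \<Rightarrow>\<^sub>0 real) cone_family"
where
  "tautological_family P v0 =
     \<lparr> tot = CtP P v0,
       base = CP P,
       proj = restrict fst (CtP P v0),
       emb = (\<lambda>t\<in>{0..}. t *\<^sub>R one_CP P),
       ident = (\<lambda>(x, t)\<in>cone_over P. (t *\<^sub>R one_CP P, x - t *\<^sub>R v0)) \<rparr>"

end

(* Let V be the set of vertices of P.  For an object over C and a vertex v of P, a point xi of C has a
   companion xi' with xi + xi' = t e(1), because e(1) is interior.  By Minkowski additivity the vertex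
   t v of t P splits over xi + xi', and, being extreme, it splits uniquely: this gives a linear section
   s_v of the projection.  For a compact edge [v, w] the midpoint of t v and t w is shared by the two
   crossed sums s_v(xi) + s_w(xi') and s_w(xi) + s_v(xi'), which therefore lie on t [v, w], so that
   s_w(xi) - s_v(xi) is a nonnegative multiple of w - v.  These multiples are the classifying map to
   C(P), and x - s_{v0}(p(x)) is the second component of the map to the tautological cone.  A morphism
   preserves the unique decompositions, whence uniqueness.

   That the tautological family is an object needs that the closing conditions over the compact
   polygons integrate to a map v -> v_xi on all of V.  One sweeps V by a generic functional u: the lower
   edges at a vertex w are connected through compact polygons below w, since in the vertex figure at w the
   simplex path to the minimum of u stays in the region u < 0.  Minkowski additivity of the fibres then
   follows because a functional minimal over P at v is minimal over the summand at v_xi. *)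

theory Submission
  imports Defs
begin

section \<open>Convex cones\<close>

text \<open>The cone C(P) only sees vertices and compact faces. So everything rests on
  \<open>P\<close> being the convex hull of its vertices plus its tail, and on describing
  \<open>P\<close>, cone(P) and every summand by inequalities of one shape: one for each vertex
  \<open>m\<close> and each functional minimal over \<open>P\<close> at \<open>m\<close>
  (\<open>minimizes\<close>). The bounds are additive and homogeneous in \<xi>, which makes sums and
  multiples of summands formal. \<open>P\<close> may be unbounded. The sweep therefore uses a
  functional bounded below: a face at \<open>w\<close> whose directions all descend is then compact,
  and only compact faces enter the definition of \<open>CP\<close>. In an object, x - s_{v0}(p(x))
  need not lie in the total cone. It is a value, at height 0, of a linear extension \<open>J\<close>
  of the identification on the tangent cone \<open>K\<close> at \<open>v0\<close>. There
  \<open>J\<close> is injective, because adding a common multiple of \<open>v0\<close> moves two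
  points of \<open>K\<close> into cone(P) at the same height. If \<open>P\<close> has no compact
  edge, C(P) is zero and e_C is not injective; the tautological family is then an
  \<open>F_family\<close> but not an \<open>F_object\<close>.\<close>

lemma convex_cone_vimage_linear:
  assumes "linear f" "convex_cone C"
  shows "convex_cone {x. f x \<in> C}"
  using assms by (auto simp: convex_cone_iff linear_0 linear_add linear_scale)

lemma polyhedral_cone_imp_convex_cone: "polyhedral_cone C \<Longrightarrow> convex_cone C"
  by (auto simp: polyhedral_cone_def convex_cone_convex_cone_hull)

text \<open>A Fourier-Motzkin step on the generator side: the generators with nonnegative
  \<open>u\<close> are kept, and each pair on opposite sides contributes the combination on which
  \<open>u\<close> vanishes.\<close>

lemma polyhedral_cone_halfspace:
  fixes u :: "'b::real_vector \<Rightarrow> real"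
  assumes "polyhedral_cone C" and lin: "linear u"
  shows "polyhedral_cone (C \<inter> {x. 0 \<le> u x})"
proof -
  obtain S where fS: "finite S" and C: "C = convex_cone hull S"
    using assms by (auto simp: polyhedral_cone_def)
  define Sp where "Sp = {s\<in>S. 0 \<le> u s}"
  define Sn where "Sn = {s\<in>S. u s < 0}"
  define T where "T = Sp \<union> (\<lambda>(a,b). u a *\<^sub>R b - u b *\<^sub>R a) ` (Sp \<times> Sn)"
  have S: "S = Sp \<union> Sn" by (auto simp: Sp_def Sn_def)
  have ccT: "convex_cone (convex_cone hull T)" by (rule convex_cone_convex_cone_hull)
  have uadd: "u (x + y) = u x + u y" and usc: "u (r *\<^sub>R x) = r * u x" for x y r
    using lin by (auto simp: linear_add linear_scale)
  \<comment> \<open>The mixed term is bilinear, so membership passes from generators to hulls in one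
    argument at a time, first in \<open>n\<close>, then in \<open>p\<close>.\<close>
  have bil1: "u s *\<^sub>R n - u n *\<^sub>R s \<in> convex_cone hull T" if s: "s \<in> Sp" and n: "n \<in> convex_cone hull Sn" for s n
  proof -
    have "linear (\<lambda>n. u s *\<^sub>R n - u n *\<^sub>R s)"
      by (rule linearI) (auto simp: uadd usc algebra_simps)
    then have "convex_cone {n. u s *\<^sub>R n - u n *\<^sub>R s \<in> convex_cone hull T}"
      using convex_cone_vimage_linear ccT by blast
    moreover have "Sn \<subseteq> {n. u s *\<^sub>R n - u n *\<^sub>R s \<in> convex_cone hull T}"
      using s by (auto simp: T_def intro!: hull_inc)
    ultimately have "convex_cone hull Sn \<subseteq> {n. u s *\<^sub>R n - u n *\<^sub>R s \<in> convex_cone hull T}"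
      by (simp add: hull_minimal)
    then show ?thesis using n by auto
  qed
  have bil: "u p *\<^sub>R n - u n *\<^sub>R p \<in> convex_cone hull T"
    if p: "p \<in> convex_cone hull Sp" and n: "n \<in> convex_cone hull Sn" for p n
  proof -
    have "linear (\<lambda>p. u p *\<^sub>R n - u n *\<^sub>R p)"
      by (rule linearI) (auto simp: uadd usc algebra_simps)
    then have "convex_cone {p. u p *\<^sub>R n - u n *\<^sub>R p \<in> convex_cone hull T}"
      using convex_cone_vimage_linear ccT by blast
    then have "convex_cone hull Sp \<subseteq> {p. u p *\<^sub>R n - u n *\<^sub>R p \<in> convex_cone hull T}"
      using n bil1 by (intro hull_minimal) auto
    then show ?thesis using p by auto
  qed
  have un: "n = 0 \<or> u n < 0" if "n \<in> convex_cone hull Sn" for n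
  proof -
    have "convex_cone {n. n = 0 \<or> u n < 0}"
      unfolding convex_cone_iff
      using linear_0[OF lin] by (auto simp: uadd usc mult_nonneg_nonpos mult_less_0_iff le_less)
    then have "convex_cone hull Sn \<subseteq> {n. n = 0 \<or> u n < 0}"
      by (intro hull_minimal) (auto simp: Sn_def)
    then show ?thesis using that by auto
  qed
  have up: "0 \<le> u p" if "p \<in> convex_cone hull Sp" for p
  proof -
    have "convex_cone {n. 0 \<le> u n}"
      unfolding convex_cone_iff using linear_0[OF lin] by (auto simp: uadd usc)
    then have "convex_cone hull Sp \<subseteq> {n. 0 \<le> u n}"
      by (intro hull_minimal) (auto simp: Sp_def)
    then show ?thesis using that by auto
  qed
  have "C \<inter> {x. 0 \<le> u x} = convex_cone hull T"
  proof (intro equalityI subsetI)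
    fix x assume x: "x \<in> C \<inter> {x. 0 \<le> u x}"
    then obtain p n where p: "p \<in> convex_cone hull Sp" and n: "n \<in> convex_cone hull Sn" and xe: "x = p + n"
      unfolding C S convex_cone_hull_Un by auto
    have pT: "p \<in> convex_cone hull T"
      using p hull_mono[of Sp T convex_cone] by (auto simp: T_def)
    show "x \<in> convex_cone hull T"
    proof (cases "n = 0")
      case True then show ?thesis using pT xe by simp
    next
      case False
      then have "u n < 0" using un n by auto
      moreover have "u p + u n \<ge> 0" using x xe uadd by auto
      ultimately have pos: "u p > 0" by linarith
      \<comment> \<open>All of \<open>n\<close> is absorbed into a mixed term; the coefficient left
        over for \<open>p\<close> is nonnegative because \<open>u x\<close> is.\<close>
      have "(1 + u n / u p) *\<^sub>R p + (1 / u p) *\<^sub>R (u p *\<^sub>R n - u n *\<^sub>R p) = x"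
        using pos by (simp add: xe algebra_simps)
      moreover have "1 + u n / u p \<ge> 0" using pos \<open>u p + u n \<ge> 0\<close> by (simp add: field_simps)
      moreover have "(1 + u n / u p) *\<^sub>R p + (1 / u p) *\<^sub>R (u p *\<^sub>R n - u n *\<^sub>R p) \<in> convex_cone hull T"
        using \<open>1 + u n / u p \<ge> 0\<close> pos
        by (intro convex_cone_hull_add convex_cone_hull_mul pT bil p n) auto
      ultimately show ?thesis by simp
    qed
  next
    fix x assume "x \<in> convex_cone hull T"
    moreover have "convex_cone (C \<inter> {x. 0 \<le> u x})"
      using linear_0[OF lin] convex_cone_convex_cone_hull[of S]
      by (auto simp: convex_cone_iff C uadd usc)
    moreover have "T \<subseteq> C \<inter> {x. 0 \<le> u x}"
    proof
      fix t assume "t \<in> T"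
      then consider "t \<in> Sp" | a b where "a \<in> Sp" "b \<in> Sn" "t = u a *\<^sub>R b + (- u b) *\<^sub>R a"
        by (auto simp: T_def)
      then show "t \<in> C \<inter> {x. 0 \<le> u x}"
      proof cases
        case 1 then show ?thesis by (auto simp: C Sp_def hull_inc)
      next
        case 2
        then have "t \<in> C" unfolding C 
          by (auto simp: Sp_def Sn_def hull_inc intro!: convex_cone_hull_add[of "u a *\<^sub>R b" _ "(- u b) *\<^sub>R a", simplified] 
             convex_cone_hull_mul[of _ _ "- u b", simplified] convex_cone_hull_mul)
        moreover have "u t = 0" unfolding 2 by (simp add: uadd usc del: scaleR_minus_left)
        ultimately show ?thesis by simp
      qed
    qed
    ultimately show "x \<in> C \<inter> {x. 0 \<le> u x}"
      by (meson hull_minimal subsetD)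
  qed
  moreover have "finite T" using fS by (auto simp: T_def Sp_def Sn_def)
  ultimately show ?thesis by (auto simp: polyhedral_cone_def)
qed

lemma polyhedral_cone_hyperplane:
  fixes u :: "'b::real_vector \<Rightarrow> real"
  assumes "polyhedral_cone C" and lin: "linear u"
  shows "polyhedral_cone (C \<inter> {x. u x = 0})"
proof -
  have "polyhedral_cone (C \<inter> {x. 0 \<le> u x} \<inter> {x. 0 \<le> - u x})"
    using assms by (intro polyhedral_cone_halfspace linear_compose_neg)
  moreover have "C \<inter> {x. 0 \<le> u x} \<inter> {x. 0 \<le> - u x} = C \<inter> {x. u x = 0}" by auto
  ultimately show ?thesis by simp
qed

lemma polyhedral_cone_hyperplanes:
  fixes U :: "('b::real_vector \<Rightarrow> real) set"
  assumes "finite U" "polyhedral_cone C" "\<And>u. u \<in> U \<Longrightarrow> linear u"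
  shows "polyhedral_cone {x\<in>C. \<forall>u\<in>U. u x = 0}"
  using assms(1,3)
proof (induction U)
  case empty then show ?case using assms(2) by simp
next
  case (insert u U)
  have "polyhedral_cone ({x\<in>C. \<forall>u\<in>U. u x = 0} \<inter> {x. u x = 0})"
    using insert by (intro polyhedral_cone_hyperplane) auto
  moreover have "{x\<in>C. \<forall>u\<in>U. u x = 0} \<inter> {x. u x = 0} = {x\<in>C. \<forall>u\<in>insert u U. u x = 0}" by auto
  ultimately show ?case by simp
qed

lemma polyhedral_cone_halfspaces:
  fixes U :: "('b::real_vector \<Rightarrow> real) set"
  assumes "finite U" "polyhedral_cone C" "\<And>u. u \<in> U \<Longrightarrow> linear u"
  shows "polyhedral_cone {x\<in>C. \<forall>u\<in>U. 0 \<le> u x}"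
  using assms(1,3)
proof (induction U)
  case empty then show ?case using assms(2) by simp
next
  case (insert u U)
  have "polyhedral_cone ({x\<in>C. \<forall>u\<in>U. 0 \<le> u x} \<inter> {x. 0 \<le> u x})"
    using insert by (intro polyhedral_cone_halfspace) auto
  moreover have "{x\<in>C. \<forall>u\<in>U. 0 \<le> u x} \<inter> {x. 0 \<le> u x} = {x\<in>C. \<forall>u\<in>insert u U. 0 \<le> u x}" by auto
  ultimately show ?case by simp
qed

lemma polyhedral_cone_UNIV: "polyhedral_cone (UNIV :: 'a::euclidean_space set)"
proof -
  let ?S = "Basis \<union> uminus ` Basis :: 'a set"
  have cc: "convex_cone (convex_cone hull ?S)" by (rule convex_cone_convex_cone_hull)
  have 1: "b \<in> convex_cone hull ?S" "- b \<in> convex_cone hull ?S" if "b \<in> Basis" for b :: 'a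
    using that by (auto intro!: hull_inc)
  have 2: "r *\<^sub>R b \<in> convex_cone hull ?S" if "b \<in> Basis" for b :: 'a and r
  proof (cases "r \<ge> 0")
    case True then show ?thesis using 1 that by (simp add: convex_cone_hull_mul)
  next
    case False
    then have "(- r) *\<^sub>R (- b) \<in> convex_cone hull ?S" using 1 that by (intro convex_cone_hull_mul) auto
    then show ?thesis by simp
  qed
  have 3: "sum f A \<in> convex_cone hull ?S" if "\<And>a. a \<in> A \<Longrightarrow> f a \<in> convex_cone hull ?S" for f :: "'a \<Rightarrow> 'a" and A
    using that by (induction A rule: infinite_finite_induct) (auto simp: convex_cone_hull_contains_0 convex_cone_hull_add)
  have "x \<in> convex_cone hull ?S" for x :: 'a
    using 3[of Basis "\<lambda>b. (x \<bullet> b) *\<^sub>R b"] 2 by (simp add: euclidean_representation)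
  then have "UNIV = convex_cone hull ?S" by blast
  then show ?thesis unfolding polyhedral_cone_def by (metis finite_Basis finite_UnI finite_imageI)
qed

lemma convex_cone_additive_sum:
  fixes h :: "'b::real_vector \<Rightarrow> 'c::real_vector"
  assumes C: "convex_cone C"
    and add: "\<And>x y. x \<in> C \<Longrightarrow> y \<in> C \<Longrightarrow> h (x + y) = h x + h y"
    and scale: "\<And>x c. x \<in> C \<Longrightarrow> 0 \<le> c \<Longrightarrow> h (c *\<^sub>R x) = c *\<^sub>R h x"
    and "finite T" "T \<subseteq> C" "\<And>b. b \<in> T \<Longrightarrow> 0 \<le> r b"
  shows "(\<Sum>b\<in>T. r b *\<^sub>R b) \<in> C \<and> h (\<Sum>b\<in>T. r b *\<^sub>R b) = (\<Sum>b\<in>T. r b *\<^sub>R h b)"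
  using assms(4-6)
proof (induction T)
  case empty
  have "0 \<in> C" using C by (simp add: convex_cone_contains_0)
  then show ?case using scale[of 0 0] by simp
next
  case (insert b T)
  then show ?case using C by (simp add: add scale convex_cone_add convex_cone_scaleR)
qed

text \<open>\<open>cone_hom\<close> asks for the restriction of a linear map. A basis of the span is
  taken inside \<open>C\<close>; as \<open>h\<close> is controlled only on \<open>C\<close>,
  negative coefficients are moved to the other side before additivity is applied.\<close>

lemma convex_cone_linear_extension:
  fixes h :: "'b::real_vector \<Rightarrow> 'c::real_vector"
  assumes C: "convex_cone C"
    and add: "\<And>x y. x \<in> C \<Longrightarrow> y \<in> C \<Longrightarrow> h (x + y) = h x + h y"
    and scale: "\<And>x c. x \<in> C \<Longrightarrow> 0 \<le> c \<Longrightarrow> h (c *\<^sub>R x) = c *\<^sub>R h x"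
  obtains G where "linear G" "\<And>x. x \<in> C \<Longrightarrow> G x = h x"
proof -
  obtain B where B: "B \<subseteq> C" "independent B" "C \<subseteq> span B"
    using maximal_independent_subset by blast
  obtain G where G: "linear G" "\<And>b. b \<in> B \<Longrightarrow> G b = h b"
    using linear_independent_extend[OF B(2), of h] by blast
  have "G x = h x" if x: "x \<in> C" for x
  proof -
    obtain T r where T: "finite T" "T \<subseteq> B" "x = (\<Sum>b\<in>T. r b *\<^sub>R b)"
      using x B(3) unfolding span_explicit by blast
    let ?p = "\<lambda>b. max (r b) 0" and ?n = "\<lambda>b. max (- r b) 0"
    have TC: "T \<subseteq> C" using T B by auto
    have sp: "h (\<Sum>b\<in>T. ?p b *\<^sub>R b) = (\<Sum>b\<in>T. ?p b *\<^sub>R h b)"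
      and sn: "(\<Sum>b\<in>T. ?n b *\<^sub>R b) \<in> C" "h (\<Sum>b\<in>T. ?n b *\<^sub>R b) = (\<Sum>b\<in>T. ?n b *\<^sub>R h b)"
      using convex_cone_additive_sum[OF C add scale T(1) TC, of ?p]
        convex_cone_additive_sum[OF C add scale T(1) TC, of ?n] by auto
    have r: "r b = ?p b - ?n b" for b by auto
    have xx: "x + (\<Sum>b\<in>T. ?n b *\<^sub>R b) = (\<Sum>b\<in>T. ?p b *\<^sub>R b)"
      unfolding T(3) sum.distrib[symmetric]
      by (rule sum.cong) (auto simp: max_def simp flip: scaleR_add_left)
    have "h x + (\<Sum>b\<in>T. ?n b *\<^sub>R h b) = (\<Sum>b\<in>T. ?p b *\<^sub>R h b)"
      unfolding sn(2)[symmetric] sp[symmetric] add[OF x sn(1), symmetric] by (simp only: xx)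
    moreover have "G x + (\<Sum>b\<in>T. ?n b *\<^sub>R h b) = (\<Sum>b\<in>T. ?p b *\<^sub>R h b)"
    proof -
      have "G (\<Sum>b\<in>T. q b *\<^sub>R b) = (\<Sum>b\<in>T. q b *\<^sub>R h b)" for q
        using G T by (auto simp: linear_sum linear_scale intro!: sum.cong)
      from this[of ?n] this[of ?p] show ?thesis using arg_cong[OF xx, of G] by (simp add: linear_add[OF G(1)])
    qed
    ultimately have "G x + (\<Sum>b\<in>T. ?n b *\<^sub>R h b) = h x + (\<Sum>b\<in>T. ?n b *\<^sub>R h b)" by (simp only:)
    then show ?thesis by (rule add_right_imp_eq)
  qed
  then show thesis using that G(1) by blast
qed

text \<open>Zero together with the points whose normalisation lies in the hull of the normalised
  generators is itself a convex cone: normalising \<open>x + y\<close> gives the convex combination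
  with weights proportional to \<open>c \<bullet> x\<close> and \<open>c \<bullet> y\<close>. It
  serves both homogenised polyhedra and vertex figures.\<close>

lemma convex_cone_hull_normalize:
  fixes c :: "'a::real_inner"
  assumes pos: "\<And>d. d \<in> D \<Longrightarrow> 0 < c \<bullet> d" and y: "y \<in> convex_cone hull D" "y \<noteq> 0"
  shows "0 < c \<bullet> y \<and> (1 / (c \<bullet> y)) *\<^sub>R y \<in> convex hull ((\<lambda>d. (1 / (c \<bullet> d)) *\<^sub>R d) ` D)"
proof -
  let ?Q = "convex hull ((\<lambda>d. (1 / (c \<bullet> d)) *\<^sub>R d) ` D)"
  let ?K = "{y. y = 0 \<or> (0 < c \<bullet> y \<and> (1 / (c \<bullet> y)) *\<^sub>R y \<in> ?Q)}"
  have "convex_cone ?K"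
    unfolding convex_cone_iff
  proof (intro conjI ballI allI impI)
    show "0 \<in> ?K" by simp
    fix x assume x: "x \<in> ?K"
    show "r *\<^sub>R x \<in> ?K" if "0 \<le> r" for r
    proof (cases "r = 0 \<or> x = 0")
      case False
      then have "0 < r" "0 < c \<bullet> x" "(1 / (c \<bullet> x)) *\<^sub>R x \<in> ?Q" using that x by auto
      moreover have "(1 / (c \<bullet> (r *\<^sub>R x))) *\<^sub>R (r *\<^sub>R x) = (1 / (c \<bullet> x)) *\<^sub>R x"
        using \<open>0 < r\<close> by simp
      ultimately show ?thesis by simp
    qed auto
    fix y assume y: "y \<in> ?K"
    show "x + y \<in> ?K"
    proof (cases "x = 0 \<or> y = 0")
      case True then show ?thesis using x y by auto
    next
      case False
      then have X: "0 < c \<bullet> x" "(1 / (c \<bullet> x)) *\<^sub>R x \<in> ?Q" and Y: "0 < c \<bullet> y" "(1 / (c \<bullet> y)) *\<^sub>R y \<in> ?Q"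
        using x y by auto
      define p q where "p = c \<bullet> x" and "q = c \<bullet> y"
      have pq: "0 < p" "0 < q" "p / (p + q) + q / (p + q) = 1" "c \<bullet> (x + y) = p + q"
        using X Y by (auto simp: p_def q_def inner_add_right simp flip: add_divide_distrib)
      have "(p / (p + q)) *\<^sub>R ((1 / p) *\<^sub>R x) + (q / (p + q)) *\<^sub>R ((1 / q) *\<^sub>R y) \<in> ?Q"
        using X Y pq by (intro convexD[OF convex_convex_hull]) (auto simp: p_def q_def)
      moreover have "(p / (p + q)) *\<^sub>R ((1 / p) *\<^sub>R x) + (q / (p + q)) *\<^sub>R ((1 / q) *\<^sub>R y) = (1 / (p + q)) *\<^sub>R (x + y)"
        using pq(1,2) by (simp add: scaleR_add_right)
      ultimately show ?thesis using pq(1,2,4) by simp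
    qed
  qed
  moreover have "D \<subseteq> ?K" using pos by (auto intro!: hull_inc)
  ultimately have "convex_cone hull D \<subseteq> ?K" by (simp add: hull_minimal)
  then show ?thesis using y by auto
qed

lemma convex_affine_vimage:
  assumes f: "linear f" and C: "convex C"
  shows "convex {x. c + f x \<in> C}"
  unfolding convex_def
proof (intro ballI allI impI CollectI)
  fix x y and r s :: real
  assume xy: "x \<in> {x. c + f x \<in> C}" "y \<in> {x. c + f x \<in> C}" and rs: "0 \<le> r" "0 \<le> s" "r + s = 1"
  have "r *\<^sub>R (c + f x) + s *\<^sub>R (c + f y) \<in> C" using xy rs by (intro convexD[OF C]) auto
  moreover have "r *\<^sub>R (c + f x) + s *\<^sub>R (c + f y) = (r + s) *\<^sub>R c + f (r *\<^sub>R x + s *\<^sub>R y)"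
    by (simp add: linear_add[OF f] linear_scale[OF f] algebra_simps)
  ultimately show "c + f (r *\<^sub>R x + s *\<^sub>R y) \<in> C" using rs(3) by simp
qed

section \<open>Decomposition of polyhedra\<close>

text \<open>Adding \<open>a\<close> repeatedly to one point of \<open>P\<close>, together with the
  Archimedean property, turns invariance under translation into homogeneous inequalities.\<close>

lemma tail_eq_recession:
  fixes H :: "('a::euclidean_space \<times> real) set"
  assumes P: "P = {x. \<forall>(u,b)\<in>H. u \<bullet> x \<le> b}" and ne: "P \<noteq> {}"
  shows "tail P = {a. \<forall>(u,b)\<in>H. u \<bullet> a \<le> 0}"
proof (intro equalityI subsetI)
  fix a assume a: "a \<in> tail P"
  obtain p where p: "p \<in> P" using ne by auto
  have np: "real n *\<^sub>R a + p \<in> P" for n :: nat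
  proof (induction n)
    case (Suc n)
    then have "a + (real n *\<^sub>R a + p) \<in> P" using a unfolding tail_def by blast
    then show ?case by (simp add: algebra_simps)
  qed (use p in simp)
  have "u \<bullet> a \<le> 0" if ub: "(u,b) \<in> H" for u b
  proof (rule ccontr)
    assume "\<not> u \<bullet> a \<le> 0"
    then obtain n :: nat where "b - u \<bullet> p < real n * (u \<bullet> a)"
      using reals_Archimedean3[of "u \<bullet> a"] by force
    moreover have "u \<bullet> (real n *\<^sub>R a + p) \<le> b" using np[of n] ub P by auto
    ultimately show False by (simp add: inner_add_right)
  qed
  then show "a \<in> {a. \<forall>(u,b)\<in>H. u \<bullet> a \<le> 0}" by auto
next
  fix a assume "a \<in> {a. \<forall>(u,b)\<in>H. u \<bullet> a \<le> 0}"
  then show "a \<in> tail P" unfolding tail_def P by (fastforce simp: inner_add_right)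
qed

lemma polyhedron_inequalities:
  fixes P :: "'a::euclidean_space set"
  assumes "polyhedron P"
  obtains H where "finite H" "P = {x. \<forall>(u,b)\<in>H. u \<bullet> x \<le> b}"
proof -
  obtain F where F: "finite F" "P = \<Inter>F" "\<forall>h\<in>F. \<exists>a b. a \<noteq> 0 \<and> h = {x. a \<bullet> x \<le> b}"
    using assms unfolding polyhedron_def by blast
  then obtain a b where ab: "\<And>h. h \<in> F \<Longrightarrow> h = {x. a h \<bullet> x \<le> b h}" by metis
  then have "\<Inter>F = {x. \<forall>h\<in>F. a h \<bullet> x \<le> b h}" by blast
  then show thesis
    by (intro that[of "(\<lambda>h. (a h, b h)) ` F"]) (use F(1,2) in auto)
qed

lemma convex_cone_tail:
  fixes P :: "'a::euclidean_space set"
  assumes "polyhedron P" "P \<noteq> {}"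
  shows "convex_cone (tail P)"
proof -
  obtain H where H: "finite H" "P = {x. \<forall>(u,b)\<in>H. u \<bullet> x \<le> b}"
    using polyhedron_inequalities assms by blast
  show ?thesis unfolding tail_eq_recession[OF H(2) assms(2)]
    by (auto simp: convex_cone_iff inner_add_right mult_nonneg_nonpos add_nonpos_nonpos split: prod.splits)
       (metis add_nonpos_nonpos)
qed

lemma convex_convex_hull_plus_cone:
  assumes "convex_cone T" shows "convex (convex hull S + T)"
  using assms by (simp add: convex_cone_def convex_set_plus)

lemma add_cone_mem:
  assumes T: "convex_cone T" and "x \<in> S + T" "a \<in> T"
  shows "x + a \<in> S + T"
proof -
  obtain s t where "s \<in> S" "t \<in> T" "x = s + t" using assms(2) by (metis set_plus_elim)
  then show ?thesis using assms(3) convex_cone_add[OF T, of t a] by (simp add: add.assoc set_plus_intro)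
qed

lemma convex_hull_plus_cone_subset:
  fixes K :: "'a::real_vector set"
  assumes "convex K" "S \<subseteq> K" "\<And>x a. x \<in> K \<Longrightarrow> a \<in> T \<Longrightarrow> x + a \<in> K"
  shows "convex hull S + T \<subseteq> K"
  using assms hull_minimal[of S K convex] by (fastforce elim!: set_plus_elim)

text \<open>Minkowski-Weyl by homogenisation: the cone \<open>K\<close> of all \<open>(x, t)\<close>
  with \<open>u \<bullet> x \<le> b * t\<close> is finitely generated. Generators at positive
  height, rescaled to height 1, give \<open>S\<close>; those at height 0 give
  \<open>A\<close>.\<close>

lemma polyhedron_finite_decomposition:
  fixes P :: "'a::euclidean_space set"
  assumes "polyhedron P" "P \<noteq> {}"
  obtains S A where "finite S" "finite A" "tail P = convex_cone hull A" "P = convex hull S + tail P"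
proof -
  obtain H where H: "finite H" and P: "P = {x. \<forall>(u,b)\<in>H. u \<bullet> x \<le> b}"
    using polyhedron_inequalities assms by blast
  have tl: "tail P = {a. \<forall>(u,b)\<in>H. u \<bullet> a \<le> 0}" by (rule tail_eq_recession[OF P assms(2)])
  define U where "U = insert snd ((\<lambda>(u,b) (x,t). b * t - u \<bullet> x) ` H :: ('a \<times> real \<Rightarrow> real) set)"
  have "polyhedral_cone {x\<in>UNIV. \<forall>u\<in>U. 0 \<le> u x}"
  proof (rule polyhedral_cone_halfspaces)
    show "finite U" using H by (auto simp: U_def)
    show "polyhedral_cone (UNIV :: ('a \<times> real) set)" by (rule polyhedral_cone_UNIV)
    fix u assume "u \<in> U"
    then show "linear u" by (auto simp: U_def split_def algebra_simps inner_add_right intro!: linearI)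
  qed
  moreover define K where "K = {(x,t). 0 \<le> t \<and> (\<forall>(u,b)\<in>H. u \<bullet> x \<le> b * t)}"
  moreover have "{x\<in>UNIV. \<forall>u\<in>U. 0 \<le> u x} = K" by (auto simp: U_def K_def split_def)
  ultimately have "polyhedral_cone K" by simp
  then obtain G where G: "finite G" "K = convex_cone hull G" by (auto simp: polyhedral_cone_def)
  have GK: "G \<subseteq> K" using G hull_subset by metis
  have sG: "0 \<le> snd g" if "g \<in> G" for g using GK that by (auto simp: K_def)
  let ?Gp = "{g\<in>G. 0 < snd g}" and ?G0 = "{g\<in>G. snd g = 0}"
  define S where "S = (\<lambda>g. (1 / snd g) *\<^sub>R fst g) ` ?Gp"
  define A where "A = fst ` ?G0"
  have GU: "G = ?Gp \<union> ?G0" using sG by (auto simp: le_less)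
  have Atail: "A \<subseteq> tail P" using GK unfolding tl by (fastforce simp: A_def K_def)
  have SP: "S \<subseteq> P"
  proof
    fix y assume "y \<in> S"
    then obtain x t where xt: "(x,t) \<in> G" "t > 0" "y = (1/t) *\<^sub>R x" by (auto simp: S_def)
    then have "\<forall>(u,b)\<in>H. u \<bullet> x \<le> b * t" using GK by (auto simp: K_def)
    then show "y \<in> P" using xt by (auto simp: P field_simps)
  qed
  have ccT: "convex_cone (tail P)" by (rule convex_cone_tail[OF assms])
  have split: "\<exists>p a. x = p + (a, 0) \<and> p \<in> convex_cone hull ?Gp \<and> a \<in> convex_cone hull A" if x: "x \<in> K" for x
  proof -
    have "x \<in> convex_cone hull (?Gp \<union> ?G0)" using x G(2) GU by metis
    then obtain p q where pq: "p \<in> convex_cone hull ?Gp" "q \<in> convex_cone hull ?G0" "x = p + q"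
      unfolding convex_cone_hull_Un by auto
    have "convex_cone hull ?G0 \<subseteq> (convex_cone hull A) \<times> {0}"
    proof (rule hull_minimal)
      show "?G0 \<subseteq> (convex_cone hull A) \<times> {0}" by (auto simp: A_def intro!: hull_inc rev_image_eqI)
    qed (intro convex_cone_Times convex_cone_convex_cone_hull convex_cone_singleton)
    then have "q \<in> (convex_cone hull A) \<times> {0}" using pq(2) by (rule subsetD)
    then show ?thesis using pq unfolding mem_Times_iff
      by (intro exI[of _ p] exI[of _ "fst q"]) (auto simp: prod_eq_iff)
  qed
  have pos: "0 < snd p \<and> (1 / snd p) *\<^sub>R fst p \<in> convex hull S" if p: "p \<in> convex_cone hull ?Gp" "p \<noteq> 0" for p
  proof -
    have *: "(0, 1) \<bullet> g = snd g" for g :: "'a \<times> real" by (simp add: inner_prod_def)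
    let ?Q = "convex hull ((\<lambda>g. (1 / snd g) *\<^sub>R g) ` ?Gp)"
    have p1: "0 < snd p" "(1 / snd p) *\<^sub>R p \<in> ?Q"
      using convex_cone_hull_normalize[of ?Gp "(0, 1)" p] p by (simp_all add: *)
    have "fst ` ?Q = convex hull ((\<lambda>g. fst ((1 / snd g) *\<^sub>R g)) ` ?Gp)"
      by (simp only: convex_hull_linear_image[OF linear_fst] image_image)
    also have "\<dots> = convex hull S" by (simp add: S_def)
    finally show ?thesis using p1(1) imageI[OF p1(2), of fst] by simp
  qed
  have tA: "tail P = convex_cone hull A"
  proof
    show "convex_cone hull A \<subseteq> tail P" using Atail ccT by (simp add: hull_minimal)
    show "tail P \<subseteq> convex_cone hull A"
    proof
      fix a assume "a \<in> tail P"
      then have "(a,0) \<in> K" by (auto simp: K_def tl)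
      then obtain p b where p: "(a, 0) = p + (b, 0)" "p \<in> convex_cone hull ?Gp" "b \<in> convex_cone hull A"
        using split by blast
      \<comment> \<open>A point at height 0 has no part generated at positive height, so only the
        directions in \<open>A\<close> remain.\<close>
      have "snd p = 0" using arg_cong[OF p(1), of snd] by simp
      then have "p = 0" using pos[OF p(2)] by auto
      then show "a \<in> convex_cone hull A" using p by simp
    qed
  qed
  have "P = convex hull S + tail P"
  proof
    show "convex hull S + tail P \<subseteq> P"
    proof (rule convex_hull_plus_cone_subset)
      show "convex P" using assms polyhedron_imp_convex by auto
      show "S \<subseteq> P" by fact
      show "x + a \<in> P" if "x \<in> P" "a \<in> tail P" for x a
        using that by (auto simp: tail_def image_subset_iff add.commute)
    qed
    show "P \<subseteq> convex hull S + tail P"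
    proof
      fix x assume "x \<in> P"
      then have "(x,1) \<in> K" by (auto simp: K_def P)
      then obtain p a where p: "(x, 1) = p + (a, 0)" "p \<in> convex_cone hull ?Gp" "a \<in> convex_cone hull A"
        using split by blast
      have "snd p = 1" "x = fst p + a" using arg_cong[OF p(1), of snd] arg_cong[OF p(1), of fst] by simp_all
      moreover then have "fst p \<in> convex hull S" using pos[OF p(2)] by force
      ultimately show "x \<in> convex hull S + tail P" unfolding tA using p(3) by (auto intro!: set_plus_intro)
    qed
  qed
  moreover have "finite S" "finite A" unfolding S_def A_def
    by (intro finite_imageI finite_subset[OF _ G(1)]; auto)+
  ultimately show thesis using that tA by blast
qed

lemma finite_vertices: "polyhedron (P :: 'a::euclidean_space set) \<Longrightarrow> finite (vertices P)"
  using finite_polyhedron_extreme_points[of P] by (simp add: vertices_def)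

text \<open>Faces of a polyhedron are exposed, in particular \<open>{w}\<close>; the normal of the
  supporting hyperplane is negated to turn a maximum into a strict minimum.\<close>

lemma exposed_vertex:
  fixes P :: "'a::euclidean_space set"
  assumes "polyhedron P" "w \<in> vertices P"
  obtains c where "\<And>x. x \<in> P \<Longrightarrow> x \<noteq> w \<Longrightarrow> c \<bullet> w < c \<bullet> x"
proof -
  have "{w} exposed_face_of P"
    using assms exposed_face_of_polyhedron face_of_singleton by (auto simp: vertices_def)
  then obtain a b where ab: "P \<subseteq> {x. a \<bullet> x \<le> b}" "{w} = P \<inter> {x. a \<bullet> x = b}"
    unfolding exposed_face_of_def by blast
  have "- a \<bullet> w < - a \<bullet> x" if "x \<in> P" "x \<noteq> w" for x
  proof -
    have "a \<bullet> x \<le> b" "a \<bullet> x \<noteq> b" "a \<bullet> w = b" using that ab by auto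
    then show ?thesis by simp
  qed
  then show thesis using that by blast
qed

lemma linear_minimum_convex_hull:
  assumes "finite S" "S \<noteq> {}"
  obtains s where "s \<in> S" "\<And>k. k \<in> convex hull S \<Longrightarrow> u \<bullet> s \<le> u \<bullet> k"
proof -
  have "Min ((\<lambda>v. u \<bullet> v) ` S) \<in> (\<lambda>v. u \<bullet> v) ` S" using assms by (intro Min_in) auto
  then obtain s where s: "s \<in> S" "u \<bullet> s = Min ((\<lambda>v. u \<bullet> v) ` S)" by auto
  have "convex hull S \<subseteq> {y. u \<bullet> y \<ge> u \<bullet> s}"
    unfolding s(2) using assms(1) by (intro hull_minimal convex_halfspace_ge) auto
  then show thesis using that s(1) by blast
qed

lemma closed_convex_hull_plus_cone:
  fixes S :: "'a::euclidean_space set"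
  assumes "finite S" "finite A"
  shows "closed (convex hull S + convex_cone hull A)"
proof -
  have "closed (\<Union>x\<in>convex hull S. \<Union>y\<in>convex_cone hull A. {x + y})"
    using assms by (intro compact_closed_sums finite_imp_compact_convex_hull closed_convex_cone_hull)
  moreover have "(\<Union>x\<in>convex hull S. \<Union>y\<in>convex_cone hull A. {x + y}) = convex hull S + convex_cone hull A"
    unfolding set_plus_def by auto
  ultimately show ?thesis by (simp only:)
qed

lemma nonneg_on_cone:
  assumes T: "convex_cone T" and bdd: "\<And>a. a \<in> T \<Longrightarrow> b \<le> u \<bullet> (x + a)" and a: "a \<in> T"
  shows "0 \<le> u \<bullet> a"
proof (rule ccontr)
  assume "\<not> 0 \<le> u \<bullet> a"
  then obtain n :: nat where n: "u \<bullet> x - b < real n * (- (u \<bullet> a))"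
    using reals_Archimedean3[of "- (u \<bullet> a)"] by force
  have "b \<le> u \<bullet> (x + real n *\<^sub>R a)" by (rule bdd) (simp add: convex_cone_scaleR[OF T _ a])
  then show False using n by (simp add: inner_add_right)
qed

text \<open>If \<open>x\<close> were separated by \<open>u\<close> from the right-hand side, then the face of \<open>P\<close> where \<open>u\<close> is minimal
  would contain a vertex; it is found on the compact face where a functional \<open>c\<close>, positive on the
  tail, is minimal in turn.\<close>

lemma pointed_polyhedron_decomposition:
  fixes P :: "'a::euclidean_space set"
  assumes poly: "polyhedron P" and v0: "v0 \<in> vertices P"
  obtains A where "finite A" "tail P = convex_cone hull A" "P = convex hull (vertices P) + tail P"
proof -
  have v0P: "v0 \<in> P" using v0 by (auto simp: vertices_def extreme_point_of_def)
  then have ne: "P \<noteq> {}" by auto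
  obtain S A where S: "finite S" and A: "finite A" "tail P = convex_cone hull A" and Peq: "P = convex hull S + tail P"
    using polyhedron_finite_decomposition[OF poly ne] by metis
  have ccT: "convex_cone (tail P)" by (rule convex_cone_tail[OF poly ne])
  have T0: "0 \<in> tail P" by (rule convex_cone_contains_0[OF ccT])
  have Pc: "convex P" "closed P" using poly polyhedron_imp_convex polyhedron_imp_closed by auto
  have Ptail: "x + a \<in> P" if "x \<in> P" "a \<in> tail P" for x a
    using that by (auto simp: tail_def image_subset_iff add.commute)
  have SP: "k \<in> P" if "k \<in> convex hull S" for k
    using subsetD[OF equalityD2[OF Peq] set_plus_intro[OF that T0]] by simp
  have dec: "\<exists>k a. k \<in> convex hull S \<and> a \<in> tail P \<and> x = k + a" if x: "x \<in> P" for x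
    using subsetD[OF equalityD1[OF Peq] x] by (metis set_plus_elim)
  have Sne: "S \<noteq> {}" using dec[OF v0P] by auto
  let ?K = "convex hull (vertices P) + tail P"
  have "?K \<subseteq> P"
    using Ptail by (intro convex_hull_plus_cone_subset Pc) (auto simp: vertices_def extreme_point_of_def)
  moreover have "x \<in> ?K" if x: "x \<in> P" for x
  proof (rule ccontr)
    assume xK: "x \<notin> ?K"
    have "closed ?K" unfolding A(2) by (rule closed_convex_hull_plus_cone[OF finite_vertices[OF poly] A(1)])
    then obtain u b where ub: "u \<bullet> x < b" "\<And>y. y \<in> ?K \<Longrightarrow> b < u \<bullet> y"
      using separating_hyperplane_closed_point[OF convex_convex_hull_plus_cone[OF ccT] _ xK] by blast
    have vK: "v + a \<in> ?K" if "v \<in> vertices P" "a \<in> tail P" for v a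
      using that by (intro set_plus_intro hull_inc)
    have ut: "0 \<le> u \<bullet> a" if a: "a \<in> tail P" for a
      by (rule nonneg_on_cone[OF ccT _ a, of b u v0]) (use ub(2) vK[OF v0] in \<open>auto simp: less_imp_le\<close>)
    obtain s where s: "s \<in> S" "\<And>k. k \<in> convex hull S \<Longrightarrow> u \<bullet> s \<le> u \<bullet> k"
      using linear_minimum_convex_hull[OF S Sne] by blast
    have us: "u \<bullet> s \<le> u \<bullet> y" if y: "y \<in> P" for y
    proof -
      obtain k a where "k \<in> convex hull S" "a \<in> tail P" "y = k + a" using dec[OF y] by blast
      then show ?thesis using s(2)[of k] ut[of a] by (simp add: inner_add_right)
    qed
    define F where "F = P \<inter> {y. u \<bullet> y = u \<bullet> s}"
    have F: "F face_of P" unfolding F_def by (rule face_of_Int_supporting_hyperplane_ge[OF Pc(1) us])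
    obtain c where c: "\<And>y. y \<in> P \<Longrightarrow> y \<noteq> v0 \<Longrightarrow> c \<bullet> v0 < c \<bullet> y" using exposed_vertex[OF poly v0] by blast
    have ct: "0 < c \<bullet> a" if "a \<in> tail P" "a \<noteq> 0" for a
      using c[OF Ptail[OF v0P that(1)]] that(2) by (simp add: inner_add_right)
    have Fdec: "\<exists>k a. k \<in> convex hull S \<inter> F \<and> a \<in> tail P \<and> y = k + a" if y: "y \<in> F" for y
    proof -
      obtain k a where k: "k \<in> convex hull S" "a \<in> tail P" "y = k + a" using dec y unfolding F_def by blast
      have "u \<bullet> k = u \<bullet> s" using s(2)[OF k(1)] ut[OF k(2)] y by (simp add: F_def k(3) inner_add_right)
      then show ?thesis using k SP by (auto simp: F_def)
    qed
    have "compact (convex hull S \<inter> F)"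
      using S F face_of_polyhedron_polyhedron[OF poly F] polyhedron_imp_closed
      by (intro compact_Int_closed finite_imp_compact_convex_hull) auto
    moreover have "s \<in> convex hull S \<inter> F" using s(1) SP by (auto simp: F_def hull_inc)
    moreover have "continuous_on (convex hull S \<inter> F) (\<lambda>y. c \<bullet> y)" by (intro continuous_intros)
    ultimately obtain k0 where k0: "k0 \<in> convex hull S \<inter> F" "\<And>k. k \<in> convex hull S \<inter> F \<Longrightarrow> c \<bullet> k0 \<le> c \<bullet> k"
      using continuous_attains_inf[of "convex hull S \<inter> F" "\<lambda>y. c \<bullet> y"] by blast
    have ck: "c \<bullet> k0 \<le> c \<bullet> y \<and> (c \<bullet> y = c \<bullet> k0 \<longrightarrow> y \<in> convex hull S)" if y: "y \<in> F" for y
    proof -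
      obtain k a where k: "k \<in> convex hull S \<inter> F" "a \<in> tail P" "y = k + a" using Fdec[OF y] by blast
      then show ?thesis using k0(2)[OF k(1)] ct[OF k(2)] by (cases "a = 0") (auto simp: inner_add_right)
    qed
    let ?G = "F \<inter> {y. c \<bullet> y = c \<bullet> k0}"
    have G: "?G face_of F" using ck face_of_imp_convex[OF F] by (intro face_of_Int_supporting_hyperplane_ge) auto
    then have GP: "?G face_of P" using F by (rule face_of_trans)
    \<comment> \<open>By \<open>ck\<close>, a point where \<open>c\<close> is minimal on
      \<open>F\<close> carries no nonzero tail part, so this face lies in the compact hull of
      \<open>S\<close>.\<close>
    have "bounded ?G" using ck S
      by (intro bounded_subset[OF compact_imp_bounded[OF finite_imp_compact_convex_hull[OF S]]]) auto
    then have "compact ?G" using face_of_polyhedron_polyhedron[OF poly GP] polyhedron_imp_closed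
      by (auto simp: compact_eq_bounded_closed)
    then obtain v where v: "v extreme_point_of ?G"
      using extreme_point_exists_convex[of ?G] face_of_imp_convex[OF GP] k0(1) by blast
    then have "v \<in> vertices P" "v \<in> F" using extreme_point_of_face[OF GP] by (auto simp: vertices_def)
    then have "u \<bullet> v = u \<bullet> s" "b < u \<bullet> v" using ub(2)[OF vK[OF _ T0, of v]] by (auto simp: F_def)
    then show False using ub(1) us[OF x] by simp
  qed
  ultimately have "P = ?K" by (meson subsetI subset_antisym)
  then show thesis by (rule that[OF A])
qed

section \<open>Vertex figures\<close>

locale pointed_polyhedron =
  fixes P :: "'a::euclidean_space set"
  assumes poly: "polyhedron P" and vertices_nonempty: "vertices P \<noteq> {}"
begin

lemma convex_P: "convex P" and closed_P: "closed P"
  using poly by (auto simp: polyhedron_imp_convex polyhedron_imp_closed)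

lemma vertex_in: "v \<in> vertices P \<Longrightarrow> v \<in> P"
  by (simp add: vertices_def extreme_point_of_def)

lemma finite_vertices_P: "finite (vertices P)"
  using finite_vertices poly by blast

lemma P_nonempty: "P \<noteq> {}"
  using vertex_in vertices_nonempty by auto

lemma convex_cone_tail_P: "convex_cone (tail P)"
  using convex_cone_tail poly P_nonempty by blast

lemma add_tail: "x \<in> P \<Longrightarrow> a \<in> tail P \<Longrightarrow> x + a \<in> P"
  by (auto simp: tail_def image_subset_iff add.commute)

definition gens :: "'a set" where
  "gens = (SOME A. finite A \<and> tail P = convex_cone hull A)"

lemma finite_gens: "finite gens" and tail_gens: "tail P = convex_cone hull gens"
proof -
  obtain v0 where v0: "v0 \<in> vertices P" using vertices_nonempty by auto
  obtain A where "finite A" "tail P = convex_cone hull A"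
    by (rule pointed_polyhedron_decomposition[OF poly v0])
  then have "\<exists>A. finite A \<and> tail P = convex_cone hull A" by blast
  then have "finite gens \<and> tail P = convex_cone hull gens"
    unfolding gens_def by (rule someI_ex)
  then show "finite gens" "tail P = convex_cone hull gens" by blast+
qed

lemma decompose:
  assumes "x \<in> P"
  obtains k a where "k \<in> convex hull vertices P" "a \<in> tail P" "x = k + a"
proof -
  obtain v0 where v0: "v0 \<in> vertices P" using vertices_nonempty by auto
  obtain A where "P = convex hull vertices P + tail P"
    by (rule pointed_polyhedron_decomposition[OF poly v0])
  then have "P \<subseteq> convex hull vertices P + tail P" by (rule equalityD1)
  then have "x \<in> convex hull vertices P + tail P" using assms by (rule subsetD)
  then show thesis using that by (rule set_plus_elim)
qed

lemma face_pointed: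
  assumes F: "F face_of P" "F \<noteq> {}"
  shows "polyhedron F" "vertices F = vertices P \<inter> F"
  using face_of_polyhedron_polyhedron[OF poly F(1)] extreme_point_of_face[OF F(1)]
  by (auto simp: vertices_def)

definition exposes :: "'a \<Rightarrow> 'a \<Rightarrow> bool" where
  "exposes c w \<longleftrightarrow> (\<forall>x\<in>P. x \<noteq> w \<longrightarrow> c \<bullet> w < c \<bullet> x)"

lemma exposes_exists:
  assumes "w \<in> vertices P"
  obtains c where "exposes c w"
proof -
  obtain c where "\<And>x. x \<in> P \<Longrightarrow> x \<noteq> w \<Longrightarrow> c \<bullet> w < c \<bullet> x"
    using exposed_vertex[OF poly assms] by metis
  then have "exposes c w" by (simp add: exposes_def)
  then show thesis by (rule that)
qed

text \<open>Generators of the tangent cone of \<open>P\<close> at \<open>w\<close>. Zero is removed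
  so that a functional exposing \<open>w\<close> is strictly positive on each and can be used to
  normalise.\<close>

definition dirs :: "'a \<Rightarrow> 'a set" where
  "dirs w = (\<lambda>v. v - w) ` (vertices P - {w}) \<union> (gens - {0})"

text \<open>The slice \<open>c = 1\<close> of the tangent cone at \<open>w\<close>, moved to the origin.\<close>

definition fig :: "'a \<Rightarrow> 'a \<Rightarrow> 'a set" where
  "fig c w = convex hull ((\<lambda>d. (1 / (c \<bullet> d)) *\<^sub>R d) ` dirs w)"

text \<open>The point where the ray from \<open>w\<close> through \<open>x\<close>, moved to the
  origin, meets the hyperplane on which \<open>c\<close> is 1.\<close>

definition direction :: "'a \<Rightarrow> 'a \<Rightarrow> 'a \<Rightarrow> 'a" where
  "direction c w x = (1 / (c \<bullet> (x - w))) *\<^sub>R (x - w)"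

lemma polytope_fig: "polytope (fig c w)"
  unfolding fig_def using finite_vertices_P finite_gens
  by (intro polytope_convex_hull) (auto simp: dirs_def)

lemma compact_fig: "compact (fig c w)" and convex_fig: "convex (fig c w)"
  and polyhedron_fig: "polyhedron (fig c w)"
  using polytope_fig polytope_imp_compact polytope_imp_convex polytope_imp_polyhedron by blast+

lemma gens_tail: "gens \<subseteq> tail P"
  using tail_gens hull_subset by metis

lemma dirs_pos:
  assumes "w \<in> vertices P" "exposes c w" "d \<in> dirs w"
  shows "0 < c \<bullet> d" "w + d \<in> P"
proof -
  consider v where "v \<in> vertices P" "v \<noteq> w" "d = v - w" | "d \<in> gens" "d \<noteq> 0"
    using assms(3) by (auto simp: dirs_def)
  then have "w + d \<in> P \<and> w + d \<noteq> w"
  proof cases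
    case 1 then show ?thesis using vertex_in by auto
  next
    case 2 then show ?thesis using assms(1) vertex_in add_tail gens_tail by auto
  qed
  then show "w + d \<in> P" "0 < c \<bullet> d" using assms(2) by (auto simp: exposes_def inner_add_right)
qed

lemma diff_in_cone_dirs:
  assumes x: "x \<in> P"
  shows "x - w \<in> convex_cone hull dirs w"
proof -
  let ?C = "convex_cone hull dirs w"
  obtain k a where k: "k \<in> convex hull vertices P" "a \<in> tail P" "x = k + a"
    using decompose[OF x] .
  have "convex {k. - w + id k \<in> ?C}"
    by (intro convex_affine_vimage linear_id convex_convex_cone_hull)
  then have "convex {k. k - w \<in> ?C}" by simp
  moreover have "vertices P \<subseteq> {k. k - w \<in> ?C}"
  proof
    fix v assume "v \<in> vertices P"
    then show "v \<in> {k. k - w \<in> ?C}"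
      by (cases "v = w") (auto simp: dirs_def convex_cone_hull_contains_0 intro!: hull_inc)
  qed
  ultimately have "k - w \<in> ?C" using k(1) hull_minimal[of "vertices P" _ convex] by blast
  moreover have "a \<in> ?C"
  proof -
    have "gens \<subseteq> ?C"
    proof
      fix g assume "g \<in> gens"
      then show "g \<in> ?C" by (cases "g = 0") (auto simp: dirs_def convex_cone_hull_contains_0 intro!: hull_inc)
    qed
    then have "convex_cone hull gens \<subseteq> ?C" by (simp add: hull_minimal convex_cone_convex_cone_hull)
    then show ?thesis using k(2) tail_gens by blast
  qed
  ultimately have "(k - w) + a \<in> ?C" by (rule convex_cone_hull_add)
  then show ?thesis by (simp add: k(3) algebra_simps)
qed

lemma direction_in_fig:
  assumes "w \<in> vertices P" "exposes c w" "x \<in> P" "x \<noteq> w"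
  shows "direction c w x \<in> fig c w"
  using convex_cone_hull_normalize[of "dirs w" c "x - w"] dirs_pos[OF assms(1,2)] diff_in_cone_dirs[OF assms(3)] assms(4)
  by (simp add: direction_def fig_def)

lemma fig_normalized:
  assumes w: "w \<in> vertices P" "exposes c w" and q: "q \<in> fig c w"
  shows "c \<bullet> q = 1"
proof -
  have "fig c w \<subseteq> {x. c \<bullet> x = 1}"
    unfolding fig_def
  proof (rule hull_minimal)
    show "(\<lambda>d. (1 / (c \<bullet> d)) *\<^sub>R d) ` dirs w \<subseteq> {x. c \<bullet> x = 1}"
      using dirs_pos[OF w] by fastforce
  qed (rule convex_hyperplane)
  then show ?thesis using q by auto
qed

lemma point_toward:
  assumes x: "w \<in> P" "w + e *\<^sub>R q \<in> P" and r: "0 \<le> r" "r \<le> e"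
  shows "w + r *\<^sub>R q \<in> P"
proof (cases "e = 0")
  case False
  then have e: "0 < e" using r by auto
  then have "(1 - r / e) *\<^sub>R w + (r / e) *\<^sub>R (w + e *\<^sub>R q) \<in> P"
    using x r by (intro convexD[OF convex_P]) auto
  moreover have "(1 - r / e) *\<^sub>R w + (r / e) *\<^sub>R (w + e *\<^sub>R q) = w + r *\<^sub>R q"
    using e by (simp add: algebra_simps)
  ultimately show ?thesis by simp
qed (use assms in auto)

text \<open>The figure belongs to the tangent cone, so only short multiples of \<open>q\<close> stay
  in \<open>P\<close>. The \<open>q\<close> with some admissible length form a convex set, the
  minimum of two lengths serving both points, so the generators suffice.\<close>

lemma fig_point:
  assumes w: "w \<in> vertices P" "exposes c w" and q: "q \<in> fig c w"
  obtains e where "0 < e" "\<And>r. 0 \<le> r \<Longrightarrow> r \<le> e \<Longrightarrow> w + r *\<^sub>R q \<in> P"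
proof -
  have wP: "w \<in> P" using w vertex_in by auto
  let ?K = "{q. \<exists>e>0. w + e *\<^sub>R q \<in> P}"
  have "convex ?K"
    unfolding convex_def
  proof (intro ballI allI impI CollectI)
    fix y z and u v :: real assume yz: "y \<in> ?K" "z \<in> ?K" and uv: "0 \<le> u" "0 \<le> v" "u + v = 1"
    obtain a b where ab: "0 < a" "w + a *\<^sub>R y \<in> P" "0 < b" "w + b *\<^sub>R z \<in> P" using yz by auto
    define e where "e = min a b"
    have e: "0 < e" "e \<le> a" "e \<le> b" using ab by (auto simp: e_def)
    have "w + e *\<^sub>R y \<in> P" "w + e *\<^sub>R z \<in> P"
      using point_toward[OF wP ab(2)] point_toward[OF wP ab(4)] e by auto
    then have "u *\<^sub>R (w + e *\<^sub>R y) + v *\<^sub>R (w + e *\<^sub>R z) \<in> P" using uv by (intro convexD[OF convex_P])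
    moreover have "u *\<^sub>R (w + e *\<^sub>R y) + v *\<^sub>R (w + e *\<^sub>R z) = (u + v) *\<^sub>R w + e *\<^sub>R (u *\<^sub>R y + v *\<^sub>R z)"
      by (simp add: algebra_simps)
    ultimately show "\<exists>e>0. w + e *\<^sub>R (u *\<^sub>R y + v *\<^sub>R z) \<in> P" using uv e(1) by auto
  qed
  moreover have "(\<lambda>d. (1 / (c \<bullet> d)) *\<^sub>R d) ` dirs w \<subseteq> ?K"
  proof
    fix q assume "q \<in> (\<lambda>d. (1 / (c \<bullet> d)) *\<^sub>R d) ` dirs w"
    then obtain d where d: "d \<in> dirs w" "q = (1 / (c \<bullet> d)) *\<^sub>R d" by auto
    have "0 < c \<bullet> d" "w + d \<in> P" using dirs_pos[OF w d(1)] .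
    then have "0 < c \<bullet> d \<and> w + (c \<bullet> d) *\<^sub>R q \<in> P" by (simp add: d(2))
    then show "q \<in> ?K" by blast
  qed
  ultimately have "q \<in> ?K" using q hull_minimal[of _ ?K convex] unfolding fig_def by blast
  then obtain e where "0 < e" "w + e *\<^sub>R q \<in> P" by auto
  then show thesis using that point_toward[OF wP] by blast
qed

lemma direction_eq:
  assumes "exposes c w" "x \<in> P" "x \<noteq> w"
  shows "0 < c \<bullet> (x - w)" "x = w + (c \<bullet> (x - w)) *\<^sub>R direction c w x"
  using assms by (auto simp: exposes_def inner_diff_right direction_def)

lemma direction_ray:
  assumes "c \<bullet> q = 1" "0 < s"
  shows "direction c w (w + s *\<^sub>R q) = q" "w + s *\<^sub>R q \<noteq> w"
  using assms by (auto simp: direction_def)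

text \<open>\<open>F\<close> is the face of \<open>P\<close> at \<open>w\<close> that corresponds to the face \<open>G\<close> of the vertex figure.\<close>

definition lifts :: "'a \<Rightarrow> 'a \<Rightarrow> 'a set \<Rightarrow> 'a set \<Rightarrow> bool" where
  "lifts c w G F \<longleftrightarrow> F face_of P \<and> w \<in> F \<and> (\<forall>x\<in>P. x \<noteq> w \<longrightarrow> (x \<in> F \<longleftrightarrow> direction c w x \<in> G))"

text \<open>A face of the figure is exposed by some \<open>a \<bullet> q \<le> b\<close>. As
  \<open>c\<close> is 1 on the figure, this inequality becomes homogeneous with
  \<open>k = b *\<^sub>R c - a\<close>, which is nonnegative there and zero exactly on
  \<open>G\<close>; hence \<open>k\<close> is minimal over \<open>P\<close> at \<open>w\<close>, and
  the points of minimum form the lifted face.\<close>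

lemma lift_exists:
  assumes w: "w \<in> vertices P" "exposes c w" and G: "G face_of fig c w"
  obtains F where "lifts c w G F"
proof -
  have "G exposed_face_of fig c w" using G exposed_face_of_polyhedron polyhedron_fig by blast
  then obtain a b where ab: "fig c w \<subseteq> {x. a \<bullet> x \<le> b}" "G = fig c w \<inter> {x. a \<bullet> x = b}"
    unfolding exposed_face_of_def by blast
  define k where "k = b *\<^sub>R c - a"
  have k: "0 \<le> k \<bullet> q" "k \<bullet> q = 0 \<longleftrightarrow> q \<in> G" if "q \<in> fig c w" for q
    using that fig_normalized[OF w that] ab by (auto simp: k_def inner_diff_left)
  have kx: "k \<bullet> x = k \<bullet> w + (c \<bullet> (x - w)) * (k \<bullet> direction c w x)" if "x \<in> P" "x \<noteq> w" for x
  proof -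
    have "k \<bullet> x = k \<bullet> (w + (c \<bullet> (x - w)) *\<^sub>R direction c w x)"
      using direction_eq(2)[OF w(2) that] by simp
    then show ?thesis by (simp only: inner_add_right inner_scaleR_right)
  qed
  have ge: "k \<bullet> x \<ge> k \<bullet> w" if "x \<in> P" for x
  proof (cases "x = w")
    case False
    then have "0 \<le> (c \<bullet> (x - w)) * (k \<bullet> direction c w x)"
      using direction_eq(1)[OF w(2) that] k(1) direction_in_fig[OF w that] by (intro mult_nonneg_nonneg) auto
    then show ?thesis using kx[OF that False] by linarith
  qed simp
  have "lifts c w G (P \<inter> {x. k \<bullet> x = k \<bullet> w})"
    unfolding lifts_def
  proof (intro conjI ballI impI)
    show "(P \<inter> {x. k \<bullet> x = k \<bullet> w}) face_of P"
      by (rule face_of_Int_supporting_hyperplane_ge[OF convex_P ge])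
    show "w \<in> P \<inter> {x. k \<bullet> x = k \<bullet> w}" using w vertex_in by auto
    fix x assume x: "x \<in> P" "x \<noteq> w"
    have "0 < c \<bullet> (x - w)" using direction_eq(1)[OF w(2) x] .
    then have "x \<in> P \<inter> {x. k \<bullet> x = k \<bullet> w} \<longleftrightarrow> k \<bullet> direction c w x = 0"
      using kx[OF x] x by auto
    then show "x \<in> P \<inter> {x. k \<bullet> x = k \<bullet> w} \<longleftrightarrow> direction c w x \<in> G"
      using k(2)[OF direction_in_fig[OF w x]] by simp
  qed
  then show thesis by (rule that)
qed

text \<open>On the compact face \<open>G\<close> the functional \<open>u\<close> is at most
  \<open>- h < 0\<close>, so it falls at rate at least \<open>h\<close> along every ray from
  \<open>w\<close> into \<open>F\<close>. The lower bound \<open>m\<close> on \<open>P\<close> then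
  bounds the length of these rays.\<close>

lemma lift_compact:
  assumes w: "w \<in> vertices P" "exposes c w" and F: "lifts c w G F"
    and G: "compact G" "\<And>q. q \<in> G \<Longrightarrow> u \<bullet> q < 0" and bdd: "\<And>x. x \<in> P \<Longrightarrow> m \<le> u \<bullet> x"
  shows "compact F"
proof (cases "G = {}")
  case True
  then have "F \<subseteq> {w}" using F by (auto simp: lifts_def dest: face_of_imp_subset)
  then show ?thesis by (meson finite.emptyI finite.insertI finite_subset finite_imp_compact)
next
  case False
  have FP: "F \<subseteq> P" "F face_of P" using F by (auto simp: lifts_def dest: face_of_imp_subset)
  have "continuous_on G (\<lambda>q. u \<bullet> q)" by (intro continuous_intros)
  then obtain q0 where q0: "q0 \<in> G" "\<And>q. q \<in> G \<Longrightarrow> u \<bullet> q \<le> u \<bullet> q0"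
    using continuous_attains_sup[OF G(1) False] by blast
  define h where "h = - (u \<bullet> q0)"
  have h: "0 < h" using G(2) q0(1) by (auto simp: h_def)
  obtain B where B: "\<And>q. q \<in> G \<Longrightarrow> norm q \<le> B" "0 < B"
    using compact_imp_bounded[OF G(1)] bounded_pos by metis
  let ?M = "max 0 ((u \<bullet> w - m) / h)"
  have "norm x \<le> norm w + ?M * B" if x: "x \<in> F" for x
  proof (cases "x = w")
    case True then show ?thesis using B(2) by simp
  next
    case False
    have xP: "x \<in> P" using x FP by auto
    define s where "s = c \<bullet> (x - w)"
    define q where "q = direction c w x"
    have s: "0 < s" "x = w + s *\<^sub>R q" unfolding s_def q_def using direction_eq[OF w(2) xP False] .
    have q: "q \<in> G" using F x xP False by (auto simp: lifts_def q_def)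
    have "m \<le> u \<bullet> x" using bdd xP by auto
    also have "u \<bullet> x = u \<bullet> w + s * (u \<bullet> q)" by (simp add: s(2) inner_add_right)
    also have "\<dots> \<le> u \<bullet> w + s * (- h)" using q0(2)[OF q] s(1) by (simp add: h_def mult_left_mono)
    finally have "s \<le> (u \<bullet> w - m) / h" using h by (simp add: field_simps)
    then have sM: "s \<le> ?M" by simp
    have "norm x \<le> norm w + s * norm q" unfolding s(2) using norm_triangle_ineq[of w "s *\<^sub>R q"] s(1) by simp
    also have "s * norm q \<le> ?M * B" using sM B(1)[OF q] s(1) by (intro mult_mono) auto
    finally show ?thesis by simp
  qed
  then have "bounded F" unfolding bounded_iff by blast
  moreover have "closed F" using face_of_polyhedron_polyhedron[OF poly FP(2)] polyhedron_imp_closed by auto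
  ultimately show ?thesis by (simp add: compact_eq_bounded_closed)
qed

lemma lift_span:
  assumes w: "w \<in> vertices P" "exposes c w" and F: "lifts c w G F" and G: "G \<subseteq> fig c w"
  shows "span ((\<lambda>x. x - w) ` F) = span G"
proof
  have FP: "F \<subseteq> P" using F by (auto simp: lifts_def dest: face_of_imp_subset)
  show "span ((\<lambda>x. x - w) ` F) \<subseteq> span G"
  proof (rule span_minimal)
    show "(\<lambda>x. x - w) ` F \<subseteq> span G"
    proof (intro image_subsetI)
      fix x assume x: "x \<in> F"
      show "x - w \<in> span G"
      proof (cases "x = w")
        case False
        have xP: "x \<in> P" using x FP by auto
        have "direction c w x \<in> G" using F x xP False by (auto simp: lifts_def)
        then have "(c \<bullet> (x - w)) *\<^sub>R direction c w x \<in> span G" by (simp add: span_base span_scale)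
        moreover have "x - w = (c \<bullet> (x - w)) *\<^sub>R direction c w x"
          using direction_eq(2)[OF w(2) xP False] by (metis add_diff_cancel_left')
        ultimately show ?thesis by simp
      qed (simp add: span_zero)
    qed
  qed simp
  show "span G \<subseteq> span ((\<lambda>x. x - w) ` F)"
  proof (rule span_minimal)
    show "G \<subseteq> span ((\<lambda>x. x - w) ` F)"
    proof
      fix q assume q: "q \<in> G"
      then have qf: "q \<in> fig c w" using G by auto
      obtain e where e: "0 < e" "\<And>r. 0 \<le> r \<Longrightarrow> r \<le> e \<Longrightarrow> w + r *\<^sub>R q \<in> P"
        using fig_point[OF w qf] by blast
      have "direction c w (w + e *\<^sub>R q) = q" "w + e *\<^sub>R q \<noteq> w" "w + e *\<^sub>R q \<in> P"
        using direction_ray[OF fig_normalized[OF w qf] e(1)] e by auto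
      then have "w + e *\<^sub>R q \<in> F" using F q by (auto simp: lifts_def)
      then have "(w + e *\<^sub>R q) - w \<in> (\<lambda>x. x - w) ` F" by (rule imageI)
      then have "e *\<^sub>R q \<in> (\<lambda>x. x - w) ` F" by simp
      then have "(1 / e) *\<^sub>R (e *\<^sub>R q) \<in> span ((\<lambda>x. x - w) ` F)" by (intro span_scale span_base)
      then show "q \<in> span ((\<lambda>x. x - w) ` F)" using e(1) by simp
    qed
  qed simp
qed

text \<open>\<open>F\<close> moved to the origin spans the same space as \<open>G\<close>, and the
  affine hull of \<open>G\<close> misses 0 because \<open>c\<close> is 1 on it; this accounts for
  the additional dimension.\<close>

lemma lift_aff_dim:
  assumes w: "w \<in> vertices P" "exposes c w" and F: "lifts c w G F" and G: "G \<subseteq> fig c w"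
  shows "aff_dim F = aff_dim G + 1"
proof -
  have "w \<in> F" using F by (simp add: lifts_def)
  then have "aff_dim F = int (dim ((\<lambda>x. x - w) ` F))"
    by (intro aff_dim_eq_dim_subtract hull_inc)
  also have "dim ((\<lambda>x. x - w) ` F) = dim G"
    using lift_span[OF assms] by (metis dim_span)
  also have "int (dim G) = aff_dim (insert 0 G)"
    by (subst aff_dim_zero) (auto simp: hull_inc dim_insert span_zero)
  also have "\<dots> = aff_dim G + 1"
  proof -
    have "affine hull G \<subseteq> {x. c \<bullet> x = 1}"
      using G fig_normalized[OF w] by (intro hull_minimal affine_hyperplane) auto
    then have "0 \<notin> affine hull G" by auto
    then show ?thesis by (simp add: aff_dim_insert)
  qed
  finally show ?thesis .
qed

lemma lifts_P: "w \<in> vertices P \<Longrightarrow> exposes c w \<Longrightarrow> lifts c w (fig c w) P"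
  using direction_in_fig vertex_in by (auto simp: lifts_def face_of_refl convex_P)

section \<open>Compact edges and descent along them\<close>

lemma segment_vertices:
  assumes "closed_segment v w face_of P"
  shows "v \<in> vertices P" "w \<in> vertices P"
  using segment_face_of[OF assms] by (auto simp: vertices_def)

lemma compact_edge_iff:
  "closed_segment v w \<in> compact_edges P \<longleftrightarrow> closed_segment v w face_of P \<and> v \<noteq> w"
  by (auto simp: compact_edges_def edge_of_def aff_dim_convex_hull[of "{v, w}", folded segment_convex_hull])

lemma compact_edgeE:
  assumes "E \<in> compact_edges P"
  obtains v w where "v \<in> vertices P" "w \<in> vertices P" "v \<noteq> w" "E = closed_segment v w"
proof -
  have E: "E face_of P" "aff_dim E = 1" "compact E"
    using assms by (auto simp: compact_edges_def edge_of_def)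
  have "E \<noteq> {}" using E(2) by auto
  moreover have "convex E" using E(1) face_of_imp_convex by auto
  moreover have "collinear E" using E(2) by (simp add: collinear_aff_dim)
  ultimately obtain v w where vw: "E = closed_segment v w"
    using compact_convex_collinear_segment E(3) by blast
  have "v \<noteq> w" using E(2) vw by auto
  then show thesis using that vw E(1) segment_vertices by blast
qed

lemma finite_compact_edges: "finite (compact_edges P)"
  using finite_polyhedron_faces[OF poly]
  by (rule finite_subset[rotated]) (auto simp: compact_edges_def edge_of_def)

lemma finite_compact_2_faces: "finite (compact_2_faces P)"
  using finite_polyhedron_faces[OF poly]
  by (rule finite_subset[rotated]) (auto simp: compact_2_faces_def)

text \<open>The vertex \<open>q\<close> of the figure lifts to a one-dimensional face, compact
  because \<open>u\<close> decreases along \<open>q\<close> and is bounded below. Being extreme,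
  \<open>w\<close> is an end of this segment.\<close>

lemma edge_at:
  assumes w: "w \<in> vertices P" "exposes c w" and q: "q extreme_point_of fig c w" "u \<bullet> q < 0"
    and bdd: "\<And>x. x \<in> P \<Longrightarrow> m \<le> u \<bullet> x"
  obtains s where "0 < s" "closed_segment w (w + s *\<^sub>R q) \<in> compact_edges P"
proof -
  have qf: "{q} face_of fig c w" "q \<in> fig c w" using q(1) by (auto simp: face_of_singleton extreme_point_of_def)
  obtain F where F: "lifts c w {q} F" using lift_exists[OF w qf(1)] .
  have cF: "compact F" by (rule lift_compact[OF w F _ _ bdd]) (use q in auto)
  have FP: "F face_of P" "F \<subseteq> P" "w \<in> F" using F by (auto simp: lifts_def dest: face_of_imp_subset)
  have dF: "aff_dim F = 1" using lift_aff_dim[OF w F] qf by simp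
  have "F \<noteq> {}" "convex F" "collinear F"
    using FP face_of_imp_convex dF by (auto simp: collinear_aff_dim)
  then obtain a b where ab: "F = closed_segment a b" using compact_convex_collinear_segment cF by blast
  have "w extreme_point_of F" using w FP extreme_point_of_face by (auto simp: vertices_def)
  then have "w = a \<or> w = b" using ab extreme_point_of_segment by blast
  then obtain z where z: "F = closed_segment w z" using ab closed_segment_commute by metis
  have "z \<noteq> w" using z dF by auto
  have zP: "z \<in> P" "z \<in> F" using z FP by auto
  have "direction c w z = q" using F zP \<open>z \<noteq> w\<close> by (auto simp: lifts_def)
  then have "z = w + (c \<bullet> (z - w)) *\<^sub>R q" "0 < c \<bullet> (z - w)"
    using direction_eq[OF w(2) zP(1) \<open>z \<noteq> w\<close>] by auto
  moreover have "closed_segment w z \<in> compact_edges P"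
    using z FP \<open>z \<noteq> w\<close> by (simp add: compact_edge_iff)
  ultimately show thesis using that by metis
qed

text \<open>A segment of the figure through the edge direction, shrunk and attached at
  \<open>w\<close>, is a segment in \<open>P\<close> through a point of the edge. The face property
  puts its ends on the edge, hence on one ray from \<open>w\<close>, and the normalisation by
  \<open>c\<close> makes them equal.\<close>

lemma edge_direction_extreme:
  assumes w: "w \<in> vertices P" "exposes c w" and E: "closed_segment w z \<in> compact_edges P"
  shows "direction c w z extreme_point_of fig c w"
  unfolding extreme_point_of_def
proof (intro conjI ballI notI)
  have fE: "closed_segment w z face_of P" "w \<noteq> z" using E by (auto simp: compact_edge_iff)
  then have zP: "z \<in> P" "z \<noteq> w" using vertex_in segment_vertices by auto
  let ?q = "direction c w z"
  show qf: "?q \<in> fig c w" using direction_in_fig[OF w zP] .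
  define s where "s = c \<bullet> (z - w)"
  have s: "0 < s" "z = w + s *\<^sub>R ?q" unfolding s_def using direction_eq[OF w(2) zP] .
  fix a b assume ab: "a \<in> fig c w" "b \<in> fig c w" "?q \<in> open_segment a b"
  obtain ea where ea: "0 < ea" "\<And>r. 0 \<le> r \<Longrightarrow> r \<le> ea \<Longrightarrow> w + r *\<^sub>R a \<in> P" using fig_point[OF w ab(1)] by blast
  obtain eb where eb: "0 < eb" "\<And>r. 0 \<le> r \<Longrightarrow> r \<le> eb \<Longrightarrow> w + r *\<^sub>R b \<in> P" using fig_point[OF w ab(2)] by blast
  \<comment> \<open>Small enough for both shrunken ends to lie in \<open>P\<close> and for the point
    on the edge not to pass \<open>z\<close>.\<close>
  define e where "e = min s (min ea eb)"
  have e: "0 < e" "e \<le> s" "w + e *\<^sub>R a \<in> P" "w + e *\<^sub>R b \<in> P"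
    using s(1) ea(1) eb(1) by (auto simp: e_def intro!: ea(2) eb(2))
  obtain t where t: "a \<noteq> b" "0 < t" "t < 1" "?q = (1 - t) *\<^sub>R a + t *\<^sub>R b" using ab(3) by (auto simp: in_segment)
  have "w + e *\<^sub>R ?q = (1 - t) *\<^sub>R (w + e *\<^sub>R a) + t *\<^sub>R (w + e *\<^sub>R b)"
    unfolding t(4) by (simp add: algebra_simps)
  moreover have "w + e *\<^sub>R a \<noteq> w + e *\<^sub>R b" using t(1) e(1) by simp
  ultimately have os: "w + e *\<^sub>R ?q \<in> open_segment (w + e *\<^sub>R a) (w + e *\<^sub>R b)"
    unfolding in_segment using t by blast
  have "w + e *\<^sub>R ?q = (1 - e / s) *\<^sub>R w + (e / s) *\<^sub>R (w + s *\<^sub>R ?q)"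
    using s(1) by (simp add: algebra_simps)
  then have "w + e *\<^sub>R ?q = (1 - e / s) *\<^sub>R w + (e / s) *\<^sub>R z" using s(2) by simp
  then have "w + e *\<^sub>R ?q \<in> closed_segment w z"
    unfolding in_segment using e s(1) by (intro exI[of _ "e / s"]) auto
  then have "w + e *\<^sub>R a \<in> closed_segment w z" "w + e *\<^sub>R b \<in> closed_segment w z"
    using face_ofD[OF fE(1) os e(3,4)] by auto
  moreover have "x = ?q" if x: "w + e *\<^sub>R x \<in> closed_segment w z" and xf: "x \<in> fig c w" for x
  proof -
    obtain l where l: "0 \<le> l" "w + e *\<^sub>R x = (1 - l) *\<^sub>R w + l *\<^sub>R z" using x by (auto simp: in_segment)
    then have "e *\<^sub>R x = l *\<^sub>R (z - w)" by (simp add: algebra_simps)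
    then have "e *\<^sub>R x = (l * s) *\<^sub>R ?q" using s(2) by (metis add_diff_cancel_left' scaleR_scaleR)
    then have "c \<bullet> (e *\<^sub>R x) = c \<bullet> ((l * s) *\<^sub>R ?q)" by simp
    then have "e = l * s" using fig_normalized[OF w xf] fig_normalized[OF w qf] by simp
    then show ?thesis using \<open>e *\<^sub>R x = (l * s) *\<^sub>R ?q\<close> e(1) by auto
  qed
  ultimately have "a = ?q" "b = ?q" using ab by auto
  then show False using t(1) by simp
qed

text \<open>The simplex step: the direction towards \<open>x\<close> makes \<open>u\<close> negative
  somewhere on the figure, so \<open>u\<close> is negative at a vertex of the figure where it is
  minimal, and \<open>edge_at\<close> turns that vertex into an edge.\<close>

lemma descending_edge:
  assumes w: "w \<in> vertices P" and x: "x \<in> P" "u \<bullet> x < u \<bullet> w" and bdd: "\<And>x. x \<in> P \<Longrightarrow> m \<le> u \<bullet> x"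
  obtains z where "z \<in> vertices P" "closed_segment w z \<in> compact_edges P" "u \<bullet> z < u \<bullet> w"
proof -
  obtain c where c: "exposes c w" using exposes_exists[OF w] .
  have xw: "x \<noteq> w" using x by auto
  let ?d = "direction c w x"
  have d: "?d \<in> fig c w" using direction_in_fig[OF w c x(1) xw] .
  have "u \<bullet> x = u \<bullet> (w + (c \<bullet> (x - w)) *\<^sub>R ?d)" using direction_eq(2)[OF c x(1) xw] by simp
  then have "(c \<bullet> (x - w)) * (u \<bullet> ?d) < 0" using x(2) by (simp only: inner_add_right inner_scaleR_right)
  then have ud: "u \<bullet> ?d < 0" using direction_eq(1)[OF c x(1) xw] by (simp add: mult_less_0_iff)
  have "continuous_on (fig c w) (\<lambda>q. u \<bullet> q)" by (intro continuous_intros)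
  then obtain q0 where q0: "q0 \<in> fig c w" "\<And>q. q \<in> fig c w \<Longrightarrow> u \<bullet> q0 \<le> u \<bullet> q"
    using continuous_attains_inf[OF compact_fig, of c w] d by blast
  let ?G = "fig c w \<inter> {q. u \<bullet> q = u \<bullet> q0}"
  have G: "?G face_of fig c w" using face_of_Int_supporting_hyperplane_ge[OF convex_fig q0(2)] .
  have "compact ?G" "convex ?G" "?G \<noteq> {}"
    using compact_fig G face_of_imp_convex q0(1) face_of_imp_compact[OF convex_fig compact_fig G] by auto
  then obtain q where q: "q extreme_point_of ?G" by (rule extreme_point_exists_convex)
  then have "q extreme_point_of fig c w" "u \<bullet> q = u \<bullet> q0"
    using extreme_point_of_face[OF G] by auto
  moreover have "u \<bullet> q0 < 0" using q0(2)[OF d] ud by linarith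
  ultimately obtain s where s: "0 < s" "closed_segment w (w + s *\<^sub>R q) \<in> compact_edges P" and uq: "u \<bullet> q < 0"
    using edge_at[OF w c _ _ bdd, of q] by metis
  have "w + s *\<^sub>R q \<in> vertices P" using s(2) segment_vertices by (auto simp: compact_edge_iff)
  moreover have "u \<bullet> (w + s *\<^sub>R q) < u \<bullet> w" using s(1) uq by (simp add: inner_add_right mult_pos_neg)
  ultimately show thesis using that s(2) by blast
qed

text \<open>A descending walk from \<open>w\<close> can only stop at the strict minimum
  \<open>v\<close>; the number of vertices strictly below the current one measures its
  progress.\<close>

lemma descent_induct:
  assumes min: "\<And>x. x \<in> P \<Longrightarrow> x \<noteq> v \<Longrightarrow> u \<bullet> v < u \<bullet> x"
    and base: "\<Phi> v"
    and step: "\<And>w z. w \<in> vertices P \<Longrightarrow> z \<in> vertices P \<Longrightarrow> closed_segment w z \<in> compact_edges P \<Longrightarrow>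
      u \<bullet> z < u \<bullet> w \<Longrightarrow> \<Phi> z \<Longrightarrow> \<Phi> w"
    and v: "v \<in> P" and w: "w \<in> vertices P"
  shows "\<Phi> w"
  using w
proof (induction "card {z\<in>vertices P. u \<bullet> z < u \<bullet> w}" arbitrary: w rule: less_induct)
  case less
  show ?case
  proof (cases "w = v")
    case False
    have "u \<bullet> v < u \<bullet> w" using min[OF vertex_in[OF less.prems] False] .
    moreover have "u \<bullet> v \<le> u \<bullet> x" if "x \<in> P" for x using min[OF that] by (cases "x = v") auto
    ultimately obtain z where z: "z \<in> vertices P" "closed_segment w z \<in> compact_edges P" "u \<bullet> z < u \<bullet> w"
      using descending_edge[OF less.prems v] by blast
    have "{y\<in>vertices P. u \<bullet> y < u \<bullet> z} \<subset> {y\<in>vertices P. u \<bullet> y < u \<bullet> w}"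
      using z by auto
    then have "card {y\<in>vertices P. u \<bullet> y < u \<bullet> z} < card {y\<in>vertices P. u \<bullet> y < u \<bullet> w}"
      using finite_vertices_P by (intro psubset_card_mono) auto
    then have "\<Phi> z" using less.hyps z(1) by blast
    then show ?thesis using step less.prems z by blast
  qed (use base in simp)
qed

lemma compact_two_face_at:
  assumes w: "w \<in> vertices P" "exposes c w" and E: "closed_segment q q' face_of fig c w" "q \<noteq> q'"
    and u: "u \<bullet> q < 0" "u \<bullet> q' < 0" and bdd: "\<And>x. x \<in> P \<Longrightarrow> m \<le> u \<bullet> x"
  obtains F where "F \<in> compact_2_faces P" "lifts c w (closed_segment q q') F"
proof -
  obtain F where F: "lifts c w (closed_segment q q') F" using lift_exists[OF w E(1)] .
  have un: "u \<bullet> p < 0" if p: "p \<in> closed_segment q q'" for p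
  proof -
    have "closed_segment q q' \<subseteq> {x. u \<bullet> x < 0}"
      unfolding segment_convex_hull using u by (intro hull_minimal) (auto simp: convex_halfspace_lt)
    then show ?thesis using p by auto
  qed
  have "compact F" by (rule lift_compact[OF w F _ un bdd]) auto
  moreover have "aff_dim F = 2"
    using lift_aff_dim[OF w F face_of_imp_subset[OF E(1)]] E(2) by (simp add: segment_convex_hull aff_dim_convex_hull)
  ultimately have "F \<in> compact_2_faces P" using F by (auto simp: compact_2_faces_def lifts_def)
  then show thesis using that F by blast
qed

text \<open>Two edges from \<open>w\<close> on the same ray: if their lengths differed, the nearer
  end would lie inside the longer edge and not be extreme.\<close>

lemma edge_direction_inj:
  assumes w: "w \<in> vertices P" and c: "exposes c w"
    and y: "closed_segment w y \<in> compact_edges P" "closed_segment w y' \<in> compact_edges P"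
    and d: "direction c w y = direction c w y'"
  shows "y = y'"
proof -
  have yy: "y \<noteq> w" "y' \<noteq> w" "y \<in> vertices P" "y' \<in> vertices P"
    using y segment_vertices by (auto simp: compact_edge_iff)
  define p s s' where "p = direction c w y" and "s = c \<bullet> (y - w)" and "s' = c \<bullet> (y' - w)"
  have s: "0 < s" "y = w + s *\<^sub>R p" unfolding p_def s_def
    using direction_eq[OF c vertex_in[OF yy(3)] yy(1)] .
  have s': "0 < s'" "y' = w + s' *\<^sub>R p" unfolding p_def d s'_def
    using direction_eq[OF c vertex_in[OF yy(4)] yy(2)] .
  have ext': "y \<notin> open_segment w y'" "y' \<notin> open_segment w y"
  proof -
    have "w \<in> P" "y \<in> P" "y' \<in> P" by (simp_all add: vertex_in w yy)
    moreover have "y extreme_point_of P" "y' extreme_point_of P" using yy(3,4) by (simp_all add: vertices_def)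
    ultimately show "y \<notin> open_segment w y'" "y' \<notin> open_segment w y" by (simp_all add: extreme_point_of_def)
  qed
  have seg: "w + a *\<^sub>R p \<in> open_segment w (w + b *\<^sub>R p)" if "0 < a" "a < b" "p \<noteq> 0" for a b
  proof -
    have "w + a *\<^sub>R p = (1 - a / b) *\<^sub>R w + (a / b) *\<^sub>R (w + b *\<^sub>R p)"
      using that by (simp add: algebra_simps)
    then show ?thesis unfolding in_segment using that by (intro conjI exI[of _ "a / b"]) auto
  qed
  have "p \<noteq> 0" using s yy by auto
  have "\<not> s < s'" using seg[OF s(1) _ \<open>p \<noteq> 0\<close>, of s'] ext'(1) s(2) s'(2) by metis
  moreover have "\<not> s' < s" using seg[OF s'(1) _ \<open>p \<noteq> 0\<close>, of s] ext'(2) s(2) s'(2) by metis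
  ultimately show ?thesis using s(2) s'(2) by simp
qed

lemma polygon_degree:
  assumes cP: "compact P" and dP: "aff_dim P = 2" and w: "w \<in> vertices P"
  obtains z z' where "z \<noteq> z'" "{y. closed_segment w y \<in> compact_edges P} = {z, z'}"
proof -
  obtain c where c: "exposes c w" using exposes_exists[OF w] .
  have "aff_dim (fig c w) = 1" using lift_aff_dim[OF w c lifts_P[OF w c]] dP by simp
  then have "collinear (fig c w)" "fig c w \<noteq> {}" by (auto simp: collinear_aff_dim)
  then obtain q q' where qq: "fig c w = closed_segment q q'"
    using compact_convex_collinear_segment[OF _ compact_fig convex_fig] by blast
  have qne: "q \<noteq> q'" using qq \<open>aff_dim (fig c w) = 1\<close> by auto
  have ext: "p extreme_point_of fig c w \<longleftrightarrow> p = q \<or> p = q'" for p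
    unfolding qq by (rule extreme_point_of_segment)
  \<comment> \<open>\<open>edge_at\<close> needs a functional that is negative on the figure and
    bounded below on \<open>P\<close>. The negative of \<open>c\<close> is constantly -1 on the
    figure, and compactness of \<open>P\<close> supplies the bound, so both ends of the figure give
    edges.\<close>
  have "continuous_on P (\<lambda>x. (- c) \<bullet> x)" by (intro continuous_intros)
  then obtain x0 where x0: "x0 \<in> P" "\<And>x. x \<in> P \<Longrightarrow> (- c) \<bullet> x0 \<le> (- c) \<bullet> x"
    using continuous_attains_inf[OF cP P_nonempty] by blast
  have neg: "(- c) \<bullet> p < 0" if "p extreme_point_of fig c w" for p
    using fig_normalized[OF w c] that by (simp add: extreme_point_of_def)
  note uniq = edge_direction_inj[OF w c]
  obtain s where s: "0 < s" "closed_segment w (w + s *\<^sub>R q) \<in> compact_edges P"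
    using edge_at[OF w c, of q "- c"] ext neg x0(2) by blast
  obtain s' where s': "0 < s'" "closed_segment w (w + s' *\<^sub>R q') \<in> compact_edges P"
    using edge_at[OF w c, of q' "- c"] ext neg x0(2) by blast
  have cq: "c \<bullet> q = 1" "c \<bullet> q' = 1" using fig_normalized[OF w c] qq by auto
  have d: "direction c w (w + s *\<^sub>R q) = q" "direction c w (w + s' *\<^sub>R q') = q'"
    using direction_ray(1)[OF cq(1) s(1)] direction_ray(1)[OF cq(2) s'(1)] .
  show thesis
  proof (rule that)
    show "w + s *\<^sub>R q \<noteq> w + s' *\<^sub>R q'" using d qne by metis
    show "{y. closed_segment w y \<in> compact_edges P} = {w + s *\<^sub>R q, w + s' *\<^sub>R q'}"
    proof (intro equalityI subsetI)
      fix y assume "y \<in> {y. closed_segment w y \<in> compact_edges P}"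
      then have y: "closed_segment w y \<in> compact_edges P" by simp
      have "direction c w y = q \<or> direction c w y = q'"
        using edge_direction_extreme[OF w c y] ext by blast
      then show "y \<in> {w + s *\<^sub>R q, w + s' *\<^sub>R q'}" using uniq[OF y s(2)] uniq[OF y s'(2)] d by auto
    qed (use s s' in auto)
  qed
qed

end

section \<open>Boundary cycles of polygons\<close>

text \<open>The longest path starting at \<open>w\<close> closes up to a cycle through all vertices.\<close>

lemma two_regular_connected_cycle:
  assumes fin: "finite V" and wV: "w \<in> V"
    and sym: "\<And>x y. adj x y \<Longrightarrow> adj y x" and irr: "\<And>x. \<not> adj x x"
    and inV: "\<And>x y. x \<in> V \<Longrightarrow> adj x y \<Longrightarrow> y \<in> V"
    and deg: "\<And>x. x \<in> V \<Longrightarrow> \<exists>a b. a \<noteq> b \<and> {y. adj x y} = {a, b}"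
    and conn: "\<And>S. S \<subseteq> V \<Longrightarrow> w \<in> S \<Longrightarrow> (\<And>x y. x \<in> S \<Longrightarrow> adj x y \<Longrightarrow> y \<in> S) \<Longrightarrow> V \<subseteq> S"
  obtains vs where "distinct vs" "set vs = V" "3 \<le> length vs" "vs ! 0 = w"
    "\<And>i. i < length vs \<Longrightarrow> adj (vs ! i) (vs ! (Suc i mod length vs))"
proof -
  define path where "path xs \<longleftrightarrow> xs \<noteq> [] \<and> xs ! 0 = w \<and> distinct xs \<and> set xs \<subseteq> V \<and>
    (\<forall>i. Suc i < length xs \<longrightarrow> adj (xs ! i) (xs ! Suc i))" for xs
  have "path [w]" using wV by (simp add: path_def)
  moreover have "\<forall>xs. path xs \<longrightarrow> length xs < Suc (card V)"
    using fin by (auto simp: path_def less_Suc_eq_le distinct_card[symmetric] card_mono)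
  ultimately obtain xs where xs: "path xs" and max: "\<And>ys. path ys \<Longrightarrow> length ys \<le> length xs"
    using ex_has_greatest_nat[of path "[w]" length "Suc (card V)"] by blast
  define n where "n = length xs"
  define l where "l = xs ! (n - 1)"
  have p: "xs \<noteq> []" "xs ! 0 = w" "distinct xs" "set xs \<subseteq> V"
    and adjS: "\<And>i. Suc i < n \<Longrightarrow> adj (xs ! i) (xs ! Suc i)"
    using xs by (auto simp: path_def n_def)
  have n0: "0 < n" using p(1) by (simp add: n_def)
  have nth_V: "xs ! i \<in> V" if "i < n" for i using p(4) that by (auto simp: n_def)
  have inj: "xs ! i = xs ! j \<longleftrightarrow> i = j" if "i < n" "j < n" for i j
    using that p(3) by (simp add: n_def nth_eq_iff_index_eq)
  have lV: "l \<in> V" using nth_V n0 by (simp add: l_def)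
  have closed: "y \<in> set xs" if y: "adj l y" for y
  proof (rule ccontr)
    assume "y \<notin> set xs"
    have "path (xs @ [y])"
      unfolding path_def
    proof (intro conjI allI impI)
      show "(xs @ [y]) ! 0 = w" using p by (simp add: nth_append)
      show "distinct (xs @ [y])" using p \<open>y \<notin> set xs\<close> by simp
      show "set (xs @ [y]) \<subseteq> V" using p inV[OF lV y] by simp
      fix i assume i: "Suc i < length (xs @ [y])"
      show "adj ((xs @ [y]) ! i) ((xs @ [y]) ! Suc i)"
      proof (cases "Suc i < n")
        case True then show ?thesis using adjS[OF True] by (simp add: nth_append n_def)
      next
        case False
        then have "i = n - 1" "Suc i = n" using i n0 by (auto simp: n_def)
        then show ?thesis using y n0 by (simp add: nth_append n_def l_def)
      qed
    qed simp
    then show False using max by fastforce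
  qed
  have two: "y = a \<or> y = b" if x: "x \<in> V" and nb: "adj x a" "adj x b" "adj x y" and ne: "a \<noteq> b" for x y a b
  proof -
    obtain a' b' where ab': "{y. adj x y} = {a', b'}" using deg[OF x] by blast
    have "a \<in> {a', b'}" "b \<in> {a', b'}" "y \<in> {a', b'}" using nb ab' by blast+
    then show ?thesis using ne by auto
  qed
  \<comment> \<open>The end of the path has two neighbours, so one of them is not its predecessor.
    The guard covers the one-point path, where \<open>n - 2\<close> truncates to 0 and there is no
    predecessor.\<close>
  obtain y where y: "adj l y" "n \<ge> 2 \<Longrightarrow> y \<noteq> xs ! (n - 2)"
  proof -
    obtain a b where "a \<noteq> b" "{y. adj l y} = {a, b}" using deg[OF lV] by blast
    then have "adj l a" "adj l b" "a \<noteq> xs ! (n - 2) \<or> b \<noteq> xs ! (n - 2)" by auto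
    then show thesis using that by blast
  qed
  obtain i where i: "i < n" "y = xs ! i" using closed[OF y(1)] by (auto simp: in_set_conv_nth n_def)
  have "i \<noteq> n - 1" using irr y(1) i(2) by (auto simp: l_def)
  then have "n \<ge> 2" using i by linarith
  then have "i \<noteq> n - 2" using y(2) i by auto
  have ilt: "i < n - 2" using i \<open>i \<noteq> n - 1\<close> \<open>i \<noteq> n - 2\<close> \<open>n \<ge> 2\<close> by linarith
  \<comment> \<open>Otherwise \<open>xs ! i\<close> has three different neighbours: its predecessor,
    its successor and the end of the path.\<close>
  have i0: "i = 0"
  proof (rule ccontr)
    assume "i \<noteq> 0"
    then obtain k where k: "i = Suc k" by (cases i) auto
    have "adj (xs ! i) (xs ! k)" using adjS[of k] i(1) sym by (simp add: k)
    moreover have "adj (xs ! i) (xs ! Suc i)" using adjS[of i] ilt by simp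
    moreover have "adj (xs ! i) (xs ! (n - 1))" using y(1) i(2) sym by (simp add: l_def)
    moreover have "xs ! k \<noteq> xs ! Suc i" using inj[of k "Suc i"] ilt k by simp
    ultimately have "xs ! (n - 1) = xs ! k \<or> xs ! (n - 1) = xs ! Suc i"
      using two[OF nth_V[OF i(1)]] by blast
    then show False using inj[of "n - 1" k] inj[of "n - 1" "Suc i"] ilt k by auto
  qed
  have n3: "3 \<le> n" using ilt by simp
  have close: "adj (xs ! (n - 1)) w" using y(1) i(2) i0 p(2) by (simp add: l_def)
  have cyc: "adj (xs ! j) (xs ! (Suc j mod n))" if "j < n" for j
  proof (cases "Suc j < n")
    case False
    then have "j = n - 1" "Suc j = n" using that by auto
    then show ?thesis using close p(2) by simp
  qed (use adjS in simp)
  \<comment> \<open>Each vertex of the cycle finds both of its neighbours on the cycle, so the cycle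
    is closed under adjacency.\<close>
  have "V \<subseteq> set xs"
  proof (rule conn)
    show "set xs \<subseteq> V" by (rule p(4))
    show "w \<in> set xs" using p(1,2) by (metis nth_mem length_greater_0_conv)
    fix x z assume "x \<in> set xs" and z: "adj x z"
    then obtain j where j: "j < n" "x = xs ! j" by (auto simp: in_set_conv_nth n_def)
    \<comment> \<open>The cyclic predecessor of \<open>j\<close>; it differs from the cyclic
      successor because the cycle has length at least 3.\<close>
    define j' where "j' = (if j = 0 then n - 1 else j - 1)"
    have j': "j' < n" "Suc j' mod n = j" "j' \<noteq> Suc j mod n"
      using j(1) n3 by (auto simp: j'_def mod_Suc)
    have "adj x (xs ! j')" using cyc[OF j'(1)] j'(2) j(2) sym by simp
    moreover have "adj x (xs ! (Suc j mod n))" using cyc[OF j(1)] j(2) by simp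
    moreover have "xs ! j' \<noteq> xs ! (Suc j mod n)" using inj[OF j'(1)] j'(3) n0 by simp
    ultimately have "z = xs ! j' \<or> z = xs ! (Suc j mod n)"
      using two[OF nth_V[OF j(1)] _ _ z[unfolded j(2)]] j(2) by blast
    moreover have "xs ! k \<in> set xs" if "k < n" for k using that by (simp add: n_def)
    moreover have "Suc j mod n < n" using n0 by simp
    ultimately show "z \<in> set xs" using j'(1) by blast
  qed
  then show thesis using that[of xs] p n3 cyc by (auto simp: n_def)
qed

text \<open>Each strict inequality between two values of \<open>u\<close> survives a sufficiently
  small tilt, and finitely many pairs are involved. The tilted functional thus refines the preorder
  given by \<open>u\<close> on \<open>V\<close>.\<close>

lemma lex_perturbation:
  fixes u r :: "'a::real_inner"
  assumes "finite V"
  obtains e :: real where "0 < e"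
    "\<And>x y. x \<in> V \<Longrightarrow> y \<in> V \<Longrightarrow> u \<bullet> x < u \<bullet> y \<Longrightarrow> (u + e *\<^sub>R r) \<bullet> x < (u + e *\<^sub>R r) \<bullet> y"
proof -
  have ev: "eventually (\<lambda>e. u \<bullet> x < u \<bullet> y \<longrightarrow> (u + e *\<^sub>R r) \<bullet> x < (u + e *\<^sub>R r) \<bullet> y) (at_right 0)" for x y
  proof (cases "u \<bullet> x < u \<bullet> y")
    case True
    have "((\<lambda>e. (u + e *\<^sub>R r) \<bullet> y - (u + e *\<^sub>R r) \<bullet> x) \<longlongrightarrow> (u + 0 *\<^sub>R r) \<bullet> y - (u + 0 *\<^sub>R r) \<bullet> x) (at_right 0)"
      by (intro tendsto_intros)
    then have "eventually (\<lambda>e. 0 < (u + e *\<^sub>R r) \<bullet> y - (u + e *\<^sub>R r) \<bullet> x) (at_right 0)"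
      by (rule order_tendstoD(1)) (use True in simp)
    then show ?thesis by (rule eventually_mono) simp
  qed simp
  have "eventually (\<lambda>e. \<forall>p\<in>V \<times> V. u \<bullet> fst p < u \<bullet> snd p \<longrightarrow> (u + e *\<^sub>R r) \<bullet> fst p < (u + e *\<^sub>R r) \<bullet> snd p) (at_right 0)"
    using assms ev by (intro eventually_ball_finite) auto
  moreover have "eventually (\<lambda>e::real. 0 < e) (at_right 0)" by (rule eventually_at_right_less)
  ultimately have "eventually (\<lambda>e::real. 0 < e \<and> (\<forall>p\<in>V \<times> V. u \<bullet> fst p < u \<bullet> snd p \<longrightarrow> (u + e *\<^sub>R r) \<bullet> fst p < (u + e *\<^sub>R r) \<bullet> snd p)) (at_right 0)"
    by eventually_elim auto
  then obtain e :: real where e: "0 < e" "\<forall>p\<in>V \<times> V. u \<bullet> fst p < u \<bullet> snd p \<longrightarrow> (u + e *\<^sub>R r) \<bullet> fst p < (u + e *\<^sub>R r) \<bullet> snd p"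
    using eventually_happens'[of "at_right (0::real)"] trivial_limit_at_right_real by blast
  show thesis
    using e by (intro that[of e]) force+
qed

lemma nonneg_perturbation:
  fixes a b :: real
  assumes "\<And>e. 0 < e \<Longrightarrow> 0 \<le> a + e * b"
  shows "0 \<le> a"
proof (rule ccontr)
  assume "\<not> 0 \<le> a"
  \<comment> \<open>Chosen so that \<open>e * b\<close> is at most \<open>- a / 2\<close>; adding 1
    to the absolute value avoids division by zero.\<close>
  define e where "e = - a / (2 * (\<bar>b\<bar> + 1))"
  have e: "0 < e" unfolding e_def using \<open>\<not> 0 \<le> a\<close> by (intro divide_pos_pos) auto
  have "e * b \<le> e * (\<bar>b\<bar> + 1)" using e by (intro mult_left_mono) auto
  also have "\<dots> = - a / 2"
  proof -
    have "\<bar>b\<bar> + 1 \<noteq> 0" by linarith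
    then show ?thesis unfolding e_def by (simp add: divide_simps)
  qed
  finally show False using assms[OF e] \<open>\<not> 0 \<le> a\<close> by linarith
qed

context pointed_polyhedron
begin

lemma compact_2_face_polygon:
  assumes F: "F \<in> compact_2_faces P"
  shows "pointed_polyhedron F" "compact F" "aff_dim F = 2" "F face_of P" "vertices F = vertices P \<inter> F"
proof -
  show fF: "F face_of P" and cF: "compact F" and dF: "aff_dim F = 2" using F by (auto simp: compact_2_faces_def)
  have ne: "F \<noteq> {}" using dF by auto
  show "vertices F = vertices P \<inter> F" by (rule face_pointed(2)[OF fF ne])
  have "convex F" using fF face_of_imp_convex by blast
  then obtain x where "x extreme_point_of F" using extreme_point_exists_convex[OF cF _ ne] by blast
  then show "pointed_polyhedron F"
    using face_pointed(1)[OF fF ne] by unfold_locales (auto simp: vertices_def)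
qed

text \<open>\<open>CP\<close> quantifies over all boundary cycles, so its closing condition says
  something about \<open>F\<close> only once a cycle exists. The edge graph of \<open>F\<close> has
  degree two by \<open>polygon_degree\<close> and is connected by descent to
  \<open>w\<close>.\<close>

lemma boundary_cycle_exists:
  assumes F: "F \<in> compact_2_faces P" and w: "w \<in> vertices F"
  obtains vs where "boundary_cycle F vs" "3 \<le> length vs" "vs ! 0 = w"
proof -
  interpret F: pointed_polyhedron F using compact_2_face_polygon(1)[OF F] .
  have sym: "closed_segment x y \<in> compact_edges F \<Longrightarrow> closed_segment y x \<in> compact_edges F" for x y
    by (simp add: closed_segment_commute)
  have irr: "closed_segment x x \<notin> compact_edges F" for x
    unfolding F.compact_edge_iff by simp
  have inV: "y \<in> vertices F" if "closed_segment x y \<in> compact_edges F" for x y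
    using that F.segment_vertices unfolding F.compact_edge_iff by blast
  have deg: "\<exists>a b. a \<noteq> b \<and> {y. closed_segment x y \<in> compact_edges F} = {a, b}" if "x \<in> vertices F" for x
    using F.polygon_degree[OF compact_2_face_polygon(2,3)[OF F] that] by metis
  have conn: "vertices F \<subseteq> S" if S: "w \<in> S" "\<And>x y. x \<in> S \<Longrightarrow> closed_segment x y \<in> compact_edges F \<Longrightarrow> y \<in> S" for S
  proof
    fix x assume x: "x \<in> vertices F"
    obtain c where c: "F.exposes c w" using F.exposes_exists[OF w] .
    show "x \<in> S"
    proof (rule F.descent_induct[of w c "\<lambda>x. x \<in> S"])
      show "c \<bullet> w < c \<bullet> x" if "x \<in> F" "x \<noteq> w" for x using c that by (simp add: F.exposes_def)
      show "a \<in> S" if "closed_segment a b \<in> compact_edges F" "b \<in> S" for a b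
        using S(2)[OF that(2) sym[OF that(1)]] .
    qed (use S w F.vertex_in x in auto)
  qed
  show thesis
  proof (rule two_regular_connected_cycle[where adj = "\<lambda>x y. closed_segment x y \<in> compact_edges F" and V = "vertices F" and w = w])
    show "finite (vertices F)" by (rule F.finite_vertices_P)
    show "w \<in> vertices F" by (rule w)
    show "vertices F \<subseteq> S" if "S \<subseteq> vertices F" "w \<in> S"
      "\<And>x y. x \<in> S \<Longrightarrow> closed_segment x y \<in> compact_edges F \<Longrightarrow> y \<in> S" for S
      using conn[OF that(2,3)] .
    show "closed_segment y x \<in> compact_edges F" if "closed_segment x y \<in> compact_edges F" for x y
      using that by (rule sym)
    show "closed_segment x x \<notin> compact_edges F" for x by (rule irr)
    show "y \<in> vertices F" if "closed_segment x y \<in> compact_edges F" for x y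
      using that by (rule inV)
    show "\<exists>a b. a \<noteq> b \<and> {y. closed_segment x y \<in> compact_edges F} = {a, b}" if "x \<in> vertices F" for x
      using that by (rule deg)
  next
    fix vs assume vs: "distinct vs" "set vs = vertices F" "3 \<le> length vs" "vs ! 0 = w"
      "\<And>i. i < length vs \<Longrightarrow> closed_segment (vs ! i) (vs ! (Suc i mod length vs)) \<in> compact_edges F"
    then have "boundary_cycle F vs" by (auto simp: boundary_cycle_def compact_edges_def)
    then show thesis using that vs by blast
  qed
qed

section \<open>The vertices of the Minkowski summands\<close>

lemma linear_minimum_at_vertex:
  assumes "\<And>a. a \<in> tail P \<Longrightarrow> 0 \<le> u \<bullet> a"
  obtains v where "v \<in> vertices P" "\<And>x. x \<in> P \<Longrightarrow> u \<bullet> v \<le> u \<bullet> x"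
proof -
  obtain v where v: "v \<in> vertices P" "\<And>k. k \<in> convex hull vertices P \<Longrightarrow> u \<bullet> v \<le> u \<bullet> k"
    using linear_minimum_convex_hull[OF finite_vertices_P vertices_nonempty] by blast
  have "u \<bullet> v \<le> u \<bullet> x" if x: "x \<in> P" for x
  proof -
    obtain k a where k: "k \<in> convex hull vertices P" "a \<in> tail P" "x = k + a" using decompose[OF x] .
    then show ?thesis using v(2)[OF k(1)] assms[OF k(2)] by (simp add: inner_add_right)
  qed
  then show thesis using that v(1) by blast
qed

text \<open>Functionals positive on the nonzero tail generators form an open set, nonempty since it
  contains any functional exposing a vertex. Those that take equal values at two vertices lie in
  finitely many hyperplanes, a negligible set.\<close>

lemma generic_functional:
  obtains u m where "inj_on (\<lambda>v. u \<bullet> v) (vertices P)" "\<And>x. x \<in> P \<Longrightarrow> m \<le> u \<bullet> x"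
proof -
  obtain w where w: "w \<in> vertices P" using vertices_nonempty by auto
  obtain c where c: "exposes c w" using exposes_exists[OF w] .
  define U where "U = (\<Inter>g\<in>gens - {0}. {u. 0 < g \<bullet> u})"
  have "open U" unfolding U_def using finite_gens by (intro open_INT) (auto simp: open_halfspace_gt)
  moreover have "c \<in> U" using dirs_pos(1)[OF w c] by (auto simp: U_def dirs_def inner_commute)
  ultimately have nU: "\<not> negligible U" using open_not_negligible by blast
  define N where "N = (\<Union>p\<in>{p\<in>vertices P \<times> vertices P. fst p \<noteq> snd p}. {u. (fst p - snd p) \<bullet> u = 0})"
  have "finite {p\<in>vertices P \<times> vertices P. fst p \<noteq> snd p}" using finite_vertices_P by simp
  then have "negligible N"
    unfolding N_def by (intro negligible_Union finite_imageI) (auto intro!: negligible_hyperplane)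
  then have "\<not> U \<subseteq> N" using nU negligible_subset by blast
  then obtain u where u: "u \<in> U" "u \<notin> N" by blast
  have inj: "inj_on (\<lambda>v. u \<bullet> v) (vertices P)"
  proof (rule inj_onI)
    fix x y assume xy: "x \<in> vertices P" "y \<in> vertices P" "u \<bullet> x = u \<bullet> y"
    show "x = y"
    proof (rule ccontr)
      assume "x \<noteq> y"
      have "(x - y) \<bullet> u = 0" using xy(3) by (simp add: inner_commute[of "x - y"] inner_diff_right)
      then show False using u(2) xy \<open>x \<noteq> y\<close> by (force simp: N_def)
    qed
  qed
  have "0 \<le> u \<bullet> a" if "a \<in> tail P" for a
  proof -
    have "gens \<subseteq> {x. u \<bullet> x \<ge> 0}"
    proof
      fix g assume "g \<in> gens" then show "g \<in> {x. u \<bullet> x \<ge> 0}"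
        using u(1) by (cases "g = 0") (auto simp: U_def inner_commute less_imp_le)
    qed
    then have "convex_cone hull gens \<subseteq> {x. u \<bullet> x \<ge> 0}" by (intro hull_minimal convex_cone_halfspace_ge)
    then show ?thesis using that tail_gens by auto
  qed
  then obtain v where "\<And>x. x \<in> P \<Longrightarrow> u \<bullet> v \<le> u \<bullet> x" using linear_minimum_at_vertex by metis
  then show thesis using that inj by blast
qed

text \<open>Compatibility is relative to a set \<open>S\<close> of vertices so that the map can be
  built up one vertex at a time.\<close>

definition vmap :: "('a set \<Rightarrow>\<^sub>0 real) \<Rightarrow> 'a set \<Rightarrow> ('a \<Rightarrow> 'a) \<Rightarrow> bool" where
  "vmap \<xi> S \<phi> \<longleftrightarrow> (\<forall>v\<in>S. \<forall>w\<in>S. closed_segment v w \<in> compact_edges P \<longrightarrow>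
     \<phi> w - \<phi> v = tcoord \<xi> v w *\<^sub>R (w - v))"

text \<open>The two edges of the polygon at \<open>w\<close> predict the same image of \<open>w\<close>, because the boundary
  closes up.\<close>

lemma polygon_consistency:
  assumes \<xi>: "\<xi> \<in> CP P" and F: "F \<in> compact_2_faces P" and w: "w \<in> vertices F"
    and S: "\<And>y. y \<in> vertices F \<Longrightarrow> y \<noteq> w \<Longrightarrow> y \<in> S" and \<phi>: "vmap \<xi> S \<phi>"
    and z: "closed_segment w z1 \<in> compact_edges F" "closed_segment w z2 \<in> compact_edges F"
  shows "\<phi> z1 + tcoord \<xi> w z1 *\<^sub>R (w - z1) = \<phi> z2 + tcoord \<xi> w z2 *\<^sub>R (w - z2)"
proof -
  interpret F: pointed_polyhedron F using compact_2_face_polygon(1)[OF F] .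
  have fF: "F face_of P" using compact_2_face_polygon(4)[OF F] .
  obtain vs where bc: "boundary_cycle F vs" and n3: "3 \<le> length vs" and v0: "vs ! 0 = w"
    using boundary_cycle_exists[OF F w] .
  define n where "n = length vs"
  \<comment> \<open>With at least three vertices, the terms with index \<open>0\<close> and
    \<open>Suc (Suc k)\<close> belong to different edges at \<open>w\<close>; the terms between them
    avoid \<open>w\<close> and telescope.\<close>
  obtain k where k: "n = Suc (Suc (Suc k))"
    using n3 by (metis n_def numeral_3_eq_3 le_Suc_ex add_Suc)
  define f where "f i = tcoord \<xi> (vs ! i) (vs ! (Suc i mod n)) *\<^sub>R (vs ! (Suc i mod n) - vs ! i)" for i
  have sum0: "(\<Sum>i<n. f i) = 0" using \<xi> F bc unfolding CP_def f_def n_def by blast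
  have edge: "closed_segment (vs ! i) (vs ! (Suc i mod n)) \<in> compact_edges F" if "i < n" for i
    using bc that by (auto simp: boundary_cycle_def compact_edges_def n_def)
  have edgeP: "E \<in> compact_edges P" if "E \<in> compact_edges F" for E
    using that face_of_trans[OF _ fF, of E] by (simp add: compact_edges_def edge_of_def)
  have dist: "distinct vs" "set vs = vertices F" using bc by (auto simp: boundary_cycle_def)
  have nS: "vs ! i \<in> S" if "0 < i" "i < n" for i
  proof (rule S)
    show "vs ! i \<in> vertices F" using nth_mem[of i vs] that(2) unfolding dist(2) n_def by blast
    have "vs ! i \<noteq> vs ! 0" using that nth_eq_iff_index_eq[OF dist(1), of i 0] unfolding n_def by force
    then show "vs ! i \<noteq> w" using v0 by simp
  qed
  have mid: "f i = \<phi> (vs ! Suc i) - \<phi> (vs ! i)" if "0 < i" "Suc i < n" for i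
  proof -
    have "closed_segment (vs ! i) (vs ! Suc i) \<in> compact_edges P" using edgeP[OF edge[of i]] that by simp
    then show ?thesis using \<phi> nS[of i] nS[of "Suc i"] that by (simp add: vmap_def f_def)
  qed
  have "(\<Sum>i<n. f i) = (\<Sum>i<Suc (Suc k). f i) + f (Suc (Suc k))"
    unfolding k by (rule sum.lessThan_Suc)
  also have "(\<Sum>i<Suc (Suc k). f i) = f 0 + (\<Sum>i<Suc k. f (Suc i))"
    by (rule sum.lessThan_Suc_shift)
  also have "(\<Sum>i<Suc k. f (Suc i)) = (\<Sum>i<Suc k. \<phi> (vs ! Suc (Suc i)) - \<phi> (vs ! Suc i))"
    by (rule sum.cong) (auto simp: k intro!: mid)
  also have "\<dots> = \<phi> (vs ! Suc (Suc k)) - \<phi> (vs ! Suc 0)"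
    by (rule sum_lessThan_telescope)
  finally have tot: "f 0 + (\<phi> (vs ! Suc (Suc k)) - \<phi> (vs ! Suc 0)) + f (Suc (Suc k)) = 0" using sum0 by simp
  let ?a = "vs ! Suc 0" and ?b = "vs ! Suc (Suc k)"
  have fa: "f 0 = - (tcoord \<xi> w ?a *\<^sub>R (w - ?a))" and fb: "f (Suc (Suc k)) = tcoord \<xi> w ?b *\<^sub>R (w - ?b)"
    by (simp_all add: f_def k v0 closed_segment_commute scaleR_diff_right)
  have eq: "\<phi> ?a + tcoord \<xi> w ?a *\<^sub>R (w - ?a) = \<phi> ?b + tcoord \<xi> w ?b *\<^sub>R (w - ?b)"
  proof -
    have "\<phi> ?b + tcoord \<xi> w ?b *\<^sub>R (w - ?b) - (\<phi> ?a + tcoord \<xi> w ?a *\<^sub>R (w - ?a)) =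
        - (tcoord \<xi> w ?a *\<^sub>R (w - ?a)) + (\<phi> ?b - \<phi> ?a) + tcoord \<xi> w ?b *\<^sub>R (w - ?b)"
      by simp
    also have "\<dots> = 0" using tot unfolding fa fb .
    finally show ?thesis by simp
  qed
  have ea: "closed_segment w ?a \<in> compact_edges F" using edge[of 0] by (simp add: k v0)
  have eb: "closed_segment w ?b \<in> compact_edges F" using edge[of "Suc (Suc k)"] by (simp add: k v0 closed_segment_commute)
  have "?a \<noteq> ?b" using k nth_eq_iff_index_eq[OF dist(1), of "Suc 0" "Suc (Suc k)"] by (simp add: n_def)
  obtain p q where pq: "{y. closed_segment w y \<in> compact_edges F} = {p, q}"
    using F.polygon_degree[OF compact_2_face_polygon(2,3)[OF F] w] by metis
  \<comment> \<open>Only two edges of the polygon meet at \<open>w\<close>, so \<open>z1\<close> and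
    \<open>z2\<close> are among the two neighbours of \<open>w\<close> on the cycle.\<close>
  have "y \<in> {p, q}" if "closed_segment w y \<in> compact_edges F" for y
    unfolding pq[symmetric] using that by (rule CollectI)
  from this[OF ea] this[OF eb] this[OF z(1)] this[OF z(2)] \<open>?a \<noteq> ?b\<close>
  have "z1 = ?a \<or> z1 = ?b" "z2 = ?a \<or> z2 = ?b" by (metis insert_iff singletonD)+
  then show ?thesis using eq by auto
qed

text \<open>A simplex path in the vertex figure along which \<open>u\<close> stays negative connects the lower edges at
  \<open>w\<close>; each of its steps is a compact polygon with top \<open>w\<close>.\<close>

lemma vertex_consistency:
  assumes \<xi>: "\<xi> \<in> CP P" and w: "w \<in> vertices P" and bdd: "\<And>x. x \<in> P \<Longrightarrow> m \<le> u \<bullet> x"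
    and \<phi>: "vmap \<xi> {y\<in>vertices P. u \<bullet> y < u \<bullet> w} \<phi>"
  shows "\<exists>p. \<forall>z. closed_segment w z \<in> compact_edges P \<longrightarrow> u \<bullet> z < u \<bullet> w \<longrightarrow>
    \<phi> z + tcoord \<xi> w z *\<^sub>R (w - z) = p"
proof (cases "\<exists>z. closed_segment w z \<in> compact_edges P \<and> u \<bullet> z < u \<bullet> w")
  case True
  then obtain z0 where z0: "closed_segment w z0 \<in> compact_edges P" "u \<bullet> z0 < u \<bullet> w" by blast
  obtain c where c: "exposes c w" using exposes_exists[OF w] .
  let ?Q = "fig c w"
  have ext0: "direction c w z0 extreme_point_of ?Q" by (rule edge_direction_extreme[OF w c z0(1)])
  interpret Q: pointed_polyhedron ?Q
    using polyhedron_fig ext0 by unfold_locales (auto simp: vertices_def)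
  \<comment> \<open>The figure is compact, so its tail is trivial and every functional attains its
    minimum over it at a vertex.\<close>
  have tailQ: "tail ?Q = {0}"
  proof -
    have "a = 0" if a: "a \<in> tail ?Q" for a
    proof (rule ccontr)
      assume "a \<noteq> 0"
      obtain B where B: "\<And>x. x \<in> ?Q \<Longrightarrow> norm x \<le> B" using compact_imp_bounded[OF compact_fig] bounded_iff by metis
      obtain q where q: "q \<in> ?Q" using Q.P_nonempty by auto
      have "q + real n *\<^sub>R a \<in> ?Q" for n
        using Q.add_tail[OF q] convex_cone_scaleR[OF Q.convex_cone_tail_P _ a] by simp
      then have nb: "norm (q + real n *\<^sub>R a) \<le> B" for n using B by blast
      obtain n where n: "B + norm q < real n * norm a"
        using reals_Archimedean3[of "norm a"] \<open>a \<noteq> 0\<close> by (metis zero_less_norm_iff)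
      have "norm (real n *\<^sub>R a) \<le> norm (q + real n *\<^sub>R a) + norm q"
        by (metis add_diff_cancel_left' norm_triangle_ineq4)
      then show False using nb[of n] n by simp
    qed
    then show ?thesis using convex_cone_contains_0[OF Q.convex_cone_tail_P] by auto
  qed
  have usign: "u \<bullet> direction c w z < 0 \<longleftrightarrow> u \<bullet> z < u \<bullet> w" if z: "z \<in> P" "z \<noteq> w" for z
  proof -
    have "u \<bullet> z = u \<bullet> (w + (c \<bullet> (z - w)) *\<^sub>R direction c w z)" using direction_eq(2)[OF c z] by simp
    then have "u \<bullet> z = u \<bullet> w + (c \<bullet> (z - w)) * (u \<bullet> direction c w z)" by (simp only: inner_add_right inner_scaleR_right)
    then show ?thesis using direction_eq(1)[OF c z] by (simp add: mult_less_0_iff)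
  qed
  have nbr: "z \<in> P" "z \<noteq> w" "z \<in> vertices P" if "closed_segment w z \<in> compact_edges P" for z
    using that segment_vertices vertex_in by (auto simp: compact_edge_iff)
  have lower: "\<exists>z. closed_segment w z \<in> compact_edges P \<and> u \<bullet> z < u \<bullet> w \<and> direction c w z = q"
    if q: "q \<in> vertices ?Q" "u \<bullet> q < 0" for q
  proof -
    obtain s where s: "0 < s" "closed_segment w (w + s *\<^sub>R q) \<in> compact_edges P"
      using edge_at[OF w c _ q(2) bdd] q(1) by (auto simp: vertices_def)
    have "direction c w (w + s *\<^sub>R q) = q"
      using direction_ray(1)[OF fig_normalized[OF w c Q.vertex_in[OF q(1)]] s(1)] .
    then show ?thesis using s usign[OF nbr(1,2)[OF s(2)]] q(2) by auto
  qed
  obtain qm where qm: "qm \<in> vertices ?Q" "\<And>x. x \<in> ?Q \<Longrightarrow> u \<bullet> qm \<le> u \<bullet> x"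
    using Q.linear_minimum_at_vertex[of u] tailQ by auto
  have "u \<bullet> qm \<le> u \<bullet> direction c w z0" using qm(2) ext0 by (simp add: extreme_point_of_def)
  also have "\<dots> < 0" using usign[OF nbr(1,2)[OF z0(1)]] z0(2) by simp
  finally have uqm: "u \<bullet> qm < 0" .
  obtain zm where zm: "closed_segment w zm \<in> compact_edges P" "u \<bullet> zm < u \<bullet> w" "direction c w zm = qm"
    using lower[OF qm(1) uqm] by blast
  obtain r where r: "Q.exposes r qm" using Q.exposes_exists[OF qm(1)] .
  \<comment> \<open>\<open>u\<close> may take equal values at vertices of the figure. The tilt by
    \<open>r\<close> makes \<open>qm\<close> the strict minimum, and \<open>e\<close> is so small
    that an edge descending for the tilted functional never raises \<open>u\<close>; the walk
    therefore stays where \<open>u\<close> is negative.\<close>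
  obtain e where e: "0 < e" and lex: "\<And>x y. x \<in> vertices ?Q \<Longrightarrow> y \<in> vertices ?Q \<Longrightarrow> u \<bullet> x < u \<bullet> y \<Longrightarrow>
      (u + e *\<^sub>R r) \<bullet> x < (u + e *\<^sub>R r) \<bullet> y"
    using lex_perturbation[OF Q.finite_vertices_P] by metis
  define p where "p = \<phi> zm + tcoord \<xi> w zm *\<^sub>R (w - zm)"
  let ?val = "\<lambda>z. \<phi> z + tcoord \<xi> w z *\<^sub>R (w - z)"
  let ?\<Phi> = "\<lambda>q. u \<bullet> q < 0 \<longrightarrow> (\<forall>z. closed_segment w z \<in> compact_edges P \<longrightarrow> direction c w z = q \<longrightarrow> ?val z = p)"
  have main: "?\<Phi> q" if q: "q \<in> vertices ?Q" for q
  proof (rule Q.descent_induct[of qm "u + e *\<^sub>R r" ?\<Phi>, OF _ _ _ _ q])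
    show "(u + e *\<^sub>R r) \<bullet> qm < (u + e *\<^sub>R r) \<bullet> x" if "x \<in> ?Q" "x \<noteq> qm" for x
    proof -
      have "r \<bullet> qm < r \<bullet> x" using r that by (simp add: Q.exposes_def)
      then have "e * (r \<bullet> qm) < e * (r \<bullet> x)" using e by simp
      then show ?thesis using qm(2)[OF that(1)] by (simp add: inner_add_left)
    qed
    show "?\<Phi> qm"
    proof (intro impI allI)
      fix z assume "closed_segment w z \<in> compact_edges P" "direction c w z = qm"
      then have "z = zm" using edge_direction_inj[OF w c] zm by metis
      then show "?val z = p" by (simp add: p_def)
    qed
    show "qm \<in> ?Q" using Q.vertex_in qm(1) by blast
    fix q1 q2 assume q12: "q1 \<in> vertices ?Q" "q2 \<in> vertices ?Q" "closed_segment q1 q2 \<in> compact_edges ?Q"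
      "(u + e *\<^sub>R r) \<bullet> q2 < (u + e *\<^sub>R r) \<bullet> q1" and IH: "?\<Phi> q2"
    show "?\<Phi> q1"
    proof (intro impI allI)
      fix z1 assume u1: "u \<bullet> q1 < 0" and z1: "closed_segment w z1 \<in> compact_edges P" "direction c w z1 = q1"
      have "\<not> u \<bullet> q1 < u \<bullet> q2" using lex[OF q12(1,2)] q12(4) by linarith
      then have u2: "u \<bullet> q2 < 0" using u1 by linarith
      obtain z2 where z2: "closed_segment w z2 \<in> compact_edges P" "direction c w z2 = q2"
        using lower[OF q12(2) u2] by blast
      have "?val z2 = p" using IH u2 z2 by blast
      moreover have "?val z1 = ?val z2"
      proof -
        have fE: "closed_segment q1 q2 face_of ?Q" "q1 \<noteq> q2" using q12(3) unfolding Q.compact_edge_iff by auto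
        obtain F where F: "F \<in> compact_2_faces P" and lF: "lifts c w (closed_segment q1 q2) F"
          using compact_two_face_at[OF w c fE u1 u2 bdd] by blast
        have FP: "F face_of P" "w \<in> F" "F \<subseteq> P" and mem: "\<And>x. x \<in> P \<Longrightarrow> x \<noteq> w \<Longrightarrow> x \<in> F \<longleftrightarrow> direction c w x \<in> closed_segment q1 q2"
          using lF by (auto simp: lifts_def dest: face_of_imp_subset)
        interpret F: pointed_polyhedron F using compact_2_face_polygon(1)[OF F] .
        have vF: "vertices F = vertices P \<inter> F" using compact_2_face_polygon(5)[OF F] .
        have eF: "closed_segment w z \<in> compact_edges F" if z: "closed_segment w z \<in> compact_edges P" "direction c w z \<in> closed_segment q1 q2" for z
        proof -
          have "z \<in> F" using mem[OF nbr(1,2)[OF z(1)]] z(2) by simp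
          then have "closed_segment w z \<subseteq> F" using FP(2) F.convex_P by (simp add: closed_segment_subset)
          moreover have "closed_segment w z face_of P" "w \<noteq> z" using z(1) by (auto simp: compact_edge_iff)
          ultimately show ?thesis unfolding F.compact_edge_iff using face_of_face[OF FP(1)] by blast
        qed
        have un: "u \<bullet> p < 0" if p: "p \<in> closed_segment q1 q2" for p
        proof -
          have "closed_segment q1 q2 \<subseteq> {x. u \<bullet> x < 0}"
            unfolding segment_convex_hull using u1 u2 by (intro hull_minimal) (auto simp: convex_halfspace_lt)
          then show ?thesis using p by auto
        qed
        \<comment> \<open>Every vertex of the polygon other than \<open>w\<close> lies strictly
          below \<open>w\<close>, that is, where \<open>\<phi>\<close> is already
          compatible.\<close>
        have low: "y \<in> {y\<in>vertices P. u \<bullet> y < u \<bullet> w}" if y: "y \<in> vertices F" "y \<noteq> w" for y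
        proof -
          have yP: "y \<in> P" "y \<in> F" "y \<in> vertices P" using y(1) vF vertex_in by auto
          then have "u \<bullet> direction c w y < 0" using un mem[OF yP(1) y(2)] by blast
          then show ?thesis using usign[OF yP(1) y(2)] yP(3) by simp
        qed
        show ?thesis
          by (rule polygon_consistency[OF \<xi> F _ low \<phi>]) (use w vF FP(2) z1 z2 eF in auto)
      qed
      ultimately show "?val z1 = p" by simp
    qed
  qed
  show ?thesis
  proof (intro exI[of _ p] allI impI)
    fix z assume z: "closed_segment w z \<in> compact_edges P" "u \<bullet> z < u \<bullet> w"
    have "direction c w z \<in> vertices ?Q" using edge_direction_extreme[OF w c z(1)] by (simp add: vertices_def)
    moreover have "u \<bullet> direction c w z < 0" using usign[OF nbr(1,2)[OF z(1)]] z(2) by simp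
    ultimately show "?val z = p" using main z(1) by blast
  qed
qed blast

text \<open>Induction over downward closed sets of vertices. Since \<open>u\<close> is injective on
  vertices, removing the top vertex \<open>w\<close> leaves exactly the vertices below
  \<open>w\<close>, and \<open>vertex_consistency\<close> supplies the value at \<open>w\<close>
  predicted by all lower edges at once; if there are none, any value will do.\<close>

lemma vmap_exists:
  assumes \<xi>: "\<xi> \<in> CP P"
  obtains \<phi> where "vmap \<xi> (vertices P) \<phi>"
proof -
  obtain u m where inj: "inj_on (\<lambda>v. u \<bullet> v) (vertices P)" and bdd: "\<And>x. x \<in> P \<Longrightarrow> m \<le> u \<bullet> x"
    using generic_functional by blast
  have "\<exists>\<phi>. vmap \<xi> S \<phi>"
    if "finite S" "S \<subseteq> vertices P" "\<And>v y. v \<in> S \<Longrightarrow> y \<in> vertices P \<Longrightarrow> u \<bullet> y < u \<bullet> v \<Longrightarrow> y \<in> S" for S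
    using that
  proof (induction S rule: finite_psubset_induct)
    case (psubset S)
    show ?case
    proof (cases "S = {}")
      case True then show ?thesis by (simp add: vmap_def)
    next
      case False
      have "Max ((\<lambda>v. u \<bullet> v) ` S) \<in> (\<lambda>v. u \<bullet> v) ` S" using psubset.hyps False by (intro Max_in) auto
      then obtain w where w: "w \<in> S" "u \<bullet> w = Max ((\<lambda>v. u \<bullet> v) ` S)" by auto
      have max: "u \<bullet> v \<le> u \<bullet> w" if "v \<in> S" for v
        unfolding w(2) using that psubset.hyps by (intro Max_ge) auto
      have wV: "w \<in> vertices P" using w psubset.prems by auto
      have less: "u \<bullet> v < u \<bullet> w" if "v \<in> S - {w}" for v
      proof -
        have "u \<bullet> v \<noteq> u \<bullet> w" using inj that wV psubset.prems(1) by (auto dest: inj_onD)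
        then show ?thesis using max[of v] that by auto
      qed
      have S': "S - {w} = {y\<in>vertices P. u \<bullet> y < u \<bullet> w}"
        using less psubset.prems w(1) by auto
      have "\<exists>\<phi>. vmap \<xi> (S - {w}) \<phi>"
      proof (rule psubset.IH)
        show "S - {w} \<subset> S" "S - {w} \<subseteq> vertices P" using w psubset.prems by auto
        show "y \<in> S - {w}" if "v \<in> S - {w}" "y \<in> vertices P" "u \<bullet> y < u \<bullet> v" for v y
          using less[OF that(1)] that S' by auto
      qed
      then obtain \<phi> where \<phi>: "vmap \<xi> (S - {w}) \<phi>" by blast
      obtain p where p: "\<And>z. closed_segment w z \<in> compact_edges P \<Longrightarrow> u \<bullet> z < u \<bullet> w \<Longrightarrow>
          \<phi> z + tcoord \<xi> w z *\<^sub>R (w - z) = p"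
        using vertex_consistency[OF \<xi> wV bdd \<phi>[unfolded S']] by blast
      have "vmap \<xi> S (\<phi>(w := p))"
        unfolding vmap_def
      proof (intro ballI impI)
        fix v y assume vy: "v \<in> S" "y \<in> S" and E: "closed_segment v y \<in> compact_edges P"
        have ne: "v \<noteq> y" using E by (auto simp: compact_edge_iff)
        consider "v = w" "y \<noteq> w" | "v \<noteq> w" "y = w" | "v \<noteq> w" "y \<noteq> w" using ne by blast
        then show "(\<phi>(w := p)) y - (\<phi>(w := p)) v = tcoord \<xi> v y *\<^sub>R (y - v)"
        proof cases
          case 1
          then have "\<phi> y + tcoord \<xi> w y *\<^sub>R (w - y) = p" using p[of y] E less[of y] vy by auto
          then have "p = \<phi> y + tcoord \<xi> w y *\<^sub>R (w - y)" by simp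
          then show ?thesis using 1 by (simp add: algebra_simps)
        next
          case 2
          then have "\<phi> v + tcoord \<xi> w v *\<^sub>R (w - v) = p"
            using p[of v] E less[of v] vy by (auto simp: closed_segment_commute)
          then have "p = \<phi> v + tcoord \<xi> v w *\<^sub>R (w - v)" by (simp add: closed_segment_commute)
          then show ?thesis using 2 by simp
        next
          case 3 then show ?thesis using \<phi> vy E by (simp add: vmap_def)
        qed
      qed
      then show ?thesis by blast
    qed
  qed
  from this[OF finite_vertices_P order_refl] show thesis using that by blast
qed

text \<open>The differences along edges fix the values on a descending path from \<open>w\<close> to
  \<open>v0\<close>.\<close>

lemma vmap_unique:
  assumes "vmap \<xi> (vertices P) \<phi>" "vmap \<xi> (vertices P) \<psi>" "v0 \<in> vertices P" "\<phi> v0 = \<psi> v0" "w \<in> vertices P"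
  shows "\<phi> w = \<psi> w"
proof -
  obtain c where c: "exposes c v0" using exposes_exists[OF assms(3)] .
  show ?thesis
  proof (rule descent_induct[of v0 c "\<lambda>w. \<phi> w = \<psi> w"])
    show "c \<bullet> v0 < c \<bullet> x" if "x \<in> P" "x \<noteq> v0" for x using c that by (simp add: exposes_def)
    fix v z assume v: "v \<in> vertices P" "z \<in> vertices P" "closed_segment v z \<in> compact_edges P" "\<phi> z = \<psi> z"
    have "\<phi> z - \<phi> v = tcoord \<xi> v z *\<^sub>R (z - v)" "\<psi> z - \<psi> v = tcoord \<xi> v z *\<^sub>R (z - v)"
      using assms(1,2) v(1-3) by (auto simp: vmap_def)
    then have "\<phi> z - \<phi> v = \<psi> z - \<psi> v" by simp
    then show "\<phi> v = \<psi> v" using v(4) by simp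
  qed (use assms vertex_in in auto)
qed

text \<open>Along a descending path from \<open>w\<close> to \<open>v\<close>, the map multiplies
  each edge vector by a nonnegative factor, so the images descend as well. Tilting \<open>u\<close>
  by a functional exposing \<open>v\<close> makes the path end at \<open>v\<close>; the tilt is
  removed in the limit.\<close>

lemma vmap_mono:
  assumes \<phi>: "vmap \<xi> (vertices P) \<phi>" and \<xi>: "\<xi> \<in> CP P" and v: "v \<in> vertices P"
    and min: "\<And>x. x \<in> P \<Longrightarrow> u \<bullet> v \<le> u \<bullet> x" and w: "w \<in> vertices P"
  shows "u \<bullet> \<phi> v \<le> u \<bullet> \<phi> w"
proof -
  obtain c where c: "exposes c v" using exposes_exists[OF v] .
  have "0 \<le> (u \<bullet> \<phi> w - u \<bullet> \<phi> v) + e * (c \<bullet> \<phi> w - c \<bullet> \<phi> v)" if e: "0 < e" for e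
  proof -
    have "(u + e *\<^sub>R c) \<bullet> \<phi> v \<le> (u + e *\<^sub>R c) \<bullet> \<phi> w"
    proof (rule descent_induct[of v "u + e *\<^sub>R c" "\<lambda>w. (u + e *\<^sub>R c) \<bullet> \<phi> v \<le> (u + e *\<^sub>R c) \<bullet> \<phi> w"])
      show "(u + e *\<^sub>R c) \<bullet> v < (u + e *\<^sub>R c) \<bullet> x" if "x \<in> P" "x \<noteq> v" for x
      proof -
        have "c \<bullet> v < c \<bullet> x" using c that by (simp add: exposes_def)
        then have "e * (c \<bullet> v) < e * (c \<bullet> x)" using e by simp
        then show ?thesis using min[OF that(1)] by (simp add: inner_add_left)
      qed
      fix y z assume y: "y \<in> vertices P" "z \<in> vertices P" "closed_segment y z \<in> compact_edges P"
        and lt: "(u + e *\<^sub>R c) \<bullet> z < (u + e *\<^sub>R c) \<bullet> y" and IH: "(u + e *\<^sub>R c) \<bullet> \<phi> v \<le> (u + e *\<^sub>R c) \<bullet> \<phi> z"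
      have d: "\<phi> z = \<phi> y + tcoord \<xi> y z *\<^sub>R (z - y)" using \<phi> y by (simp add: vmap_def algebra_simps)
      have "0 \<le> tcoord \<xi> y z" using \<xi> y(3) by (simp add: CP_def)
      then have "tcoord \<xi> y z * ((u + e *\<^sub>R c) \<bullet> (z - y)) \<le> 0"
        using lt by (intro mult_nonneg_nonpos) (auto simp: inner_diff_right)
      then have "(u + e *\<^sub>R c) \<bullet> \<phi> z \<le> (u + e *\<^sub>R c) \<bullet> \<phi> y" by (simp only: d inner_add_right inner_scaleR_right)
      then show "(u + e *\<^sub>R c) \<bullet> \<phi> v \<le> (u + e *\<^sub>R c) \<bullet> \<phi> y" using IH by linarith
    qed (use v w vertex_in in auto)
    then show ?thesis by (simp add: inner_add_left algebra_simps)
  qed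
  then have "0 \<le> u \<bullet> \<phi> w - u \<bullet> \<phi> v" by (rule nonneg_perturbation)
  then show ?thesis by simp
qed

lemma vertex_at_vmap:
  assumes \<xi>: "\<xi> \<in> CP P" and v0: "v0 \<in> vertices P"
  shows "vertex_at P v0 \<xi> v0 = 0" "vmap \<xi> (vertices P) (vertex_at P v0 \<xi>)"
proof -
  let ?X = "\<lambda>\<phi>. \<phi> \<in> extensional (vertices P) \<and> \<phi> v0 = 0 \<and>
     (\<forall>v\<in>vertices P. \<forall>w\<in>vertices P. closed_segment v w \<in> compact_edges P \<longrightarrow>
        \<phi> w - \<phi> v = tcoord \<xi> v w *\<^sub>R (w - v))"
  obtain \<phi> where \<phi>: "vmap \<xi> (vertices P) \<phi>" using vmap_exists[OF \<xi>] .
  have "?X (restrict (\<lambda>v. \<phi> v - \<phi> v0) (vertices P))"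
    using \<phi> v0 by (auto simp: vmap_def)
  moreover have "\<psi> = \<theta>" if "?X \<psi>" "?X \<theta>" for \<psi> \<theta>
  proof (rule extensionalityI)
    show "\<psi> \<in> extensional (vertices P)" "\<theta> \<in> extensional (vertices P)" using that by auto
    fix v assume v: "v \<in> vertices P"
    have "vmap \<xi> (vertices P) \<psi>" "vmap \<xi> (vertices P) \<theta>" "\<psi> v0 = \<theta> v0"
      using that unfolding vmap_def by simp_all
    then show "\<psi> v = \<theta> v" by (rule vmap_unique[OF _ _ v0 _ v])
  qed
  ultimately have "\<exists>!\<phi>. ?X \<phi>" by blast
  then have "?X (vertex_at P v0 \<xi>)" unfolding vertex_at_def by (rule theI')
  then show "vertex_at P v0 \<xi> v0 = 0" "vmap \<xi> (vertices P) (vertex_at P v0 \<xi>)" by (auto simp: vmap_def)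
qed

lemma vertex_at_eqI:
  assumes "\<xi> \<in> CP P" "v0 \<in> vertices P" "vmap \<xi> (vertices P) \<phi>" "\<phi> v0 = 0" "v \<in> vertices P"
  shows "vertex_at P v0 \<xi> v = \<phi> v"
  using vmap_unique[OF vertex_at_vmap(2)[OF assms(1,2)] assms(3,2)] vertex_at_vmap(1)[OF assms(1,2)] assms(4,5) by simp

end

section \<open>Finitely supported real functions\<close>

lemma lookup_scaleR_real: "Poly_Mapping.lookup (r *\<^sub>R \<xi>) e = r * Poly_Mapping.lookup \<xi> e"
  for \<xi> :: "'k \<Rightarrow>\<^sub>0 real"
proof -
  have "{i. r *\<^sub>R Poly_Mapping.lookup \<xi> i \<noteq> 0} \<subseteq> {i. Poly_Mapping.lookup \<xi> i \<noteq> 0}" by auto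
  then have "finite {i. r *\<^sub>R Poly_Mapping.lookup \<xi> i \<noteq> 0}" using finite_lookup finite_subset by blast
  then show ?thesis unfolding scaleR_poly_mapping_def by simp
qed

lemma abs_lookup_le_norm: "\<bar>Poly_Mapping.lookup \<xi> e\<bar> \<le> norm \<xi>" for \<xi> :: "'k \<Rightarrow>\<^sub>0 real"
proof (cases "e \<in> Poly_Mapping.keys \<xi>")
  case True
  have "norm \<xi> = (\<Sum>n\<in>Poly_Mapping.keys \<xi>. \<bar>Poly_Mapping.lookup \<xi> n\<bar>)"
    by (simp add: norm_poly_mapping_def dist_poly_mapping_def dist_real_def)
  moreover have "\<bar>Poly_Mapping.lookup \<xi> e\<bar> \<le> (\<Sum>n\<in>Poly_Mapping.keys \<xi>. \<bar>Poly_Mapping.lookup \<xi> n\<bar>)"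
    using True by (intro member_le_sum) auto
  ultimately show ?thesis by simp
qed (simp add: in_keys_iff)

text \<open>The norm is the sum of the absolute values of the coordinates. Continuity of coordinates
  makes strict positivity of finitely many of them an open condition.\<close>

lemma bounded_linear_lookup: "bounded_linear (\<lambda>\<xi> :: 'k \<Rightarrow>\<^sub>0 real. Poly_Mapping.lookup \<xi> e)"
  by (rule bounded_linear_intro[of _ 1])
    (simp_all add: lookup_add lookup_scaleR_real abs_lookup_le_norm)

lemma polyhedral_cone_orthant:
  assumes "finite E"
  shows "polyhedral_cone {\<xi> :: 'k \<Rightarrow>\<^sub>0 real. Poly_Mapping.keys \<xi> \<subseteq> E \<and> (\<forall>e\<in>E. 0 \<le> Poly_Mapping.lookup \<xi> e)}"
    (is "polyhedral_cone ?O")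
proof -
  let ?S = "(\<lambda>e. Poly_Mapping.single e (1::real)) ` E"
  have mem: "\<xi> \<in> ?O \<longleftrightarrow> (\<forall>e. e \<notin> E \<longrightarrow> Poly_Mapping.lookup \<xi> e = 0) \<and> (\<forall>e\<in>E. 0 \<le> Poly_Mapping.lookup \<xi> e)" for \<xi>
    by (auto simp: in_keys_iff subset_iff)
  have "?O = convex_cone hull ?S"
  proof
    have O: "?O = {\<xi>. (\<forall>e. e \<notin> E \<longrightarrow> Poly_Mapping.lookup \<xi> e = 0) \<and> (\<forall>e\<in>E. 0 \<le> Poly_Mapping.lookup \<xi> e)}"
      using mem by blast
    have "convex_cone ?O"
      unfolding O convex_cone_iff by (auto simp: lookup_add lookup_scaleR_real)
    moreover have "?S \<subseteq> ?O" by (auto simp: mem lookup_single when_def)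
    ultimately show "convex_cone hull ?S \<subseteq> ?O" by (simp add: hull_minimal)
    show "?O \<subseteq> convex_cone hull ?S"
    proof
      fix \<xi> assume \<xi>: "\<xi> \<in> ?O"
      have "(\<Sum>e\<in>F. Poly_Mapping.lookup \<xi> e *\<^sub>R Poly_Mapping.single e (1::real)) \<in> convex_cone hull ?S"
        if "finite F" "F \<subseteq> E" for F
        using that
      proof (induction F)
        case (insert e F)
        then have "Poly_Mapping.lookup \<xi> e *\<^sub>R Poly_Mapping.single e (1::real) \<in> convex_cone hull ?S"
          using \<xi> by (intro convex_cone_hull_mul hull_inc) auto
        then show ?case using insert by (simp add: convex_cone_hull_add)
      qed (simp add: convex_cone_hull_contains_0)
      from this[OF assms order_refl]
      have "(\<Sum>e\<in>E. Poly_Mapping.lookup \<xi> e *\<^sub>R Poly_Mapping.single e (1::real)) \<in> convex_cone hull ?S" .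
      moreover have "\<xi> = (\<Sum>e\<in>E. Poly_Mapping.lookup \<xi> e *\<^sub>R Poly_Mapping.single e (1::real))"
      proof (rule poly_mapping_eqI)
        fix k
        have "Poly_Mapping.lookup (\<Sum>e\<in>E. Poly_Mapping.lookup \<xi> e *\<^sub>R Poly_Mapping.single e (1::real)) k
          = (\<Sum>e\<in>E. if e = k then Poly_Mapping.lookup \<xi> e else 0)"
          unfolding lookup_sum by (rule sum.cong) (auto simp: lookup_scaleR_real lookup_single when_def)
        also have "\<dots> = Poly_Mapping.lookup \<xi> k"
          using assms \<xi>[unfolded mem] by (simp add: sum.delta)
        finally show "Poly_Mapping.lookup \<xi> k = Poly_Mapping.lookup (\<Sum>e\<in>E. Poly_Mapping.lookup \<xi> e *\<^sub>R Poly_Mapping.single e (1::real)) k" ..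
      qed
      ultimately show "\<xi> \<in> convex_cone hull ?S" by simp
    qed
  qed
  then show ?thesis using assms unfolding polyhedral_cone_def by blast
qed

section \<open>The cone of Minkowski summands\<close>

definition closing :: "'a::euclidean_space list \<Rightarrow> ('a set \<Rightarrow>\<^sub>0 real) \<Rightarrow> 'a" where
  "closing vs \<xi> = (\<Sum>i<length vs. tcoord \<xi> (vs ! i) (vs ! (Suc i mod length vs)) *\<^sub>R
     (vs ! (Suc i mod length vs) - vs ! i))"

lemma linear_closing: "linear (closing vs)"
  by (rule linearI)
    (simp_all add: closing_def lookup_add lookup_scaleR_real scaleR_add_left sum.distrib scaleR_sum_right)

lemma mem_CP: "\<xi> \<in> CP P \<longleftrightarrow> (\<forall>e. e \<notin> compact_edges P \<longrightarrow> Poly_Mapping.lookup \<xi> e = 0) \<and>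
    (\<forall>E\<in>compact_edges P. 0 \<le> Poly_Mapping.lookup \<xi> E) \<and>
    (\<forall>F\<in>compact_2_faces P. \<forall>vs. boundary_cycle F vs \<longrightarrow> closing vs \<xi> = 0)"
  by (auto simp: CP_def closing_def in_keys_iff subset_iff)

lemma convex_cone_CP: "convex_cone (CP P)"
  unfolding convex_cone_iff
proof (intro conjI ballI allI impI)
  show "0 \<in> CP P" by (simp add: mem_CP linear_0[OF linear_closing])
  fix \<xi> assume \<xi>: "\<xi> \<in> CP P"
  show "\<xi> + \<eta> \<in> CP P" if "\<eta> \<in> CP P" for \<eta>
    using \<xi> that by (simp add: mem_CP lookup_add linear_add[OF linear_closing])
  show "r *\<^sub>R \<xi> \<in> CP P" if "0 \<le> r" for r
    using \<xi> that by (simp add: mem_CP lookup_scaleR_real linear_scale[OF linear_closing])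
qed

lemma cyclic_sum_zero:
  fixes g :: "'a \<Rightarrow> 'b::ab_group_add"
  shows "(\<Sum>i<length vs. g (vs ! (Suc i mod length vs)) - g (vs ! i)) = 0"
proof (cases "length vs")
  case (Suc m)
  have "(\<Sum>i<Suc m. g (vs ! (Suc i mod Suc m)) - g (vs ! i)) =
      (\<Sum>i<m. g (vs ! (Suc i mod Suc m)) - g (vs ! i)) + (g (vs ! (Suc m mod Suc m)) - g (vs ! m))"
    by (rule sum.lessThan_Suc)
  also have "(\<Sum>i<m. g (vs ! (Suc i mod Suc m)) - g (vs ! i)) = (\<Sum>i<m. g (vs ! Suc i) - g (vs ! i))"
    by (rule sum.cong) auto
  also have "\<dots> = g (vs ! m) - g (vs ! 0)" by (rule sum_lessThan_telescope)
  finally show ?thesis unfolding Suc by simp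
qed simp

lemma lookup_one_CP:
  assumes "finite (compact_edges P)"
  shows "Poly_Mapping.lookup (one_CP P) E = (if E \<in> compact_edges P then 1 else 0)"
proof -
  have "Poly_Mapping.lookup (one_CP P) E = (\<Sum>e\<in>compact_edges P. if e = E then 1 else 0)"
    unfolding one_CP_def lookup_sum by (rule sum.cong) (auto simp: lookup_single when_def)
  then show ?thesis using assms by (simp add: sum.delta)
qed

locale based_polyhedron = pointed_polyhedron P for P :: "'a::euclidean_space set" +
  fixes v0 :: 'a
  assumes v0: "v0 \<in> vertices P"
begin

text \<open>The converse of integration: if the coordinates come from a map on the vertices, the sum
  around each polygon telescopes. Membership of \<open>one_CP\<close> and of the classifying map in
  \<open>CP\<close> is obtained this way.\<close>

lemma CP_I:
  assumes z: "\<And>e. e \<notin> compact_edges P \<Longrightarrow> Poly_Mapping.lookup \<xi> e = 0"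
    and nn: "\<And>e. e \<in> compact_edges P \<Longrightarrow> 0 \<le> Poly_Mapping.lookup \<xi> e"
    and \<phi>: "vmap \<xi> (vertices P) \<phi>"
  shows "\<xi> \<in> CP P"
  unfolding mem_CP
proof (intro conjI allI ballI impI)
  fix F vs assume F: "F \<in> compact_2_faces P" and bc: "boundary_cycle F vs"
  let ?n = "length vs"
  have fF: "F face_of P" and vF: "vertices F = vertices P \<inter> F" and cF: "compact F"
    using compact_2_face_polygon[OF F] by auto
  have "closing vs \<xi> = (\<Sum>i<?n. \<phi> (vs ! (Suc i mod ?n)) - \<phi> (vs ! i))"
    unfolding closing_def
  proof (rule sum.cong[OF refl])
    fix i assume "i \<in> {..<?n}"
    then have i: "i < ?n" "Suc i mod ?n < ?n" by (auto intro: mod_less_divisor)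
    have "closed_segment (vs ! i) (vs ! (Suc i mod ?n)) edge_of F" using bc i by (simp add: boundary_cycle_def)
    then have "closed_segment (vs ! i) (vs ! (Suc i mod ?n)) \<in> compact_edges P"
      using face_of_trans[OF _ fF] by (simp add: compact_edges_def edge_of_def)
    moreover have "vs ! i \<in> set vs" "vs ! (Suc i mod ?n) \<in> set vs" using i by auto
    then have "vs ! i \<in> vertices P" "vs ! (Suc i mod ?n) \<in> vertices P"
      using bc vF unfolding boundary_cycle_def by blast+
    ultimately show "tcoord \<xi> (vs ! i) (vs ! (Suc i mod ?n)) *\<^sub>R (vs ! (Suc i mod ?n) - vs ! i) =
        \<phi> (vs ! (Suc i mod ?n)) - \<phi> (vs ! i)"
      using \<phi> by (simp add: vmap_def)
  qed
  then show "closing vs \<xi> = 0" by (simp only: cyclic_sum_zero)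
qed (use z nn in auto)

lemma lookup_one: "Poly_Mapping.lookup (one_CP P) E = (if E \<in> compact_edges P then 1 else 0)"
  by (rule lookup_one_CP[OF finite_compact_edges])

lemma vmap_one: "vmap (one_CP P) (vertices P) (\<lambda>v. v - v0)"
  by (simp add: vmap_def lookup_one)

lemma one_in_CP: "one_CP P \<in> CP P"
  by (rule CP_I[OF _ _ vmap_one]) (simp_all add: lookup_one)

lemma scaled_one_in_CP: "0 \<le> t \<Longrightarrow> t *\<^sub>R one_CP P \<in> CP P"
  using convex_cone_scaleR[OF convex_cone_CP] one_in_CP by blast

abbreviation vtx :: "('a set \<Rightarrow>\<^sub>0 real) \<Rightarrow> 'a \<Rightarrow> 'a" where
  "vtx \<equiv> vertex_at P v0"

lemma vmap_vtx: "\<xi> \<in> CP P \<Longrightarrow> vmap \<xi> (vertices P) (vtx \<xi>)"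
  and vtx_v0: "\<xi> \<in> CP P \<Longrightarrow> vtx \<xi> v0 = 0"
  using vertex_at_vmap v0 by blast+

lemma vtx_eqI: "\<xi> \<in> CP P \<Longrightarrow> vmap \<xi> (vertices P) \<phi> \<Longrightarrow> \<phi> v0 = 0 \<Longrightarrow> v \<in> vertices P \<Longrightarrow> vtx \<xi> v = \<phi> v"
  using vertex_at_eqI v0 by blast

lemma vtx_add:
  assumes "\<xi> \<in> CP P" "\<eta> \<in> CP P" "v \<in> vertices P"
  shows "vtx (\<xi> + \<eta>) v = vtx \<xi> v + vtx \<eta> v"
proof (rule vtx_eqI)
  show "\<xi> + \<eta> \<in> CP P" using convex_cone_add[OF convex_cone_CP] assms by blast
  show "vmap (\<xi> + \<eta>) (vertices P) (\<lambda>v. vtx \<xi> v + vtx \<eta> v)"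
    unfolding vmap_def
  proof (intro ballI impI)
    fix v w assume vw: "v \<in> vertices P" "w \<in> vertices P" "closed_segment v w \<in> compact_edges P"
    have "vtx \<xi> w - vtx \<xi> v = tcoord \<xi> v w *\<^sub>R (w - v)" "vtx \<eta> w - vtx \<eta> v = tcoord \<eta> v w *\<^sub>R (w - v)"
      using vmap_vtx assms(1,2) vw by (auto simp: vmap_def)
    then have "(vtx \<xi> w - vtx \<xi> v) + (vtx \<eta> w - vtx \<eta> v) = tcoord (\<xi> + \<eta>) v w *\<^sub>R (w - v)"
      by (simp add: lookup_add scaleR_add_left)
    then show "vtx \<xi> w + vtx \<eta> w - (vtx \<xi> v + vtx \<eta> v) = tcoord (\<xi> + \<eta>) v w *\<^sub>R (w - v)"
      by (simp add: algebra_simps)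
  qed
qed (use assms vtx_v0 in auto)

lemma vtx_scale:
  assumes "\<xi> \<in> CP P" "0 \<le> r" "v \<in> vertices P"
  shows "vtx (r *\<^sub>R \<xi>) v = r *\<^sub>R vtx \<xi> v"
proof (rule vtx_eqI)
  show "r *\<^sub>R \<xi> \<in> CP P" using convex_cone_scaleR[OF convex_cone_CP] assms by blast
  show "vmap (r *\<^sub>R \<xi>) (vertices P) (\<lambda>v. r *\<^sub>R vtx \<xi> v)"
    unfolding vmap_def
  proof (intro ballI impI)
    fix v w assume vw: "v \<in> vertices P" "w \<in> vertices P" "closed_segment v w \<in> compact_edges P"
    have "vtx \<xi> w - vtx \<xi> v = tcoord \<xi> v w *\<^sub>R (w - v)"
      using vmap_vtx assms(1) vw by (auto simp: vmap_def)
    then have "r *\<^sub>R (vtx \<xi> w - vtx \<xi> v) = tcoord (r *\<^sub>R \<xi>) v w *\<^sub>R (w - v)"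
      by (simp add: lookup_scaleR_real)
    then show "r *\<^sub>R vtx \<xi> w - r *\<^sub>R vtx \<xi> v = tcoord (r *\<^sub>R \<xi>) v w *\<^sub>R (w - v)"
      by (simp add: scaleR_diff_right)
  qed
qed (use assms vtx_v0 in auto)

lemma vtx_one: "v \<in> vertices P \<Longrightarrow> vtx (one_CP P) v = v - v0"
  by (rule vtx_eqI[OF one_in_CP vmap_one]) simp_all

lemma vtx_scaled_one: "0 \<le> t \<Longrightarrow> v \<in> vertices P \<Longrightarrow> vtx (t *\<^sub>R one_CP P) v = t *\<^sub>R (v - v0)"
  using vtx_scale[OF one_in_CP] vtx_one by simp

section \<open>The tautological family\<close>

text \<open>That is, \<open>u\<close> lies in the inner normal cone of \<open>P\<close> at the
  vertex \<open>m\<close>. Every functional bounded below on \<open>P\<close> occurs in such a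
  pair.\<close>

definition minimizes :: "'a \<Rightarrow> 'a \<Rightarrow> bool" where
  "minimizes m u \<longleftrightarrow> m \<in> vertices P \<and> (\<forall>y\<in>P. u \<bullet> m \<le> u \<bullet> y)"

lemma minimizes_tail:
  assumes "minimizes m u" "a \<in> tail P" shows "0 \<le> u \<bullet> a"
proof -
  have "m + a \<in> P" using assms vertex_in add_tail by (auto simp: minimizes_def)
  then have "u \<bullet> m \<le> u \<bullet> (m + a)" using assms by (simp add: minimizes_def)
  then show ?thesis by (simp add: inner_add_right)
qed

lemma zero_tail: "0 \<in> tail P"
  by (rule convex_cone_contains_0[OF convex_cone_tail_P])

lemma vtx_in_summand: "v \<in> vertices P \<Longrightarrow> vtx \<xi> v \<in> summand P v0 \<xi>"
  unfolding summand_def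
  using set_plus_intro[of "vtx \<xi> v" "convex hull (vtx \<xi> ` vertices P)" 0 "tail P"] zero_tail
  by (simp add: hull_inc)

lemma summand_add_tail: "x \<in> summand P v0 \<xi> \<Longrightarrow> a \<in> tail P \<Longrightarrow> x + a \<in> summand P v0 \<xi>"
  unfolding summand_def by (rule add_cone_mem[OF convex_cone_tail_P])

lemma convex_summand: "convex (summand P v0 \<xi>)"
  unfolding summand_def by (rule convex_convex_hull_plus_cone[OF convex_cone_tail_P])

text \<open>The vertex of \<open>P\<close> that minimises \<open>u\<close> also indicates where
  \<open>u\<close> is minimal on the summand, by \<open>vmap_mono\<close>: the normal fan of
  \<open>P\<close> serves all summands. Conversely, a functional separating a point from the summand
  is nonnegative on the tail, so it is minimal over \<open>P\<close> at some vertex and its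
  inequality fails.\<close>

lemma mem_summand_iff:
  assumes \<xi>: "\<xi> \<in> CP P"
  shows "x \<in> summand P v0 \<xi> \<longleftrightarrow> (\<forall>u m. minimizes m u \<longrightarrow> u \<bullet> vtx \<xi> m \<le> u \<bullet> x)"
proof (intro iffI allI impI)
  fix u m assume x: "x \<in> summand P v0 \<xi>" and mu: "minimizes m u"
  obtain k a where k: "k \<in> convex hull (vtx \<xi> ` vertices P)" "a \<in> tail P" "x = k + a"
    using x unfolding summand_def by (rule set_plus_elim)
  have "vtx \<xi> ` vertices P \<subseteq> {y. u \<bullet> y \<ge> u \<bullet> vtx \<xi> m}"
    using vmap_mono[OF vmap_vtx[OF \<xi>] \<xi>] mu by (auto simp: minimizes_def)
  then have "convex hull (vtx \<xi> ` vertices P) \<subseteq> {y. u \<bullet> y \<ge> u \<bullet> vtx \<xi> m}"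
    by (intro hull_minimal convex_halfspace_ge)
  then have "u \<bullet> vtx \<xi> m \<le> u \<bullet> k" using k(1) by auto
  then show "u \<bullet> vtx \<xi> m \<le> u \<bullet> x" using minimizes_tail[OF mu k(2)] by (simp add: k(3) inner_add_right)
next
  assume R: "\<forall>u m. minimizes m u \<longrightarrow> u \<bullet> vtx \<xi> m \<le> u \<bullet> x"
  show "x \<in> summand P v0 \<xi>"
  proof (rule ccontr)
    assume x: "x \<notin> summand P v0 \<xi>"
    have "closed (summand P v0 \<xi>)"
      unfolding summand_def tail_gens using finite_vertices_P finite_gens by (intro closed_convex_hull_plus_cone) auto
    then obtain u b where ub: "u \<bullet> x < b" "\<And>y. y \<in> summand P v0 \<xi> \<Longrightarrow> u \<bullet> y > b"
      using separating_hyperplane_closed_point[OF convex_summand _ x] by blast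
    have "b \<le> u \<bullet> (vtx \<xi> v0 + a)" if "a \<in> tail P" for a
      using ub(2)[OF summand_add_tail[OF vtx_in_summand[OF v0] that]] by simp
    then have "0 \<le> u \<bullet> a" if "a \<in> tail P" for a
      using that by (rule nonneg_on_cone[OF convex_cone_tail_P])
    then obtain m where "m \<in> vertices P" "\<And>y. y \<in> P \<Longrightarrow> u \<bullet> m \<le> u \<bullet> y"
      using linear_minimum_at_vertex by metis
    then have "minimizes m u" by (simp add: minimizes_def)
    then have "u \<bullet> vtx \<xi> m \<le> u \<bullet> x" using R by blast
    moreover have "b < u \<bullet> vtx \<xi> m" using ub(2) vtx_in_summand \<open>m \<in> vertices P\<close> by blast
    ultimately show False using ub(1) by linarith
  qed
qed

text \<open>The same vertex \<open>m\<close> gives the bound for both summands, and these bounds add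
  up, which yields one inclusion. For the other, each vertex of the sum is split by
  \<open>vtx_add\<close>.\<close>

lemma summand_add:
  assumes \<xi>: "\<xi> \<in> CP P" and \<eta>: "\<eta> \<in> CP P"
  shows "summand P v0 \<xi> + summand P v0 \<eta> = summand P v0 (\<xi> + \<eta>)"
proof
  have s: "\<xi> + \<eta> \<in> CP P" using convex_cone_add[OF convex_cone_CP \<xi> \<eta>] .
  show "summand P v0 \<xi> + summand P v0 \<eta> \<subseteq> summand P v0 (\<xi> + \<eta>)"
  proof
    fix z assume "z \<in> summand P v0 \<xi> + summand P v0 \<eta>"
    then obtain x y where xy: "x \<in> summand P v0 \<xi>" "y \<in> summand P v0 \<eta>" "z = x + y" by (rule set_plus_elim)
    show "z \<in> summand P v0 (\<xi> + \<eta>)"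
      unfolding mem_summand_iff[OF s]
    proof (intro allI impI)
      fix u m assume mu: "minimizes m u"
      have "u \<bullet> vtx \<xi> m \<le> u \<bullet> x" "u \<bullet> vtx \<eta> m \<le> u \<bullet> y"
        using mem_summand_iff[OF \<xi>] mem_summand_iff[OF \<eta>] xy mu by blast+
      moreover have "m \<in> vertices P" using mu by (simp add: minimizes_def)
      ultimately show "u \<bullet> vtx (\<xi> + \<eta>) m \<le> u \<bullet> z"
        by (simp add: xy(3) vtx_add[OF \<xi> \<eta>] inner_add_right)
    qed
  qed
  show "summand P v0 (\<xi> + \<eta>) \<subseteq> summand P v0 \<xi> + summand P v0 \<eta>"
    unfolding summand_def[of P v0 "\<xi> + \<eta>"]
  proof (rule convex_hull_plus_cone_subset)
    show "convex (summand P v0 \<xi> + summand P v0 \<eta>)" by (intro convex_set_plus convex_summand)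
    show "vtx (\<xi> + \<eta>) ` vertices P \<subseteq> summand P v0 \<xi> + summand P v0 \<eta>"
      using vtx_add[OF \<xi> \<eta>] vtx_in_summand by (auto intro!: set_plus_intro)
    fix x a assume "x \<in> summand P v0 \<xi> + summand P v0 \<eta>" and a: "a \<in> tail P"
    then obtain y z where yz: "y \<in> summand P v0 \<xi>" "z \<in> summand P v0 \<eta>" "x = y + z" by (metis set_plus_elim)
    then have "y + (z + a) \<in> summand P v0 \<xi> + summand P v0 \<eta>"
      using summand_add_tail[OF yz(2) a] by (intro set_plus_intro)
    then show "x + a \<in> summand P v0 \<xi> + summand P v0 \<eta>" by (simp add: yz(3) add.assoc)
  qed
qed

lemma summand_scale:
  assumes \<xi>: "\<xi> \<in> CP P" and r: "0 \<le> r" and x: "x \<in> summand P v0 \<xi>"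
  shows "r *\<^sub>R x \<in> summand P v0 (r *\<^sub>R \<xi>)"
proof -
  have s: "r *\<^sub>R \<xi> \<in> CP P" using convex_cone_scaleR[OF convex_cone_CP r \<xi>] .
  show ?thesis
    unfolding mem_summand_iff[OF s]
  proof (intro allI impI)
    fix u m assume mu: "minimizes m u"
    have "u \<bullet> vtx \<xi> m \<le> u \<bullet> x" using mem_summand_iff[OF \<xi>] x mu by blast
    then have "r * (u \<bullet> vtx \<xi> m) \<le> r * (u \<bullet> x)" using r by (rule mult_left_mono)
    moreover have "m \<in> vertices P" using mu by (simp add: minimizes_def)
    ultimately show "u \<bullet> vtx (r *\<^sub>R \<xi>) m \<le> u \<bullet> (r *\<^sub>R x)" by (simp add: vtx_scale[OF \<xi> r])
  qed
qed

lemma mem_summand_scaled_one: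
  assumes "0 \<le> t"
  shows "x - t *\<^sub>R v0 \<in> summand P v0 (t *\<^sub>R one_CP P) \<longleftrightarrow> (\<forall>u m. minimizes m u \<longrightarrow> t * (u \<bullet> m) \<le> u \<bullet> x)"
proof -
  have "u \<bullet> vtx (t *\<^sub>R one_CP P) m \<le> u \<bullet> (x - t *\<^sub>R v0) \<longleftrightarrow> t * (u \<bullet> m) \<le> u \<bullet> x"
    if "minimizes m u" for u m
    using that by (simp add: minimizes_def vtx_scaled_one[OF assms] inner_diff_right right_diff_distrib)
  then show ?thesis unfolding mem_summand_iff[OF scaled_one_in_CP[OF assms]] by blast
qed

text \<open>Read off from the summand at \<open>one_CP P\<close>, whose vertices are those of
  \<open>P\<close> shifted by \<open>v0\<close>, so the separation argument is not repeated.\<close>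

lemma mem_P_iff: "x \<in> P \<longleftrightarrow> (\<forall>u m. minimizes m u \<longrightarrow> u \<bullet> m \<le> u \<bullet> x)"
proof
  assume "\<forall>u m. minimizes m u \<longrightarrow> u \<bullet> m \<le> u \<bullet> x"
  then have "x - v0 \<in> summand P v0 (one_CP P)" using mem_summand_scaled_one[of 1 x] by simp
  then obtain k a where k: "k \<in> convex hull (vtx (one_CP P) ` vertices P)" "a \<in> tail P" "x - v0 = k + a"
    unfolding summand_def by (rule set_plus_elim)
  have "vtx (one_CP P) ` vertices P \<subseteq> (\<lambda>y. y - v0) ` P" using vtx_one vertex_in by auto
  moreover have "convex ((\<lambda>y. y - v0) ` P)" using convex_translation_subtract[OF convex_P] .
  ultimately have "k \<in> (\<lambda>y. y - v0) ` P" using k(1) hull_minimal[of _ _ convex] by blast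
  then have "k + v0 \<in> P" by auto
  then have "(k + v0) + a \<in> P" by (rule add_tail[OF _ k(2)])
  moreover have "(k + v0) + a = x" using k(3) by (simp add: algebra_simps)
  ultimately show "x \<in> P" by simp
qed (simp add: minimizes_def)

text \<open>The right-hand side is closed and homogeneous, so it contains the closure. Conversely,
  points at positive height are rescaled into \<open>P\<close>, while points at height 0 are
  obtained only as limits.\<close>

lemma mem_cone_over_iff:
  "(x, t) \<in> cone_over P \<longleftrightarrow> 0 \<le> t \<and> (\<forall>u m. minimizes m u \<longrightarrow> t * (u \<bullet> m) \<le> u \<bullet> x)"
proof
  let ?K = "{p :: 'a \<times> real. 0 \<le> snd p} \<inter> (\<Inter>(u, m)\<in>{(u, m). minimizes m u}. {p. snd p * (u \<bullet> m) \<le> u \<bullet> fst p})"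
  have "closed {p :: 'a \<times> real. snd p * (u \<bullet> m) \<le> u \<bullet> fst p}" for u m
    by (intro closed_Collect_le continuous_intros)
  moreover have "closed {p :: 'a \<times> real. 0 \<le> snd p}" by (intro closed_Collect_le continuous_intros)
  ultimately have "closed ?K" by (intro closed_Int closed_INT) auto
  moreover have "cone hull (P \<times> {1}) \<subseteq> ?K"
  proof (rule hull_minimal)
    show "P \<times> {1} \<subseteq> ?K" by (auto simp: minimizes_def)
    show "cone ?K"
      unfolding cone_def
    proof (intro ballI allI impI)
      fix p :: "'a \<times> real" and r :: real assume p: "p \<in> ?K" and r: "0 \<le> r"
      have "r * (snd p * (u \<bullet> m)) \<le> r * (u \<bullet> fst p)" if "minimizes m u" for u m
        using p r that by (intro mult_left_mono) auto
      then show "r *\<^sub>R p \<in> ?K" using p r by (auto simp: mult.assoc)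
    qed
  qed
  ultimately have "cone_over P \<subseteq> ?K" unfolding cone_over_def by (intro closure_minimal)
  then show "(x, t) \<in> cone_over P \<Longrightarrow> 0 \<le> t \<and> (\<forall>u m. minimizes m u \<longrightarrow> t * (u \<bullet> m) \<le> u \<bullet> x)" by auto
next
  have gen: "(t *\<^sub>R x, t) \<in> cone hull (P \<times> {1})" if "x \<in> P" "0 \<le> t" for x and t :: real
  proof -
    have "t *\<^sub>R (x, 1::real) \<in> cone hull (P \<times> {1})"
      using that by (intro mem_cone[OF cone_cone_hull] hull_inc) auto
    then show ?thesis by simp
  qed
  assume R: "0 \<le> t \<and> (\<forall>u m. minimizes m u \<longrightarrow> t * (u \<bullet> m) \<le> u \<bullet> x)"
  show "(x, t) \<in> cone_over P"
  proof (cases "t = 0")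
    case False
    then have t: "0 < t" using R by auto
    have "(1 / t) *\<^sub>R x \<in> P"
      unfolding mem_P_iff
    proof (intro allI impI)
      fix u m assume "minimizes m u"
      then have "t * (u \<bullet> m) \<le> u \<bullet> x" using R by blast
      then show "u \<bullet> m \<le> u \<bullet> (1 / t) *\<^sub>R x" using t by (simp add: field_simps)
    qed
    then have "(t *\<^sub>R ((1 / t) *\<^sub>R x), t) \<in> cone hull (P \<times> {1})" using t by (intro gen) auto
    then have "(x, t) \<in> cone hull (P \<times> {1})" using t by simp
    then show ?thesis unfolding cone_over_def using closure_subset by blast
  next
    case True
    \<comment> \<open>A point at height 0 is a direction of \<open>P\<close>, so far points on the
      ray from \<open>v0\<close> in this direction lie in \<open>P\<close>; scaled down to height
      \<open>1 / real (Suc n)\<close> they converge to it.\<close>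
    have "(1 / real (Suc n)) *\<^sub>R (v0 + real (Suc n) *\<^sub>R x) = (1 / real (Suc n)) *\<^sub>R v0 + x" for n
      by (simp add: scaleR_add_right)
    moreover have "v0 + real (Suc n) *\<^sub>R x \<in> P" for n
      unfolding mem_P_iff
    proof (intro allI impI)
      fix u m assume mu: "minimizes m u"
      then have "0 \<le> u \<bullet> x" using R True by force
      then have "0 \<le> real (Suc n) * (u \<bullet> x)" by simp
      moreover have "u \<bullet> m \<le> u \<bullet> v0" using mu v0 vertex_in by (simp add: minimizes_def)
      ultimately show "u \<bullet> m \<le> u \<bullet> (v0 + real (Suc n) *\<^sub>R x)" by (simp only: inner_add_right inner_scaleR_right)
    qed
    ultimately have mem: "((1 / real (Suc n)) *\<^sub>R v0 + x, 1 / real (Suc n)) \<in> cone hull (P \<times> {1})" for n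
      using gen[of "v0 + real (Suc n) *\<^sub>R x" "1 / real (Suc n)"] by simp
    have "(\<lambda>n. ((1 / real (Suc n)) *\<^sub>R v0 + x, 1 / real (Suc n))) \<longlonglongrightarrow> (0 *\<^sub>R v0 + x, 0)"
      using LIMSEQ_inverse_real_of_nat by (intro tendsto_intros) (simp_all add: inverse_eq_divide)
    then have "(x, 0::real) \<in> closure (cone hull (P \<times> {1}))"
      unfolding closure_sequential using mem by (intro exI[of _ "\<lambda>n. ((1 / real (Suc n)) *\<^sub>R v0 + x, 1 / real (Suc n))"]) auto
    then show ?thesis unfolding cone_over_def True .
  qed
qed

text \<open>This identifies cone(P) with the base change of the tautological family along
  \<open>emb\<close>.\<close>

lemma mem_cone_over_summand:
  "(x, t) \<in> cone_over P \<longleftrightarrow> 0 \<le> t \<and> x - t *\<^sub>R v0 \<in> summand P v0 (t *\<^sub>R one_CP P)"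
  using mem_cone_over_iff mem_summand_scaled_one by auto

lemma cone_over_scaled:
  "0 \<le> t \<Longrightarrow> x \<in> P \<Longrightarrow> (t *\<^sub>R x, t) \<in> cone_over P"
  unfolding mem_cone_over_iff by (auto simp: mem_P_iff mult_left_mono)

lemma convex_cone_cone_over: "convex_cone (cone_over P)"
  unfolding convex_cone_iff
proof (intro conjI ballI allI impI)
  show "0 \<in> cone_over P" using mem_cone_over_iff[of 0 0] by (simp add: zero_prod_def)
  fix p assume p: "p \<in> cone_over P"
  obtain x t where pe: "p = (x, t)" by force
  show "r *\<^sub>R p \<in> cone_over P" if r: "0 \<le> r" for r
  proof -
    have "r * t * (u \<bullet> m) \<le> r * (u \<bullet> x)" if "minimizes m u" for u m
      unfolding mult.assoc using p r that unfolding pe mem_cone_over_iff by (intro mult_left_mono) auto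
    then show ?thesis using p r by (auto simp: pe mem_cone_over_iff)
  qed
  fix q assume q: "q \<in> cone_over P"
  obtain y s where qe: "q = (y, s)" by force
  show "p + q \<in> cone_over P"
    using p q unfolding pe qe by (auto simp: mem_cone_over_iff inner_add_right distrib_right add_mono)
qed

lemma convex_cone_CtP: "convex_cone (CtP P v0)"
  unfolding convex_cone_iff
proof (intro conjI ballI allI impI)
  have "0 \<in> CP P" by (rule convex_cone_contains_0[OF convex_cone_CP])
  then have "(0, vtx 0 v0) \<in> CtP P v0" using vtx_in_summand v0 by (simp add: CtP_def)
  then show "0 \<in> CtP P v0" using vtx_v0[OF \<open>0 \<in> CP P\<close>] by (simp add: zero_prod_def)
  fix p assume p: "p \<in> CtP P v0"
  obtain \<xi> x where pe: "p = (\<xi>, x)" by force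
  show "r *\<^sub>R p \<in> CtP P v0" if r: "0 \<le> r" for r
    using p convex_cone_scaleR[OF convex_cone_CP r, of \<xi> P] summand_scale[OF _ r] by (simp add: pe CtP_def)
  fix q assume q: "q \<in> CtP P v0"
  obtain \<eta> y where qe: "q = (\<eta>, y)" by force
  have "\<xi> \<in> CP P" "\<eta> \<in> CP P" "x \<in> summand P v0 \<xi>" "y \<in> summand P v0 \<eta>"
    using p q by (auto simp: pe qe CtP_def)
  then have "\<xi> + \<eta> \<in> CP P" "x + y \<in> summand P v0 (\<xi> + \<eta>)"
    using convex_cone_add[OF convex_cone_CP] set_plus_intro summand_add by metis+
  then show "p + q \<in> CtP P v0" by (simp add: pe qe CtP_def)
qed

section \<open>Finite generation of the tautological cones\<close>

lemma polyhedral_cone_CP: "polyhedral_cone (CP P)"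
proof -
  let ?O = "{\<xi> :: 'a set \<Rightarrow>\<^sub>0 real. Poly_Mapping.keys \<xi> \<subseteq> compact_edges P \<and> (\<forall>e\<in>compact_edges P. 0 \<le> Poly_Mapping.lookup \<xi> e)}"
  \<comment> \<open>Boundary cycles are distinct lists of vertices, so \<open>I\<close> is finite.
    One scalar equation for each cycle and each basis vector cuts \<open>CP P\<close> out of the
    orthant.\<close>
  define I where "I = (\<Union>F\<in>compact_2_faces P. {vs. boundary_cycle F vs})"
  define U where "U = (\<lambda>(vs, b) \<xi>. closing vs \<xi> \<bullet> b) ` (I \<times> Basis)"
  have "finite {vs. boundary_cycle F vs}" if F: "F \<in> compact_2_faces P" for F
  proof (rule finite_subset)
    show "{vs. boundary_cycle F vs} \<subseteq> {vs. set vs \<subseteq> vertices F \<and> distinct vs}"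
      by (auto simp: boundary_cycle_def)
    have "finite (vertices F)" using compact_2_face_polygon(5)[OF F] finite_vertices_P by simp
    then show "finite {vs. set vs \<subseteq> vertices F \<and> distinct vs}" by (rule finite_subset_distinct)
  qed
  then have "finite I" unfolding I_def using finite_compact_2_faces by (intro finite_UN_I)
  then have fU: "finite U" by (simp add: U_def)
  have linU: "linear u" if uU: "u \<in> U" for u
  proof -
    obtain vs b where "u = (\<lambda>\<xi>. closing vs \<xi> \<bullet> b)" using uU by (auto simp: U_def)
    then show ?thesis
      by (auto intro!: linearI simp: linear_add[OF linear_closing] linear_scale[OF linear_closing] inner_add_left)
  qed
  have "polyhedral_cone {\<xi>\<in>?O. \<forall>u\<in>U. u \<xi> = 0}"
    by (rule polyhedral_cone_hyperplanes[OF fU polyhedral_cone_orthant[OF finite_compact_edges] linU])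
  moreover have "{\<xi>\<in>?O. \<forall>u\<in>U. u \<xi> = 0} = CP P"
  proof -
    have "(\<forall>u\<in>U. u \<xi> = 0) \<longleftrightarrow> (\<forall>vs\<in>I. closing vs \<xi> = 0)" for \<xi>
      by (auto simp: U_def euclidean_all_zero_iff)
    then show ?thesis by (auto simp: CP_def closing_def I_def)
  qed
  ultimately show ?thesis by simp
qed

text \<open>Over each generator of \<open>CP P\<close> it suffices to take the vertices of the
  summand, and over 0 the generators of the tail.\<close>

lemma polyhedral_cone_CtP: "polyhedral_cone (CtP P v0)"
proof -
  obtain G where G: "finite G" "CP P = convex_cone hull G"
    using polyhedral_cone_CP by (auto simp: polyhedral_cone_def)
  have GCP: "G \<subseteq> CP P" unfolding G(2) by (rule hull_subset)
  let ?S = "(\<lambda>(\<xi>, v). (\<xi>, vtx \<xi> v)) ` (G \<times> vertices P) \<union> (\<lambda>a. (0, a)) ` gens"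
  let ?H = "convex_cone hull ?S"
  have ccH: "convex_cone ?H" by (rule convex_cone_convex_cone_hull)
  have tailH: "(0, a) \<in> ?H" if "a \<in> tail P" for a
  proof -
    have "linear (\<lambda>a :: 'a. (0 :: 'a set \<Rightarrow>\<^sub>0 real, a))" by (rule linearI) simp_all
    then have "convex_cone {a. (0, a) \<in> ?H}" using convex_cone_vimage_linear ccH by blast
    moreover have "gens \<subseteq> {a. (0, a) \<in> ?H}" by (auto intro!: hull_inc)
    ultimately have "convex_cone hull gens \<subseteq> {a. (0, a) \<in> ?H}" by (simp add: hull_minimal)
    then show ?thesis using that unfolding tail_gens by blast
  qed
  \<comment> \<open>For fixed \<open>v\<close>, the vertex moves additively and homogeneously with
    \<xi>, so membership spreads from the generators of \<open>CP P\<close> to the whole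
    cone.\<close>
  have vtxH: "(\<xi>, vtx \<xi> v) \<in> ?H" if \<xi>: "\<xi> \<in> CP P" and v: "v \<in> vertices P" for \<xi> v
  proof -
    let ?M = "{\<xi>\<in>CP P. (\<xi>, vtx \<xi> v) \<in> ?H}"
    have "convex_cone ?M"
    proof (rule convex_cone_iff[THEN iffD2], intro conjI ballI allI impI)
      have "0 \<in> CP P" by (rule convex_cone_contains_0[OF convex_cone_CP])
      moreover have "vtx (0 *\<^sub>R 0) v = 0 *\<^sub>R vtx 0 v" using vtx_scale[OF \<open>0 \<in> CP P\<close> order_refl v] .
      ultimately show "0 \<in> ?M" using convex_cone_contains_0[OF ccH] by (simp add: zero_prod_def)
      fix \<eta> assume \<eta>: "\<eta> \<in> ?M"
      show "r *\<^sub>R \<eta> \<in> ?M" if r: "0 \<le> r" for r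
      proof -
        have "r *\<^sub>R (\<eta>, vtx \<eta> v) \<in> ?H" using \<eta> r by (intro convex_cone_hull_mul) auto
        then show ?thesis using \<eta> convex_cone_scaleR[OF convex_cone_CP r, of \<eta> P] vtx_scale[OF _ r v] by simp
      qed
      fix \<zeta> assume \<zeta>: "\<zeta> \<in> ?M"
      have "(\<eta>, vtx \<eta> v) + (\<zeta>, vtx \<zeta> v) \<in> ?H" using \<eta> \<zeta> by (intro convex_cone_hull_add) auto
      then show "\<eta> + \<zeta> \<in> ?M" using \<eta> \<zeta> convex_cone_add[OF convex_cone_CP, of \<eta> P \<zeta>] vtx_add[OF _ _ v] by simp
    qed
    moreover have "G \<subseteq> ?M" using GCP v by (auto intro!: hull_inc)
    ultimately have "convex_cone hull G \<subseteq> ?M" by (simp add: hull_minimal)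
    then show ?thesis using \<xi> unfolding G(2) by blast
  qed
  have "CtP P v0 = ?H"
  proof
    show "?H \<subseteq> CtP P v0"
    proof (rule hull_minimal)
      show "?S \<subseteq> CtP P v0"
      proof
        fix p assume "p \<in> ?S"
        then consider \<xi> v where "\<xi> \<in> G" "v \<in> vertices P" "p = (\<xi>, vtx \<xi> v)" | a where "a \<in> gens" "p = (0, a)" by auto
        then show "p \<in> CtP P v0"
        proof cases
          case 1 then show ?thesis using GCP vtx_in_summand by (auto simp: CtP_def)
        next
          case 2
          have "0 \<in> CP P" by (rule convex_cone_contains_0[OF convex_cone_CP])
          moreover have "vtx 0 v0 + a \<in> summand P v0 0"
            using 2 gens_tail by (intro summand_add_tail vtx_in_summand v0) auto
          ultimately show ?thesis using 2 vtx_v0 by (simp add: CtP_def)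
        qed
      qed
    qed (rule convex_cone_CtP)
    show "CtP P v0 \<subseteq> ?H"
    proof
      fix p assume "p \<in> CtP P v0"
      then obtain \<xi> x where p: "p = (\<xi>, x)" "\<xi> \<in> CP P" "x \<in> summand P v0 \<xi>" by (auto simp: CtP_def)
      obtain k a where k: "k \<in> convex hull (vtx \<xi> ` vertices P)" "a \<in> tail P" "x = k + a"
        using p(3) unfolding summand_def by (rule set_plus_elim)
      have "linear (\<lambda>k :: 'a. (0 :: 'a set \<Rightarrow>\<^sub>0 real, k))" by (rule linearI) simp_all
      then have "convex {k. (\<xi>, 0) + (0, k) \<in> ?H}" by (rule convex_affine_vimage) (rule convex_convex_cone_hull)
      then have "convex {k. (\<xi>, k) \<in> ?H}" by simp
      moreover have "vtx \<xi> ` vertices P \<subseteq> {k. (\<xi>, k) \<in> ?H}" using vtxH[OF p(2)] by auto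
      ultimately have "(\<xi>, k) \<in> ?H" using k(1) hull_minimal[of _ _ convex] by blast
      then have "(\<xi>, k) + (0, a) \<in> ?H" using tailH[OF k(2)] by (rule convex_cone_hull_add)
      then show "p \<in> ?H" by (simp add: p(1) k(3))
    qed
  qed
  moreover have "finite ?S" using G(1) finite_vertices_P finite_gens by auto
  ultimately show ?thesis unfolding polyhedral_cone_def by blast
qed

text \<open>The affine hull of \<open>CP P\<close> satisfies the closing equations. Within it,
  strict positivity of all edge coordinates is an open condition that implies membership in
  \<open>CP P\<close>.\<close>

lemma one_rel_interior: "one_CP P \<in> rel_interior (CP P)"
proof -
  let ?U = "\<Inter>E\<in>compact_edges P. {\<xi> :: 'a set \<Rightarrow>\<^sub>0 real. 0 < Poly_Mapping.lookup \<xi> E}"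
  let ?L = "{\<xi> :: 'a set \<Rightarrow>\<^sub>0 real. (\<forall>e. e \<notin> compact_edges P \<longrightarrow> Poly_Mapping.lookup \<xi> e = 0) \<and>
    (\<forall>F\<in>compact_2_faces P. \<forall>vs. boundary_cycle F vs \<longrightarrow> closing vs \<xi> = 0)}"
  have "open {\<xi> :: 'a set \<Rightarrow>\<^sub>0 real. 0 < Poly_Mapping.lookup \<xi> E}" for E
    by (intro open_Collect_less continuous_on_const linear_continuous_on bounded_linear_lookup)
  then have oU: "open ?U" using finite_compact_edges by (intro open_INT) auto
  have "subspace ?L"
    unfolding subspace_def
    by (auto simp: lookup_add lookup_scaleR_real linear_0[OF linear_closing] linear_add[OF linear_closing] linear_scale[OF linear_closing])
  then have "affine ?L" by (rule subspace_imp_affine)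
  then have aff: "affine hull (CP P) \<subseteq> ?L" by (rule hull_minimal[rotated]) (auto simp: mem_CP)
  have "openin (top_of_set (affine hull (CP P))) (affine hull (CP P) \<inter> ?U)"
    using oU by (rule openin_open_Int)
  moreover have "one_CP P \<in> affine hull (CP P) \<inter> ?U"
    using one_in_CP by (auto simp: hull_inc lookup_one)
  moreover have "affine hull (CP P) \<inter> ?U \<subseteq> CP P"
    using aff by (auto simp: mem_CP less_imp_le)
  ultimately show ?thesis unfolding rel_interior_def by blast
qed

lemma fibre_tautological:
  "\<xi> \<in> CP P \<Longrightarrow> fibre (tautological_family P v0) \<xi> = Pair \<xi> ` summand P v0 \<xi>"
  by (auto simp: fibre_def tautological_family_def CtP_def)

lemma F_family_tautological: "F_family P (tautological_family P v0)"
  unfolding F_family_def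
proof (intro conjI ballI)
  let ?T = "tautological_family P v0"
  show "polyhedral_cone (tot ?T)" "polyhedral_cone (base ?T)"
    using polyhedral_cone_CtP polyhedral_cone_CP by (auto simp: tautological_family_def)
  show "proj ?T \<in> cone_hom (tot ?T) (base ?T)"
  proof -
    have "restrict fst (CtP P v0) \<in> CtP P v0 \<rightarrow>\<^sub>E CP P" by (auto simp: CtP_def)
    then show ?thesis unfolding cone_hom_def tautological_family_def
      using linear_fst by (auto intro!: exI[of _ fst])
  qed
  show "proj ?T ` tot ?T = base ?T"
  proof -
    have "\<xi> \<in> fst ` CtP P v0" if "\<xi> \<in> CP P" for \<xi>
      using that vtx_in_summand[OF v0, of \<xi>] by (force simp: CtP_def)
    then show ?thesis by (auto simp: tautological_family_def CtP_def)
  qed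
  show "emb ?T \<in> cone_hom {0..} (base ?T)"
  proof -
    have "linear (\<lambda>t. t *\<^sub>R one_CP P)" by (rule linearI) (simp_all add: scaleR_add_left)
    then show ?thesis unfolding cone_hom_def tautological_family_def
      using scaled_one_in_CP by (auto intro!: exI[of _ "\<lambda>t. t *\<^sub>R one_CP P"])
  qed
  show "emb ?T 1 \<in> rel_interior (base ?T)" using one_rel_interior by (simp add: tautological_family_def)
  show "fibre ?T \<xi> + fibre ?T \<xi>' = fibre ?T (\<xi> + \<xi>')" if "\<xi> \<in> base ?T" "\<xi>' \<in> base ?T" for \<xi> \<xi>'
  proof -
    have xi: "\<xi> \<in> CP P" "\<xi>' \<in> CP P" using that by (auto simp: tautological_family_def)
    have "\<xi> + \<xi>' \<in> CP P" using convex_cone_add[OF convex_cone_CP xi] .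
    moreover have "Pair \<xi> ` summand P v0 \<xi> + Pair \<xi>' ` summand P v0 \<xi>' = Pair (\<xi> + \<xi>') ` (summand P v0 \<xi> + summand P v0 \<xi>')"
      by (force simp: set_plus_def)
    ultimately show ?thesis using xi by (simp add: fibre_tautological summand_add)
  qed
  show "ident ?T \<in> cone_hom (cone_over P) (tot ?T)"
  proof -
    let ?i = "\<lambda>p :: 'a \<times> real. (snd p *\<^sub>R one_CP P, fst p - snd p *\<^sub>R v0)"
    have "linear ?i" by (rule linearI) (simp_all add: scaleR_add_left scaleR_diff_right)
    moreover have "?i p \<in> CtP P v0" if "p \<in> cone_over P" for p
      using that mem_cone_over_summand[of "fst p" "snd p"] scaled_one_in_CP by (simp add: CtP_def)
    ultimately show ?thesis unfolding cone_hom_def tautological_family_def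
      by (auto intro!: exI[of _ ?i])
  qed
  show "cartesian_square (cone_over P) (tot ?T) {0..} (ident ?T) snd (proj ?T) (emb ?T)"
    unfolding cartesian_square_def bij_betw_def
  proof
    show "inj_on (\<lambda>x. (ident ?T x, snd x)) (cone_over P)"
      by (rule inj_onI) (auto simp: tautological_family_def)
    show "(\<lambda>x. (ident ?T x, snd x)) ` cone_over P = {(b, c). b \<in> tot ?T \<and> c \<in> {0..} \<and> proj ?T b = emb ?T c}"
    proof (intro equalityI subsetI)
      fix q assume "q \<in> (\<lambda>x. (ident ?T x, snd x)) ` cone_over P"
      then obtain x t where "(x, t) \<in> cone_over P" "q = (ident ?T (x, t), t)" by auto
      then show "q \<in> {(b, c). b \<in> tot ?T \<and> c \<in> {0..} \<and> proj ?T b = emb ?T c}"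
        using mem_cone_over_summand[of x t] scaled_one_in_CP by (simp add: tautological_family_def CtP_def)
    next
      fix q assume "q \<in> {(b, c). b \<in> tot ?T \<and> c \<in> {0..} \<and> proj ?T b = emb ?T c}"
      then obtain \<xi> w t where q: "q = ((\<xi>, w), t)" "(\<xi>, w) \<in> CtP P v0" "0 \<le> t" "\<xi> = t *\<^sub>R one_CP P"
        by (auto simp: tautological_family_def)
      then have "(w + t *\<^sub>R v0, t) \<in> cone_over P" by (simp add: mem_cone_over_summand CtP_def)
      moreover then have "q = (ident ?T (w + t *\<^sub>R v0, t), snd (w + t *\<^sub>R v0, t))" using q by (simp add: tautological_family_def)
      ultimately show "q \<in> (\<lambda>x. (ident ?T x, snd x)) ` cone_over P" by blast
    qed
  qed
qed

text \<open>Without compact edges \<open>one_CP P\<close> is zero and \<open>emb\<close> is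
  constant, so injectivity depends on the assumption.\<close>

lemma F_object_tautological:
  assumes "compact_edges P \<noteq> {}"
  shows "F_object P (tautological_family P v0)"
proof -
  obtain E where "E \<in> compact_edges P" using assms by auto
  then have "one_CP P \<noteq> 0" using lookup_one[of E] by auto
  then have "inj_on (emb (tautological_family P v0)) {0..}"
    by (auto simp: tautological_family_def inj_on_def)
  then show ?thesis using F_family_tautological by (simp add: F_object_def)
qed

end

section \<open>The universal property\<close>

text \<open>The segment from \<zeta> to \<open>e\<close> can be prolonged slightly beyond
  \<open>e\<close> within \<open>C\<close>; a multiple of the point reached there complements
  \<zeta> to a multiple of \<open>e\<close>.\<close>

lemma rel_interior_companion:
  fixes C :: "'c::real_normed_vector set"
  assumes C: "convex_cone C" and e: "e \<in> rel_interior C" and \<zeta>: "\<zeta> \<in> C"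
  obtains \<zeta>' r where "\<zeta>' \<in> C" "0 < r" "\<zeta> + \<zeta>' = r *\<^sub>R e"
proof -
  obtain T where T: "openin (top_of_set (affine hull C)) T" "e \<in> T" "T \<subseteq> C"
    using e unfolding rel_interior_def by blast
  obtain U where U: "open U" "T = affine hull C \<inter> U" using T(1) unfolding openin_open by blast
  have eA: "e \<in> affine hull C" using T(2) U(2) by blast
  have zA: "\<zeta> \<in> affine hull C" using \<zeta> by (rule hull_inc)
  have "((\<lambda>d. (1 + d) *\<^sub>R e + (- d) *\<^sub>R \<zeta>) \<longlongrightarrow> (1 + 0) *\<^sub>R e + (- 0) *\<^sub>R \<zeta>) (at_right 0)"
    by (intro tendsto_intros)
  then have "((\<lambda>d. (1 + d) *\<^sub>R e + (- d) *\<^sub>R \<zeta>) \<longlongrightarrow> e) (at_right 0)" by simp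
  moreover have "e \<in> U" using T(2) U(2) by blast
  ultimately have "eventually (\<lambda>d. (1 + d) *\<^sub>R e + (- d) *\<^sub>R \<zeta> \<in> U) (at_right 0)"
    using U(1) by (intro topological_tendstoD)
  moreover have "eventually (\<lambda>d::real. 0 < d) (at_right 0)" by (rule eventually_at_right_less)
  ultimately have "eventually (\<lambda>d. 0 < d \<and> (1 + d) *\<^sub>R e + (- d) *\<^sub>R \<zeta> \<in> U) (at_right 0)"
    by eventually_elim auto
  then obtain d :: real where d: "0 < d" "(1 + d) *\<^sub>R e + (- d) *\<^sub>R \<zeta> \<in> U"
    using eventually_happens'[of "at_right (0::real)"] trivial_limit_at_right_real by blast
  have "(1 + d) *\<^sub>R e + (- d) *\<^sub>R \<zeta> \<in> affine hull C"
    by (rule mem_affine[OF affine_affine_hull eA zA]) simp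
  then have m: "(1 + d) *\<^sub>R e + (- d) *\<^sub>R \<zeta> \<in> C" using d(2) U(2) T(3) by blast
  show thesis
  proof (rule that)
    show "(1 / d) *\<^sub>R ((1 + d) *\<^sub>R e + (- d) *\<^sub>R \<zeta>) \<in> C" using d(1) by (intro convex_cone_scaleR[OF C _ m]) simp
    show "0 < (1 + d) / d" using d(1) by simp
    show "\<zeta> + (1 / d) *\<^sub>R ((1 + d) *\<^sub>R e + (- d) *\<^sub>R \<zeta>) = ((1 + d) / d) *\<^sub>R e"
      using d(1) by (simp add: scaleR_add_right scaleR_diff_right)
  qed
qed

lemma (in based_polyhedron) cone_over_section:
  assumes x: "(x, t) \<in> cone_over P" and t: "0 < t"
  shows "(1 / t) *\<^sub>R x \<in> P"
  unfolding mem_P_iff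
proof (intro allI impI)
  fix u m assume "minimizes m u"
  then have "t * (u \<bullet> m) \<le> u \<bullet> x" using x mem_cone_over_iff by blast
  then show "u \<bullet> m \<le> u \<bullet> (1 / t) *\<^sub>R x" using t by (simp add: field_simps)
qed

section \<open>The structure of an object over \<open>P\<close>\<close>

locale F_family_over = based_polyhedron P v0 for P :: "'a::euclidean_space set" and v0 +
  fixes X :: "('a, 'b::real_normed_vector, 'c::real_normed_vector) cone_family"
  assumes family: "F_family P X"
begin

abbreviation unit :: 'c where "unit \<equiv> emb X 1"

lemma convex_cone_tot: "convex_cone (tot X)" and convex_cone_base: "convex_cone (base X)"
  using family by (auto simp: F_family_def polyhedral_cone_imp_convex_cone)

lemma proj_base: "x \<in> tot X \<Longrightarrow> proj X x \<in> base X"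
  using family by (auto simp: F_family_def cone_hom_def)

lemma proj_add: "x \<in> tot X \<Longrightarrow> y \<in> tot X \<Longrightarrow> proj X (x + y) = proj X x + proj X y"
  and proj_scale: "x \<in> tot X \<Longrightarrow> 0 \<le> r \<Longrightarrow> proj X (r *\<^sub>R x) = r *\<^sub>R proj X x"
proof -
  obtain g where g: "linear g" "\<And>x. x \<in> tot X \<Longrightarrow> proj X x = g x"
    using family by (auto simp: F_family_def cone_hom_def)
  show "proj X (x + y) = proj X x + proj X y" if "x \<in> tot X" "y \<in> tot X"
    using that g convex_cone_add[OF convex_cone_tot that] by (simp add: linear_add)
  show "proj X (r *\<^sub>R x) = r *\<^sub>R proj X x" if "x \<in> tot X" "0 \<le> r"
    using that g convex_cone_scaleR[OF convex_cone_tot that(2,1)] by (simp add: linear_scale)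
qed

lemma unit_base: "unit \<in> base X"
proof -
  have "emb X \<in> {0..} \<rightarrow>\<^sub>E base X" using family by (simp add: F_family_def cone_hom_def)
  then show ?thesis by (rule PiE_mem) simp
qed

lemma emb_scale: "0 \<le> t \<Longrightarrow> emb X t = t *\<^sub>R unit"
proof -
  assume t: "0 \<le> t"
  obtain g where g: "linear g" "\<And>t. 0 \<le> t \<Longrightarrow> emb X t = g t"
    using family by (auto simp: F_family_def cone_hom_def)
  have "g t = t *\<^sub>R g 1" using linear_scale[OF g(1), of t 1] by simp
  then show ?thesis using g(2) t by simp
qed

lemma split_fibre:
  assumes "\<xi> \<in> base X" "\<xi>' \<in> base X" "z \<in> tot X" "proj X z = \<xi> + \<xi>'"
  obtains x y where "x \<in> tot X" "proj X x = \<xi>" "y \<in> tot X" "proj X y = \<xi>'" "z = x + y"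
proof -
  have "fibre X \<xi> + fibre X \<xi>' = fibre X (\<xi> + \<xi>')" using family assms(1,2) by (simp add: F_family_def)
  moreover have "z \<in> fibre X (\<xi> + \<xi>')" using assms(3,4) by (simp add: fibre_def)
  ultimately have "z \<in> fibre X \<xi> + fibre X \<xi>'" by simp
  then obtain x y where "x \<in> fibre X \<xi>" "y \<in> fibre X \<xi>'" "z = x + y" by (rule set_plus_elim)
  then show thesis using that by (auto simp: fibre_def)
qed

text \<open>\<open>ident\<close> is \<open>undefined\<close> off cone(P), but differences of points
  of that cone are needed; hence a linear extension is fixed.\<close>

definition J :: "'a \<times> real \<Rightarrow> 'b" where
  "J = (SOME J. linear J \<and> (\<forall>q\<in>cone_over P. ident X q = J q))"

lemma linear_J: "linear J" and ident_J: "q \<in> cone_over P \<Longrightarrow> ident X q = J q"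
proof -
  have "\<exists>J. linear J \<and> (\<forall>q\<in>cone_over P. ident X q = J q)"
    using family by (auto simp: F_family_def cone_hom_def)
  then have "linear J \<and> (\<forall>q\<in>cone_over P. ident X q = J q)" unfolding J_def by (rule someI_ex)
  then show "linear J" "q \<in> cone_over P \<Longrightarrow> ident X q = J q" by blast+
qed

lemma J_bij: "bij_betw (\<lambda>q. (ident X q, snd q)) (cone_over P) {(b, c). b \<in> tot X \<and> c \<in> {0..} \<and> proj X b = emb X c}"
  using family by (simp add: F_family_def cartesian_square_def)

lemma J_tot: "(x, t) \<in> cone_over P \<Longrightarrow> J (x, t) \<in> tot X"
  and proj_J: "(x, t) \<in> cone_over P \<Longrightarrow> proj X (J (x, t)) = t *\<^sub>R unit"
proof -
  assume xt: "(x, t) \<in> cone_over P"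
  have "(ident X (x, t), t) \<in> {(b, c). b \<in> tot X \<and> c \<in> {0..} \<and> proj X b = emb X c}"
    using bij_betwE[OF J_bij] xt by force
  then show "J (x, t) \<in> tot X" "proj X (J (x, t)) = t *\<^sub>R unit"
    using ident_J[OF xt] emb_scale[of t] by auto
qed

lemma J_surj:
  assumes "x \<in> tot X" "0 \<le> t" "proj X x = t *\<^sub>R unit"
  obtains y where "(y, t) \<in> cone_over P" "x = J (y, t)"
proof -
  have "(x, t) \<in> {(b, c). b \<in> tot X \<and> c \<in> {0..} \<and> proj X b = emb X c}"
    using assms emb_scale[of t] by simp
  then have "(x, t) \<in> (\<lambda>q. (ident X q, snd q)) ` cone_over P"
    using bij_betw_imp_surj_on[OF J_bij] by blast
  then obtain q where q: "q \<in> cone_over P" "x = ident X q" "t = snd q" by auto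
  then have "(fst q, t) \<in> cone_over P" "x = J (fst q, t)" using ident_J by auto
  then show thesis by (rule that)
qed

text \<open>Points are compared at one height only: the square makes the pair of
  \<open>ident\<close> and the height injective, and \<open>F_family\<close> does not require
  \<open>emb\<close> to separate heights.\<close>

lemma J_inj:
  assumes "(x, t) \<in> cone_over P" "(y, t) \<in> cone_over P" "J (x, t) = J (y, t)"
  shows "x = y"
proof -
  have "(x, t) = (y, t)"
    by (rule inj_onD[OF bij_betw_imp_inj_on[OF J_bij] _ assms(1,2)]) (simp add: ident_J assms)
  then show ?thesis by simp
qed

lemma J_add: "J (x, s) + J (y, t) = J (x + y, s + t)"
  and J_diff: "J (x, s) - J (y, t) = J (x - y, s - t)"
  and J_scale: "r *\<^sub>R J (x, s) = J (r *\<^sub>R x, r * s)"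
  using linear_add[OF linear_J, of "(x, s)" "(y, t)"] linear_diff[OF linear_J, of "(x, s)" "(y, t)"]
    linear_scale[OF linear_J, of r "(x, s)"] by simp_all

lemma J_zero: "J (0, 0) = 0"
  using linear_0[OF linear_J] by (simp add: zero_prod_def)

text \<open>The tangent cone of \<open>P\<close> at \<open>v0\<close>.\<close>

definition K :: "'a set" where
  "K = {y. \<exists>s\<ge>0. (y + s *\<^sub>R v0, s) \<in> cone_over P}"

lemma v0_ray: "0 \<le> s \<Longrightarrow> (s *\<^sub>R v0, s) \<in> cone_over P"
  using cone_over_scaled vertex_in v0 by blast

lemma K_enlarge:
  assumes "(y + s *\<^sub>R v0, s) \<in> cone_over P" "s \<le> s'"
  shows "(y + s' *\<^sub>R v0, s') \<in> cone_over P"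
proof -
  have "(y + s *\<^sub>R v0, s) + ((s' - s) *\<^sub>R v0, s' - s) \<in> cone_over P"
    using assms v0_ray by (intro convex_cone_add[OF convex_cone_cone_over]) auto
  then show ?thesis by (simp add: scaleR_diff_left)
qed

lemma convex_cone_K: "convex_cone K"
  unfolding convex_cone_iff
proof (intro conjI ballI allI impI)
  show "0 \<in> K" using v0_ray[of 0] by (auto simp: K_def)
  fix y assume y: "y \<in> K"
  obtain s where s: "0 \<le> s" "(y + s *\<^sub>R v0, s) \<in> cone_over P" using y by (auto simp: K_def)
  show "r *\<^sub>R y \<in> K" if r: "0 \<le> r" for r
  proof -
    have "r *\<^sub>R (y + s *\<^sub>R v0, s) \<in> cone_over P" by (rule convex_cone_scaleR[OF convex_cone_cone_over r s(2)])
    then have "(r *\<^sub>R y + (r * s) *\<^sub>R v0, r * s) \<in> cone_over P" by (simp add: scaleR_add_right)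
    then show ?thesis using r s(1) unfolding K_def by (intro CollectI exI[of _ "r * s"]) simp
  qed
  fix z assume z: "z \<in> K"
  obtain t where t: "0 \<le> t" "(z + t *\<^sub>R v0, t) \<in> cone_over P" using z by (auto simp: K_def)
  have "(y + s *\<^sub>R v0, s) + (z + t *\<^sub>R v0, t) \<in> cone_over P"
    by (rule convex_cone_add[OF convex_cone_cone_over s(2) t(2)])
  then have "(y + z + (s + t) *\<^sub>R v0, s + t) \<in> cone_over P" by (simp add: algebra_simps)
  then show "y + z \<in> K" using s(1) t(1) unfolding K_def by (intro CollectI exI[of _ "s + t"]) simp
qed

lemma K_I: "(x, t) \<in> cone_over P \<Longrightarrow> x - t *\<^sub>R v0 \<in> K"
  unfolding K_def using mem_cone_over_iff[of x t] by (intro CollectI exI[of _ t]) simp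

text \<open>Adding a large common multiple of \<open>v0\<close> moves both points into cone(P) at
  the same height, where \<open>J_inj\<close> applies.\<close>

lemma J_inj_K:
  assumes "y \<in> K" "z \<in> K" "J (y, 0) = J (z, 0)"
  shows "y = z"
proof -
  obtain s t where s: "0 \<le> s" "(y + s *\<^sub>R v0, s) \<in> cone_over P" and t: "0 \<le> t" "(z + t *\<^sub>R v0, t) \<in> cone_over P"
    using assms(1,2) by (auto simp: K_def)
  define r where "r = max s t"
  have "(y + r *\<^sub>R v0, r) \<in> cone_over P" "(z + r *\<^sub>R v0, r) \<in> cone_over P"
    using K_enlarge[OF s(2)] K_enlarge[OF t(2)] by (auto simp: r_def)
  moreover have "J (y + r *\<^sub>R v0, r) = J (z + r *\<^sub>R v0, r)"
    using J_add[of y 0 "r *\<^sub>R v0" r] J_add[of z 0 "r *\<^sub>R v0" r] assms(3) by simp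
  ultimately have "y + r *\<^sub>R v0 = z + r *\<^sub>R v0" by (rule J_inj)
  then show ?thesis by simp
qed

text \<open>Adding \<open>(v, 1)\<close> makes the height positive, so height 0 needs no separate
  treatment. The rescaled sum is a point of \<open>P\<close> at which \<open>c\<close> is minimal,
  hence it is \<open>v\<close>.\<close>

lemma cone_over_exposed:
  assumes v: "v \<in> vertices P" and c: "exposes c v" and x: "(x, t) \<in> cone_over P" and eq: "c \<bullet> x \<le> t * (c \<bullet> v)"
  shows "x = t *\<^sub>R v"
proof -
  have t: "0 \<le> t" using x mem_cone_over_iff by blast
  have "(v, 1) \<in> cone_over P" using cone_over_scaled[of 1 v] vertex_in v by simp
  then have "(x, t) + (v, 1) \<in> cone_over P" using x by (rule convex_cone_add[OF convex_cone_cone_over, rotated])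
  then have xv: "(x + v, t + 1) \<in> cone_over P" by simp
  let ?z = "(1 / (t + 1)) *\<^sub>R (x + v)"
  have "?z \<in> P" by (rule cone_over_section[OF xv]) (use t in simp)
  moreover have "\<not> c \<bullet> v < c \<bullet> ?z"
  proof -
    have "(1 / s) * a \<le> b" if "0 < s" "a \<le> s * b" for a b s :: real using that by (simp add: field_simps)
    moreover have "c \<bullet> (x + v) \<le> (t + 1) * (c \<bullet> v)" using eq by (simp add: inner_add_right distrib_right)
    ultimately have "(1 / (t + 1)) * (c \<bullet> (x + v)) \<le> c \<bullet> v" using t by simp
    then show ?thesis unfolding inner_scaleR_right by linarith
  qed
  ultimately have "?z = v" using c by (auto simp: exposes_def)
  then have "(t + 1) *\<^sub>R ?z = (t + 1) *\<^sub>R v" by simp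
  then have "x + v = (t + 1) *\<^sub>R v" using t by simp
  then show ?thesis by (simp add: scaleR_add_left)
qed

section \<open>Linear sections through the vertices of the distinguished fibre\<close>

lemma vertex_point:
  assumes "v \<in> P" "0 \<le> t"
  shows "J (t *\<^sub>R v, t) \<in> tot X" "proj X (J (t *\<^sub>R v, t)) = t *\<^sub>R unit"
  using J_tot proj_J cone_over_scaled[OF assms(2,1)] by blast+

text \<open>With \<open>c\<close> exposing \<open>v\<close>, the values of \<open>c\<close> on the
  two parts are at least \<open>s\<close> and \<open>t\<close> times its value at \<open>v\<close>,
  and their sum is the least possible; so equality holds for each part.\<close>

lemma vertex_decomposition:
  assumes v: "v \<in> vertices P" and a: "a \<in> tot X" "0 \<le> s" "proj X a = s *\<^sub>R unit"
    and b: "b \<in> tot X" "0 \<le> t" "proj X b = t *\<^sub>R unit" and sum: "a + b = J ((s + t) *\<^sub>R v, s + t)"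
  shows "a = J (s *\<^sub>R v, s)"
proof -
  obtain c where c: "exposes c v" using exposes_exists[OF v] .
  obtain x where x: "(x, s) \<in> cone_over P" "a = J (x, s)" using J_surj[OF a] .
  obtain y where y: "(y, t) \<in> cone_over P" "b = J (y, t)" using J_surj[OF b] .
  have "J (x + y, s + t) = J ((s + t) *\<^sub>R v, s + t)" using sum by (simp add: x(2) y(2) J_add)
  moreover have "(x + y, s + t) \<in> cone_over P" using convex_cone_add[OF convex_cone_cone_over x(1) y(1)] by simp
  moreover have "((s + t) *\<^sub>R v, s + t) \<in> cone_over P" using cone_over_scaled vertex_in v a(2) b(2) by simp
  ultimately have xy: "x + y = (s + t) *\<^sub>R v" using J_inj by blast
  have "minimizes v c" using c v by (force simp: minimizes_def exposes_def less_imp_le)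
  then have "t * (c \<bullet> v) \<le> c \<bullet> y" using y(1) mem_cone_over_iff by blast
  moreover have "c \<bullet> x + c \<bullet> y = (s + t) * (c \<bullet> v)" using arg_cong[OF xy, of "\<lambda>z. c \<bullet> z"] by (simp add: inner_add_right)
  ultimately have "c \<bullet> x \<le> s * (c \<bullet> v)" by (simp add: distrib_right)
  then show ?thesis using cone_over_exposed[OF v c x(1)] x(2) by simp
qed

text \<open>\<open>x\<close> is the part over \<open>\<zeta>\<close> of a decomposition of a multiple of the vertex \<open>v\<close> of the
  distinguished fibre.\<close>

definition dec :: "'a \<Rightarrow> 'c \<Rightarrow> 'b \<Rightarrow> bool" where
  "dec v \<zeta> x \<longleftrightarrow> x \<in> tot X \<and> proj X x = \<zeta> \<and> (\<exists>y\<in>tot X. \<exists>t\<ge>0. x + y = J (t *\<^sub>R v, t))"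

text \<open>The two decompositions may use different multiples and companions. Exchanging the
  companions gives \<open>x + y'\<close> and \<open>x' + y\<close>, both over multiples of the unit
  and with sum a multiple of the vertex, so \<open>x + y'\<close> is the same vertex point as
  \<open>x' + y'\<close>.\<close>

lemma dec_unique:
  assumes v: "v \<in> vertices P" and x: "dec v \<zeta> x" and x': "dec v \<zeta> x'"
  shows "x = x'"
proof -
  obtain y t where y: "x \<in> tot X" "proj X x = \<zeta>" "y \<in> tot X" "0 \<le> t" "x + y = J (t *\<^sub>R v, t)"
    using x unfolding dec_def by blast
  obtain y' t' where y': "x' \<in> tot X" "proj X x' = \<zeta>" "y' \<in> tot X" "0 \<le> t'" "x' + y' = J (t' *\<^sub>R v, t')"
    using x' unfolding dec_def by blast
  have vP: "v \<in> P" using v vertex_in by blast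
  have p: "\<zeta> + proj X y = t *\<^sub>R unit" "\<zeta> + proj X y' = t' *\<^sub>R unit"
    using vertex_point(2)[OF vP y(4)] vertex_point(2)[OF vP y'(4)] y y'
      proj_add[OF y(1,3)] proj_add[OF y'(1,3)] by simp_all
  have "x + y' = J (t' *\<^sub>R v, t')"
  proof (rule vertex_decomposition[OF v _ y'(4) _ _ y(4)])
    show "x + y' \<in> tot X" "x' + y \<in> tot X" using convex_cone_add[OF convex_cone_tot] y y' by blast+
    show "proj X (x + y') = t' *\<^sub>R unit" "proj X (x' + y) = t *\<^sub>R unit"
      using proj_add[OF y(1) y'(3)] proj_add[OF y'(1) y(3)] y(2) y'(2) p by simp_all
    have "x + y' + (x' + y) = (x' + y') + (x + y)" by simp
    also have "\<dots> = J ((t' + t) *\<^sub>R v, t' + t)" unfolding y(5) y'(5) by (simp add: J_add scaleR_add_left)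
    finally show "x + y' + (x' + y) = J ((t' + t) *\<^sub>R v, t' + t)" .
  qed
  then have "x + y' = x' + y'" using y'(5) by simp
  then show ?thesis by simp
qed

lemma companion:
  assumes "\<zeta> \<in> base X"
  obtains \<zeta>' t where "\<zeta>' \<in> base X" "0 < t" "\<zeta> + \<zeta>' = t *\<^sub>R unit"
  using rel_interior_companion[OF convex_cone_base _ assms] family by (auto simp: F_family_def)

lemma dec_split:
  assumes v: "v \<in> P" and \<zeta>: "\<zeta> \<in> base X" "\<zeta>' \<in> base X" and t: "0 < t" "\<zeta> + \<zeta>' = t *\<^sub>R unit"
  obtains x y where "dec v \<zeta> x" "x \<in> tot X" "proj X x = \<zeta>" "y \<in> tot X" "proj X y = \<zeta>'" "x + y = J (t *\<^sub>R v, t)"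
proof -
  have z: "J (t *\<^sub>R v, t) \<in> tot X" "proj X (J (t *\<^sub>R v, t)) = \<zeta> + \<zeta>'"
    using vertex_point[OF v less_imp_le[OF t(1)]] t(2) by simp_all
  obtain x y where xy: "x \<in> tot X" "proj X x = \<zeta>" "y \<in> tot X" "proj X y = \<zeta>'" "J (t *\<^sub>R v, t) = x + y"
    using split_fibre[OF \<zeta> z] .
  then have "dec v \<zeta> x" unfolding dec_def using t(1) less_imp_le by metis
  then show thesis using that xy by metis
qed

text \<open>The linear section of the projection through the vertex \<open>v\<close> of the distinguished fibre.\<close>

definition sec :: "'a \<Rightarrow> 'c \<Rightarrow> 'b" where
  "sec v \<zeta> = (THE x. dec v \<zeta> x)"

lemma sec_eqI: "v \<in> vertices P \<Longrightarrow> dec v \<zeta> x \<Longrightarrow> sec v \<zeta> = x"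
  unfolding sec_def using dec_unique by (intro the_equality) auto

lemma dec_sec:
  assumes v: "v \<in> vertices P" and \<zeta>: "\<zeta> \<in> base X"
  shows "dec v \<zeta> (sec v \<zeta>)"
proof -
  obtain \<zeta>' t where "\<zeta>' \<in> base X" "0 < t" "\<zeta> + \<zeta>' = t *\<^sub>R unit" using companion[OF \<zeta>] .
  then obtain x where "dec v \<zeta> x" using dec_split[OF vertex_in[OF v] \<zeta>] by metis
  then show ?thesis using sec_eqI[OF v] by simp
qed

lemma sec_tot: "v \<in> vertices P \<Longrightarrow> \<zeta> \<in> base X \<Longrightarrow> sec v \<zeta> \<in> tot X"
  and proj_sec: "v \<in> vertices P \<Longrightarrow> \<zeta> \<in> base X \<Longrightarrow> proj X (sec v \<zeta>) = \<zeta>"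
  using dec_sec by (auto simp: dec_def)

lemma sec_add:
  assumes v: "v \<in> vertices P" and \<zeta>: "\<zeta> \<in> base X" and \<zeta>': "\<zeta>' \<in> base X"
  shows "sec v (\<zeta> + \<zeta>') = sec v \<zeta> + sec v \<zeta>'"
proof (rule sec_eqI[OF v])
  obtain y t where y: "y \<in> tot X" "0 \<le> t" "sec v \<zeta> + y = J (t *\<^sub>R v, t)" using dec_sec[OF v \<zeta>] by (auto simp: dec_def)
  obtain y' t' where y': "y' \<in> tot X" "0 \<le> t'" "sec v \<zeta>' + y' = J (t' *\<^sub>R v, t')" using dec_sec[OF v \<zeta>'] by (auto simp: dec_def)
  have "sec v \<zeta> + sec v \<zeta>' + (y + y') = (sec v \<zeta> + y) + (sec v \<zeta>' + y')" by simp
  also have "\<dots> = J ((t + t') *\<^sub>R v, t + t')" unfolding y(3) y'(3) by (simp add: J_add scaleR_add_left)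
  finally have "sec v \<zeta> + sec v \<zeta>' + (y + y') = J ((t + t') *\<^sub>R v, t + t')" .
  moreover have "y + y' \<in> tot X" by (rule convex_cone_add[OF convex_cone_tot y(1) y'(1)])
  moreover have "0 \<le> t + t'" using y(2) y'(2) by simp
  moreover have "sec v \<zeta> + sec v \<zeta>' \<in> tot X" using sec_tot v \<zeta> \<zeta>' by (intro convex_cone_add[OF convex_cone_tot]) auto
  moreover have "proj X (sec v \<zeta> + sec v \<zeta>') = \<zeta> + \<zeta>'" using sec_tot proj_sec v \<zeta> \<zeta>' by (simp add: proj_add)
  ultimately show "dec v (\<zeta> + \<zeta>') (sec v \<zeta> + sec v \<zeta>')" unfolding dec_def by blast
qed

lemma sec_scale:
  assumes v: "v \<in> vertices P" and \<zeta>: "\<zeta> \<in> base X" and r: "0 \<le> r"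
  shows "sec v (r *\<^sub>R \<zeta>) = r *\<^sub>R sec v \<zeta>"
proof (rule sec_eqI[OF v])
  obtain y t where y: "y \<in> tot X" "0 \<le> t" "sec v \<zeta> + y = J (t *\<^sub>R v, t)" using dec_sec[OF v \<zeta>] by (auto simp: dec_def)
  have "r *\<^sub>R sec v \<zeta> + r *\<^sub>R y = r *\<^sub>R J (t *\<^sub>R v, t)" unfolding y(3)[symmetric] by (simp add: scaleR_add_right)
  also have "\<dots> = J ((r * t) *\<^sub>R v, r * t)" by (simp add: J_scale)
  finally have "r *\<^sub>R sec v \<zeta> + r *\<^sub>R y = J ((r * t) *\<^sub>R v, r * t)" .
  moreover have "r *\<^sub>R y \<in> tot X" by (rule convex_cone_scaleR[OF convex_cone_tot r y(1)])
  moreover have "0 \<le> r * t" using y(2) r by simp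
  moreover have "r *\<^sub>R sec v \<zeta> \<in> tot X" using sec_tot v \<zeta> r by (intro convex_cone_scaleR[OF convex_cone_tot]) auto
  moreover have "proj X (r *\<^sub>R sec v \<zeta>) = r *\<^sub>R \<zeta>" using sec_tot proj_sec v \<zeta> r by (simp add: proj_scale)
  ultimately show "dec v (r *\<^sub>R \<zeta>) (r *\<^sub>R sec v \<zeta>)" unfolding dec_def by blast
qed

lemma sec_unit:
  assumes v: "v \<in> vertices P" and t: "0 \<le> t"
  shows "sec v (t *\<^sub>R unit) = J (t *\<^sub>R v, t)"
proof (rule sec_eqI[OF v])
  have "J (t *\<^sub>R v, t) + 0 = J (t *\<^sub>R v, t)" by simp
  moreover have "0 \<in> tot X" by (rule convex_cone_contains_0[OF convex_cone_tot])
  ultimately show "dec v (t *\<^sub>R unit) (J (t *\<^sub>R v, t))"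
    unfolding dec_def using vertex_point[OF vertex_in[OF v] t] t by blast
qed

section \<open>Position relative to the section through \<open>v0\<close>\<close>

definition rel :: "'b \<Rightarrow> 'a" where
  "rel x = (THE y. y \<in> K \<and> x - sec v0 (proj X x) = J (y, 0))"

lemma rel_eqI: "y \<in> K \<Longrightarrow> x - sec v0 (proj X x) = J (y, 0) \<Longrightarrow> rel x = y"
  unfolding rel_def using J_inj_K by (intro the_equality) auto

text \<open>Adding a common companion moves \<open>x\<close> and the section through
  \<open>v0\<close> into the fibre over one multiple of the unit, where \<open>J\<close> identifies
  them with a point of a multiple of \<open>P\<close> and with a multiple of \<open>v0\<close>.
  Their difference lies in the tangent cone.\<close>

lemma rel_spec:
  assumes x: "x \<in> tot X"
  shows "rel x \<in> K" "x - sec v0 (proj X x) = J (rel x, 0)"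
proof -
  have \<zeta>: "proj X x \<in> base X" using proj_base[OF x] .
  obtain \<zeta>' t where \<zeta>': "\<zeta>' \<in> base X" "0 < t" "proj X x + \<zeta>' = t *\<^sub>R unit" using companion[OF \<zeta>] .
  obtain z y where zy: "dec v0 (proj X x) z" "y \<in> tot X" "proj X y = \<zeta>'" "z + y = J (t *\<^sub>R v0, t)"
    using dec_split[OF vertex_in[OF v0] \<zeta> \<zeta>'] by metis
  have z: "sec v0 (proj X x) = z" by (rule sec_eqI[OF v0 zy(1)])
  have "x + y \<in> tot X" "proj X (x + y) = t *\<^sub>R unit"
    using convex_cone_add[OF convex_cone_tot x zy(2)] proj_add[OF x zy(2)] zy(3) \<zeta>'(3) by simp_all
  then obtain q where q: "(q, t) \<in> cone_over P" "x + y = J (q, t)" using J_surj \<zeta>'(2) less_imp_le by metis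
  have "x - z = (x + y) - (z + y)" by simp
  also have "\<dots> = J (q - t *\<^sub>R v0, 0)" unfolding q(2) zy(4) by (simp add: J_diff)
  finally have e: "x - sec v0 (proj X x) = J (q - t *\<^sub>R v0, 0)" using z by simp
  have k: "q - t *\<^sub>R v0 \<in> K" by (rule K_I[OF q(1)])
  have "rel x = q - t *\<^sub>R v0" by (rule rel_eqI[OF k e])
  then show "rel x \<in> K" "x - sec v0 (proj X x) = J (rel x, 0)" using e k by simp_all
qed

lemma rel_recover: "x \<in> tot X \<Longrightarrow> x = sec v0 (proj X x) + J (rel x, 0)"
  using rel_spec(2)[of x] by (metis add_diff_cancel_left' diff_add_cancel add.commute)

lemma rel_add:
  assumes x: "x \<in> tot X" and y: "y \<in> tot X"
  shows "rel (x + y) = rel x + rel y"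
proof (rule rel_eqI)
  show "rel x + rel y \<in> K" using rel_spec x y by (intro convex_cone_add[OF convex_cone_K]) auto
  have "x + y - sec v0 (proj X (x + y)) = (x - sec v0 (proj X x)) + (y - sec v0 (proj X y))"
    by (simp add: proj_add[OF x y] sec_add[OF v0 proj_base[OF x] proj_base[OF y]])
  also have "\<dots> = J (rel x + rel y, 0)" unfolding rel_spec(2)[OF x] rel_spec(2)[OF y] by (simp add: J_add)
  finally show "x + y - sec v0 (proj X (x + y)) = J (rel x + rel y, 0)" .
qed

lemma rel_scale:
  assumes x: "x \<in> tot X" and r: "0 \<le> r"
  shows "rel (r *\<^sub>R x) = r *\<^sub>R rel x"
proof (rule rel_eqI)
  show "r *\<^sub>R rel x \<in> K" using rel_spec x r by (intro convex_cone_scaleR[OF convex_cone_K]) auto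
  have "r *\<^sub>R x - sec v0 (proj X (r *\<^sub>R x)) = r *\<^sub>R (x - sec v0 (proj X x))"
    by (simp add: proj_scale[OF x r] sec_scale[OF v0 proj_base[OF x] r] scaleR_diff_right)
  also have "\<dots> = J (r *\<^sub>R rel x, 0)" unfolding rel_spec(2)[OF x] by (simp add: J_scale)
  finally show "r *\<^sub>R x - sec v0 (proj X (r *\<^sub>R x)) = J (r *\<^sub>R rel x, 0)" .
qed

lemma rel_J:
  assumes "(x, t) \<in> cone_over P"
  shows "rel (J (x, t)) = x - t *\<^sub>R v0"
proof (rule rel_eqI[OF K_I[OF assms]])
  have "0 \<le> t" using assms mem_cone_over_iff by blast
  then show "J (x, t) - sec v0 (proj X (J (x, t))) = J (x - t *\<^sub>R v0, 0)"
    by (simp add: proj_J[OF assms] sec_unit[OF v0] J_diff)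
qed

text \<open>Two points of one fibre become comparable inside a multiple of \<open>P\<close> after
  adding the same companion \<open>y\<close>, and this does not change their difference.\<close>

lemma rel_diff:
  assumes x: "x \<in> tot X" "x' \<in> tot X" "proj X x = proj X x'"
    and a: "(a, t) \<in> cone_over P" "x + y = J (a, t)" and b: "(b, t) \<in> cone_over P" "x' + y = J (b, t)"
  shows "rel x - rel x' = a - b"
proof -
  have "J (rel x, 0) - J (rel x', 0) = (x + y) - (x' + y)"
    unfolding rel_spec(2)[OF x(1), symmetric] rel_spec(2)[OF x(2), symmetric] x(3) by simp
  then have "J (rel x, 0) - J (rel x', 0) = J (a, t) - J (b, t)" by (simp only: a(2) b(2))
  then have "J (rel x, 0) + J (b, t) = J (rel x', 0) + J (a, t)" by (simp add: algebra_simps)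
  \<comment> \<open>\<open>J\<close> is known to be injective on \<open>K\<close> only, so the
    equation between differences is rewritten with sums of elements of \<open>K\<close> on both
    sides.\<close>
  then have "J (rel x, 0) + J (b, t) - J (t *\<^sub>R v0, t) = J (rel x', 0) + J (a, t) - J (t *\<^sub>R v0, t)" by simp
  then have "J (rel x + (b - t *\<^sub>R v0), 0) = J (rel x' + (a - t *\<^sub>R v0), 0)" by (simp add: J_add J_diff algebra_simps)
  moreover have "rel x + (b - t *\<^sub>R v0) \<in> K" "rel x' + (a - t *\<^sub>R v0) \<in> K"
    using rel_spec(1) x K_I a(1) b(1) by (auto intro!: convex_cone_add[OF convex_cone_K])
  ultimately have "rel x + (b - t *\<^sub>R v0) = rel x' + (a - t *\<^sub>R v0)" using J_inj_K by blast
  then have "rel x + b = rel x' + a" by (simp add: algebra_simps)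
  then show ?thesis by (simp add: algebra_simps)
qed

section \<open>Edge lengths and the classifying map\<close>

abbreviation D :: "'a \<Rightarrow> 'c \<Rightarrow> 'a" where
  "D v \<zeta> \<equiv> rel (sec v \<zeta>)"

lemma D_add: "v \<in> vertices P \<Longrightarrow> \<zeta> \<in> base X \<Longrightarrow> \<zeta>' \<in> base X \<Longrightarrow> D v (\<zeta> + \<zeta>') = D v \<zeta> + D v \<zeta>'"
  by (simp add: sec_add rel_add sec_tot)

lemma D_scale: "v \<in> vertices P \<Longrightarrow> \<zeta> \<in> base X \<Longrightarrow> 0 \<le> r \<Longrightarrow> D v (r *\<^sub>R \<zeta>) = r *\<^sub>R D v \<zeta>"
  by (simp add: sec_scale rel_scale sec_tot)

lemma D_v0: "\<zeta> \<in> base X \<Longrightarrow> D v0 \<zeta> = 0"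
  by (rule rel_eqI) (simp_all add: convex_cone_contains_0[OF convex_cone_K] proj_sec[OF v0] J_zero)

lemma D_unit: "v \<in> vertices P \<Longrightarrow> D v unit = v - v0"
  using sec_unit[of v 1] rel_J[of v 1] cone_over_scaled[of 1 v] vertex_in by simp

lemma D_edge:
  assumes E: "closed_segment v w \<in> compact_edges P" and \<zeta>: "\<zeta> \<in> base X"
  obtains t where "0 \<le> t" "D w \<zeta> - D v \<zeta> = t *\<^sub>R (w - v)"
proof -
  have fE: "closed_segment v w face_of P" "v \<noteq> w" using E by (auto simp: compact_edge_iff)
  have v: "v \<in> vertices P" "v \<in> P" and w: "w \<in> vertices P" "w \<in> P" using segment_vertices[OF fE(1)] vertex_in by auto
  obtain \<zeta>' t where \<zeta>': "\<zeta>' \<in> base X" "0 < t" "\<zeta> + \<zeta>' = t *\<^sub>R unit" using companion[OF \<zeta>] .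
  obtain x y where xy: "dec v \<zeta> x" "x \<in> tot X" "proj X x = \<zeta>" "y \<in> tot X" "proj X y = \<zeta>'" "x + y = J (t *\<^sub>R v, t)"
    using dec_split[OF v(2) \<zeta> \<zeta>'] .
  obtain x' y' where xy': "dec w \<zeta> x'" "x' \<in> tot X" "proj X x' = \<zeta>" "y' \<in> tot X" "proj X y' = \<zeta>'" "x' + y' = J (t *\<^sub>R w, t)"
    using dec_split[OF w(2) \<zeta> \<zeta>'] .
  have sec: "sec v \<zeta> = x" "sec w \<zeta> = x'" using sec_eqI v(1) w(1) xy(1) xy'(1) by blast+
  have t0: "0 \<le> t" using \<zeta>'(2) by simp
  have "x + y' \<in> tot X" "proj X (x + y') = t *\<^sub>R unit"
    using convex_cone_add[OF convex_cone_tot xy(2) xy'(4)] proj_add[OF xy(2) xy'(4)] xy(3) xy'(5) \<zeta>'(3) by simp_all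
  then obtain a where a: "(a, t) \<in> cone_over P" "x + y' = J (a, t)" using J_surj[OF _ t0] by metis
  have "x' + y \<in> tot X" "proj X (x' + y) = t *\<^sub>R unit"
    using convex_cone_add[OF convex_cone_tot xy'(2) xy(4)] proj_add[OF xy'(2) xy(4)] xy'(3) xy(5) \<zeta>'(3) by simp_all
  then obtain b where b: "(b, t) \<in> cone_over P" "x' + y = J (b, t)" using J_surj[OF _ t0] by metis
  have "(x + y') + (x' + y) = (x + y) + (x' + y')" by simp
  then have "J (a + b, t + t) = J (t *\<^sub>R v + t *\<^sub>R w, t + t)" unfolding a(2) b(2) xy(6) xy'(6) by (simp add: J_add)
  moreover have "(a + b, t + t) \<in> cone_over P" using convex_cone_add[OF convex_cone_cone_over a(1) b(1)] by simp
  moreover have "(t *\<^sub>R v + t *\<^sub>R w, t + t) \<in> cone_over P"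
    using convex_cone_add[OF convex_cone_cone_over cone_over_scaled[OF t0 v(2)] cone_over_scaled[OF t0 w(2)]] by simp
  ultimately have ab: "a + b = t *\<^sub>R v + t *\<^sub>R w" using J_inj by blast
  define a' b' where "a' = (1 / t) *\<^sub>R a" and "b' = (1 / t) *\<^sub>R b"
  have a'b': "a' \<in> P" "b' \<in> P" "a = t *\<^sub>R a'" "a' + b' = v + w"
  proof -
    show "a' \<in> P" "b' \<in> P" unfolding a'_def b'_def using cone_over_section a(1) b(1) \<zeta>'(2) by blast+
    show "a = t *\<^sub>R a'" using \<zeta>'(2) by (simp add: a'_def)
    have "(1 / t) *\<^sub>R (a + b) = v + w" unfolding ab using \<zeta>'(2) by (simp add: scaleR_add_right)
    then show "a' + b' = v + w" by (simp add: a'_def b'_def scaleR_add_right)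
  qed
  have mid: "midpoint a' b' = midpoint v w" unfolding midpoint_def a'b'(4) ..
  have "midpoint v w \<in> closed_segment v w" by simp
  \<comment> \<open>If the two crossed sums coincide, the open segment between them is empty and the
    face property gives nothing; then \<open>a'\<close> is the midpoint itself.\<close>
  have "a' \<in> closed_segment v w"
  proof (cases "a' = b'")
    case True
    then have "a' = midpoint v w" using mid by simp
    then show ?thesis by simp
  next
    case False
    then have "midpoint v w \<in> open_segment a' b'" using mid by (metis midpoint_in_open_segment)
    then show ?thesis using face_ofD[OF fE(1) _ a'b'(1,2)] \<open>midpoint v w \<in> closed_segment v w\<close> by blast
  qed
  then obtain l where l: "0 \<le> l" "l \<le> 1" "a' = (1 - l) *\<^sub>R v + l *\<^sub>R w" by (auto simp: in_segment)
  \<comment> \<open>Both points are compared with the companion \<open>y'\<close>. As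
    \<open>a'\<close> divides the edge in the ratio given by \<open>l\<close>, the factor is
    \<open>t\<close> times the share \<open>1 - l\<close> left up to \<open>w\<close>.\<close>
  have "rel x' - rel x = t *\<^sub>R w - a"
    by (rule rel_diff[OF xy'(2) xy(2) _ cone_over_scaled[OF t0 w(2)] xy'(6) a]) (simp add: xy xy')
  also have "\<dots> = (t * (1 - l)) *\<^sub>R (w - v)" unfolding a'b'(3) l(3) by (simp add: algebra_simps)
  finally have "D w \<zeta> - D v \<zeta> = (t * (1 - l)) *\<^sub>R (w - v)" by (simp add: sec)
  moreover have "0 \<le> t * (1 - l)" using t0 l by simp
  ultimately show thesis using that by blast
qed

text \<open>Coordinates are indexed by segments as sets, so the length is required to fit both
  orientations; reversal changes the sign of both sides.\<close>

definition edge_length :: "'a set \<Rightarrow> 'c \<Rightarrow> real" where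
  "edge_length E \<zeta> = (THE t. \<forall>v w. E = closed_segment v w \<longrightarrow> D w \<zeta> - D v \<zeta> = t *\<^sub>R (w - v))"

lemma edge_length_eqI:
  assumes E: "closed_segment v w \<in> compact_edges P" and t: "D w \<zeta> - D v \<zeta> = t *\<^sub>R (w - v)"
  shows "edge_length (closed_segment v w) \<zeta> = t"
  unfolding edge_length_def
proof (rule the_equality)
  have ne: "v \<noteq> w" using E by (auto simp: compact_edge_iff)
  show "\<forall>v' w'. closed_segment v w = closed_segment v' w' \<longrightarrow> D w' \<zeta> - D v' \<zeta> = t *\<^sub>R (w' - v')"
  proof (intro allI impI)
    fix v' w' assume "closed_segment v w = closed_segment v' w'"
    then have "{v, w} = {v', w'}" by (simp only: closed_segment_eq)
    then consider "v' = v" "w' = w" | "v' = w" "w' = v" using ne by (auto simp: doubleton_eq_iff)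
    then show "D w' \<zeta> - D v' \<zeta> = t *\<^sub>R (w' - v')"
    proof cases
      case 2
      have "D v \<zeta> - D w \<zeta> = - (D w \<zeta> - D v \<zeta>)" by simp
      also have "\<dots> = t *\<^sub>R (v - w)" unfolding t by (simp flip: scaleR_minus_right)
      finally show ?thesis using 2 by simp
    qed (use t in simp)
  qed
  fix t' assume "\<forall>v' w'. closed_segment v w = closed_segment v' w' \<longrightarrow> D w' \<zeta> - D v' \<zeta> = t' *\<^sub>R (w' - v')"
  then have "t' *\<^sub>R (w - v) = t *\<^sub>R (w - v)" using t by metis
  then show "t' = t" using ne by simp
qed

lemma edge_length:
  assumes E: "closed_segment v w \<in> compact_edges P" and \<zeta>: "\<zeta> \<in> base X"
  shows "D w \<zeta> - D v \<zeta> = edge_length (closed_segment v w) \<zeta> *\<^sub>R (w - v)" "0 \<le> edge_length (closed_segment v w) \<zeta>"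
proof -
  obtain t where t: "0 \<le> t" "D w \<zeta> - D v \<zeta> = t *\<^sub>R (w - v)" using D_edge[OF E \<zeta>] .
  then show "D w \<zeta> - D v \<zeta> = edge_length (closed_segment v w) \<zeta> *\<^sub>R (w - v)" "0 \<le> edge_length (closed_segment v w) \<zeta>"
    using edge_length_eqI[OF E t(2)] by simp_all
qed

definition classify :: "'c \<Rightarrow> 'a set \<Rightarrow>\<^sub>0 real" where
  "classify \<zeta> = (\<Sum>E\<in>compact_edges P. Poly_Mapping.single E (edge_length E \<zeta>))"

lemma lookup_classify: "Poly_Mapping.lookup (classify \<zeta>) E = (if E \<in> compact_edges P then edge_length E \<zeta> else 0)"
proof -
  have "Poly_Mapping.lookup (classify \<zeta>) E = (\<Sum>e\<in>compact_edges P. if e = E then edge_length e \<zeta> else 0)"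
    unfolding classify_def lookup_sum by (rule sum.cong) (auto simp: lookup_single when_def)
  then show ?thesis using finite_compact_edges by (simp add: sum.delta)
qed

lemma vmap_classify: "\<zeta> \<in> base X \<Longrightarrow> vmap (classify \<zeta>) (vertices P) (\<lambda>v. D v \<zeta>)"
  unfolding vmap_def using edge_length(1) by (simp add: lookup_classify)

lemma classify_CP:
  assumes \<zeta>: "\<zeta> \<in> base X" shows "classify \<zeta> \<in> CP P"
proof (rule CP_I[OF _ _ vmap_classify[OF \<zeta>]])
  fix E assume E: "E \<in> compact_edges P"
  then obtain v w where "E = closed_segment v w" by (rule compact_edgeE)
  then show "0 \<le> Poly_Mapping.lookup (classify \<zeta>) E" using E edge_length(2)[OF _ \<zeta>] by (simp add: lookup_classify)
qed (simp add: lookup_classify)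

lemma vtx_classify: "\<zeta> \<in> base X \<Longrightarrow> v \<in> vertices P \<Longrightarrow> vtx (classify \<zeta>) v = D v \<zeta>"
  by (rule vtx_eqI[OF classify_CP vmap_classify]) (simp_all add: D_v0)

text \<open>An edge vector is nonzero, so its factor can be recovered from the images of its ends.
  Identities in \<open>CP P\<close> are thereby reduced to identities at the vertices.\<close>

lemma CP_eqI:
  assumes \<xi>: "\<xi> \<in> CP P" "\<eta> \<in> CP P" and eq: "\<And>v. v \<in> vertices P \<Longrightarrow> vtx \<xi> v = vtx \<eta> v"
  shows "\<xi> = \<eta>"
proof (rule poly_mapping_eqI)
  fix E show "Poly_Mapping.lookup \<xi> E = Poly_Mapping.lookup \<eta> E"
  proof (cases "E \<in> compact_edges P")
    case True
    then obtain v w where vw: "v \<in> vertices P" "w \<in> vertices P" "v \<noteq> w" "E = closed_segment v w" by (rule compact_edgeE)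
    have "vtx \<xi> w - vtx \<xi> v = tcoord \<xi> v w *\<^sub>R (w - v)" "vtx \<eta> w - vtx \<eta> v = tcoord \<eta> v w *\<^sub>R (w - v)"
      using vmap_vtx \<xi> vw True by (auto simp: vmap_def)
    then have "tcoord \<xi> v w *\<^sub>R (w - v) = tcoord \<eta> v w *\<^sub>R (w - v)"
      using eq[OF vw(1)] eq[OF vw(2)] by metis
    then show ?thesis using vw(3,4) by simp
  next
    case False then show ?thesis using \<xi> by (simp add: mem_CP)
  qed
qed

lemma classify_add:
  assumes \<zeta>: "\<zeta> \<in> base X" "\<zeta>' \<in> base X"
  shows "classify (\<zeta> + \<zeta>') = classify \<zeta> + classify \<zeta>'"
proof (rule CP_eqI)
  have s: "\<zeta> + \<zeta>' \<in> base X" by (rule convex_cone_add[OF convex_cone_base \<zeta>])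
  show "classify (\<zeta> + \<zeta>') \<in> CP P" by (rule classify_CP[OF s])
  show "classify \<zeta> + classify \<zeta>' \<in> CP P" by (intro convex_cone_add[OF convex_cone_CP] classify_CP \<zeta>)
  show "vtx (classify (\<zeta> + \<zeta>')) v = vtx (classify \<zeta> + classify \<zeta>') v" if v: "v \<in> vertices P" for v
    by (simp add: vtx_classify[OF s v] vtx_add[OF classify_CP[OF \<zeta>(1)] classify_CP[OF \<zeta>(2)] v]
        vtx_classify[OF \<zeta>(1) v] vtx_classify[OF \<zeta>(2) v] D_add[OF v \<zeta>])
qed

lemma classify_scale:
  assumes \<zeta>: "\<zeta> \<in> base X" and r: "0 \<le> r"
  shows "classify (r *\<^sub>R \<zeta>) = r *\<^sub>R classify \<zeta>"
proof (rule CP_eqI)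
  have s: "r *\<^sub>R \<zeta> \<in> base X" by (rule convex_cone_scaleR[OF convex_cone_base r \<zeta>])
  show "classify (r *\<^sub>R \<zeta>) \<in> CP P" by (rule classify_CP[OF s])
  show "r *\<^sub>R classify \<zeta> \<in> CP P" by (intro convex_cone_scaleR[OF convex_cone_CP] classify_CP \<zeta> r)
  show "vtx (classify (r *\<^sub>R \<zeta>)) v = vtx (r *\<^sub>R classify \<zeta>) v" if v: "v \<in> vertices P" for v
    by (simp add: vtx_classify[OF s v] vtx_scale[OF classify_CP[OF \<zeta>] r v] vtx_classify[OF \<zeta> v] D_scale[OF v \<zeta> r])
qed

lemma classify_unit: "classify unit = one_CP P"
  by (rule CP_eqI) (simp_all add: classify_CP one_in_CP unit_base vtx_classify D_unit vtx_one)

text \<open>For each normal pair \<open>(m, u)\<close>, \<open>x\<close> is compared with the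
  section through \<open>m\<close> in its own fibre. By \<open>rel_diff\<close> the difference is
  \<open>a - t *\<^sub>R m\<close> with \<open>(a, t)\<close> in cone(P), so \<open>u\<close> is
  nonnegative on it.\<close>

lemma rel_in_summand:
  assumes x: "x \<in> tot X"
  shows "rel x \<in> summand P v0 (classify (proj X x))"
proof -
  have \<zeta>: "proj X x \<in> base X" by (rule proj_base[OF x])
  show ?thesis
    unfolding mem_summand_iff[OF classify_CP[OF \<zeta>]]
  proof (intro allI impI)
    fix u m assume mu: "minimizes m u"
    then have m: "m \<in> vertices P" "m \<in> P" using vertex_in by (auto simp: minimizes_def)
    obtain \<zeta>' t where \<zeta>': "\<zeta>' \<in> base X" "0 < t" "proj X x + \<zeta>' = t *\<^sub>R unit" using companion[OF \<zeta>] .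
    have t0: "0 \<le> t" using \<zeta>'(2) by simp
    obtain z y where zy: "dec m (proj X x) z" "z \<in> tot X" "proj X z = proj X x" "y \<in> tot X" "proj X y = \<zeta>'" "z + y = J (t *\<^sub>R m, t)"
      using dec_split[OF m(2) \<zeta> \<zeta>'] .
    have "x + y \<in> tot X" "proj X (x + y) = t *\<^sub>R unit"
      using convex_cone_add[OF convex_cone_tot x zy(4)] proj_add[OF x zy(4)] zy(5) \<zeta>'(3) by simp_all
    then obtain a where a: "(a, t) \<in> cone_over P" "x + y = J (a, t)" using J_surj[OF _ t0] by metis
    have "rel x - rel z = a - t *\<^sub>R m"
      by (rule rel_diff[OF x zy(2) zy(3)[symmetric] a cone_over_scaled[OF t0 m(2)] zy(6)])
    then have "u \<bullet> rel x - u \<bullet> rel z = u \<bullet> a - t * (u \<bullet> m)" by (metis inner_diff_right inner_scaleR_right)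
    moreover have "t * (u \<bullet> m) \<le> u \<bullet> a" using a(1) mu mem_cone_over_iff by blast
    moreover have "vtx (classify (proj X x)) m = rel z"
      using vtx_classify[OF \<zeta> m(1)] sec_eqI[OF m(1) zy(1)] by simp
    ultimately show "u \<bullet> vtx (classify (proj X x)) m \<le> u \<bullet> rel x" by simp
  qed
qed

lemma convex_fibre: "convex (fibre X \<zeta>)"
  unfolding convex_def
proof (intro ballI allI impI)
  fix x y and r s :: real
  assume xy: "x \<in> fibre X \<zeta>" "y \<in> fibre X \<zeta>" and rs: "0 \<le> r" "0 \<le> s" "r + s = 1"
  then have m: "r *\<^sub>R x \<in> tot X" "s *\<^sub>R y \<in> tot X"
    using convex_cone_scaleR[OF convex_cone_tot] by (auto simp: fibre_def)
  have "r *\<^sub>R \<zeta> + s *\<^sub>R \<zeta> = \<zeta>" using rs(3) by (metis scaleR_left_distrib scaleR_one)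
  then show "r *\<^sub>R x + s *\<^sub>R y \<in> fibre X \<zeta>"
    using xy rs convex_cone_add[OF convex_cone_tot m] proj_add[OF m] by (simp add: fibre_def proj_scale)
qed

text \<open>This makes the square Cartesian. The vertices of the summand come from the sections,
  convex combinations stay in the convex fibre, and tail directions come from cone(P) at height
  0.\<close>

lemma lift_summand:
  assumes \<zeta>: "\<zeta> \<in> base X" and y: "y \<in> summand P v0 (classify \<zeta>)"
  shows "sec v0 \<zeta> + J (y, 0) \<in> tot X" "proj X (sec v0 \<zeta> + J (y, 0)) = \<zeta>" "rel (sec v0 \<zeta> + J (y, 0)) = y"
proof -
  obtain k a where k: "k \<in> convex hull (vtx (classify \<zeta>) ` vertices P)" "a \<in> tail P" "y = k + a"
    using y unfolding summand_def by (rule set_plus_elim)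
  \<comment> \<open>Membership in \<open>K\<close> is carried along because \<open>rel\<close> can
    be read off by \<open>rel_eqI\<close> only there.\<close>
  let ?M = "K \<inter> {k. sec v0 \<zeta> + J (k, 0) \<in> fibre X \<zeta>}"
  have "linear (\<lambda>k. J (k, 0))" by (rule linearI) (simp_all add: J_add J_scale)
  then have "convex ?M"
    using convex_cone_K by (intro convex_Int convex_affine_vimage convex_fibre) (simp add: convex_cone_def)
  moreover have "vtx (classify \<zeta>) ` vertices P \<subseteq> ?M"
  proof (intro image_subsetI)
    fix v assume v: "v \<in> vertices P"
    have s: "sec v \<zeta> \<in> tot X" "proj X (sec v \<zeta>) = \<zeta>" using sec_tot proj_sec v \<zeta> by auto
    have "sec v \<zeta> = sec v0 \<zeta> + J (D v \<zeta>, 0)" using rel_recover[OF s(1)] s(2) by simp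
    then show "vtx (classify \<zeta>) v \<in> ?M"
      using s rel_spec(1)[OF s(1)] by (simp add: vtx_classify[OF \<zeta> v] fibre_def)
  qed
  ultimately have "convex hull (vtx (classify \<zeta>) ` vertices P) \<subseteq> ?M" by (intro hull_minimal)
  then have kM: "k \<in> K" "sec v0 \<zeta> + J (k, 0) \<in> tot X" "proj X (sec v0 \<zeta> + J (k, 0)) = \<zeta>"
    using k(1) by (auto simp: fibre_def)
  have a0: "(a, 0) \<in> cone_over P" using minimizes_tail k(2) by (simp add: mem_cone_over_iff)
  have aK: "a \<in> K" using K_I[OF a0] by simp
  have yK: "y \<in> K" unfolding k(3) by (rule convex_cone_add[OF convex_cone_K kM(1) aK])
  have e: "sec v0 \<zeta> + J (y, 0) = (sec v0 \<zeta> + J (k, 0)) + J (a, 0)"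
    using J_add[of k 0 a 0] by (simp add: k(3) add.assoc)
  show t: "sec v0 \<zeta> + J (y, 0) \<in> tot X"
    unfolding e by (rule convex_cone_add[OF convex_cone_tot kM(2) J_tot[OF a0]])
  show p: "proj X (sec v0 \<zeta> + J (y, 0)) = \<zeta>"
    unfolding e proj_add[OF kM(2) J_tot[OF a0]] kM(3) proj_J[OF a0] by simp
  show "rel (sec v0 \<zeta> + J (y, 0)) = y"
    by (rule rel_eqI[OF yK]) (simp only: p add_diff_cancel_left')
qed

lemma F_morphism_exists:
  "F_morphism P X (tautological_family P v0) (restrict classify (base X))
     (restrict (\<lambda>x. (classify (proj X x), rel x)) (tot X))"
proof -
  let ?T = "tautological_family P v0"
  let ?f = "restrict classify (base X)"
  let ?g = "restrict (\<lambda>x. (classify (proj X x), rel x)) (tot X)"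
  have g_mem: "(classify (proj X x), rel x) \<in> CtP P v0" if "x \<in> tot X" for x
    using classify_CP[OF proj_base[OF that]] rel_in_summand[OF that] by (simp add: CtP_def)
  have f_hom: "?f \<in> cone_hom (base X) (base ?T)"
  proof -
    obtain G where "linear G" "\<And>\<zeta>. \<zeta> \<in> base X \<Longrightarrow> G \<zeta> = classify \<zeta>"
      using convex_cone_linear_extension[OF convex_cone_base, of classify] classify_add classify_scale by metis
    moreover have "?f \<in> base X \<rightarrow>\<^sub>E CP P" using classify_CP by auto
    ultimately show ?thesis unfolding cone_hom_def by (auto simp: tautological_family_def intro!: exI[of _ G])
  qed
  have g_hom: "?g \<in> cone_hom (tot X) (tot ?T)"
  proof -
    obtain G where "linear G" "\<And>x. x \<in> tot X \<Longrightarrow> G x = (classify (proj X x), rel x)"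
    proof (rule convex_cone_linear_extension[OF convex_cone_tot, of "\<lambda>x. (classify (proj X x), rel x)"])
      show "(classify (proj X (x + y)), rel (x + y)) = (classify (proj X x), rel x) + (classify (proj X y), rel y)"
        if "x \<in> tot X" "y \<in> tot X" for x y
        using that by (simp add: proj_add classify_add proj_base rel_add)
      show "(classify (proj X (r *\<^sub>R x)), rel (r *\<^sub>R x)) = r *\<^sub>R (classify (proj X x), rel x)"
        if "x \<in> tot X" "0 \<le> r" for x r
        using that by (simp add: proj_scale classify_scale proj_base rel_scale)
    qed blast
    moreover have "?g \<in> tot X \<rightarrow>\<^sub>E CtP P v0" using g_mem by auto
    ultimately show ?thesis unfolding cone_hom_def by (auto simp: tautological_family_def intro!: exI[of _ G])
  qed
  have "cartesian_square (tot X) (tot ?T) (base X) ?g (proj X) (proj ?T) ?f"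
    unfolding cartesian_square_def bij_betw_def
  proof
    show "inj_on (\<lambda>x. (?g x, proj X x)) (tot X)"
    proof (rule inj_onI)
      fix x y assume xy: "x \<in> tot X" "y \<in> tot X" "(?g x, proj X x) = (?g y, proj X y)"
      then have "proj X x = proj X y" "rel x = rel y" by auto
      then show "x = y" using rel_recover[OF xy(1)] rel_recover[OF xy(2)] by simp
    qed
    show "(\<lambda>x. (?g x, proj X x)) ` tot X = {(b, c). b \<in> tot ?T \<and> c \<in> base X \<and> proj ?T b = ?f c}"
    proof (intro equalityI subsetI)
      fix q assume "q \<in> (\<lambda>x. (?g x, proj X x)) ` tot X"
      then show "q \<in> {(b, c). b \<in> tot ?T \<and> c \<in> base X \<and> proj ?T b = ?f c}"
        using g_mem proj_base by (auto simp: tautological_family_def)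
    next
      fix q assume "q \<in> {(b, c). b \<in> tot ?T \<and> c \<in> base X \<and> proj ?T b = ?f c}"
      then obtain y c where q: "q = ((classify c, y), c)" "y \<in> summand P v0 (classify c)" "c \<in> base X"
        by (auto simp: tautological_family_def CtP_def)
      let ?x = "sec v0 c + J (y, 0)"
      have "?x \<in> tot X" "q = (?g ?x, proj X ?x)" using lift_summand[OF q(3,2)] by (simp_all add: q(1))
      then show "q \<in> (\<lambda>x. (?g x, proj X x)) ` tot X" by blast
    qed
  qed
  moreover have "?f unit = emb ?T 1" using unit_base by (simp add: classify_unit tautological_family_def)
  moreover have "?g (ident X (x, 1)) = ident ?T (x, 1)" if "x \<in> P" for x
  proof -
    have c: "(x, 1) \<in> cone_over P" using cone_over_scaled[of 1 x] that by simp
    show ?thesis using J_tot[OF c] proj_J[OF c] rel_J[OF c] c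
      by (simp add: ident_J[OF c] classify_unit tautological_family_def)
  qed
  ultimately show ?thesis unfolding F_morphism_def using f_hom g_hom by blast
qed

end

lemma (in based_polyhedron) tautological_F_family_over: "F_family_over P v0 (tautological_family P v0)"
  using F_family_tautological by unfold_locales

section \<open>Uniqueness of the morphism\<close>

context F_family_over
begin

lemma F_morphism_unique:
  assumes mor: "F_morphism P X (tautological_family P v0) f g"
  shows "f = restrict classify (base X)" "g = restrict (\<lambda>x. (classify (proj X x), rel x)) (tot X)"
proof -
  let ?T = "tautological_family P v0"
  \<comment> \<open>The tautological family is a family over \<open>P\<close> itself, so uniqueness
    of vertex decompositions is also available in the target.\<close>
  interpret T: F_family_over P v0 ?T by (rule tautological_F_family_over)
  have f: "f \<in> base X \<rightarrow>\<^sub>E CP P" and g: "g \<in> tot X \<rightarrow>\<^sub>E CtP P v0"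
    using mor by (auto simp: F_morphism_def cone_hom_def tautological_family_def)
  obtain L where L: "linear L" "\<And>\<zeta>. \<zeta> \<in> base X \<Longrightarrow> f \<zeta> = L \<zeta>"
    using mor by (auto simp: F_morphism_def cone_hom_def)
  obtain G where G: "linear G" "\<And>x. x \<in> tot X \<Longrightarrow> g x = G x"
    using mor by (auto simp: F_morphism_def cone_hom_def)
  have over: "fst (g x) = f (proj X x)" if x: "x \<in> tot X" for x
  proof -
    have "(g x, proj X x) \<in> {(b, c). b \<in> tot ?T \<and> c \<in> base X \<and> proj ?T b = f c}"
      using mor x unfolding F_morphism_def cartesian_square_def by (blast dest: bij_betwE)
    then show ?thesis by (auto simp: tautological_family_def)
  qed
  have JT: "T.J (x, t) = (t *\<^sub>R one_CP P, x - t *\<^sub>R v0)" if "(x, t) \<in> cone_over P" for x t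
    using T.ident_J[OF that] that by (simp add: tautological_family_def)
  have GJ1: "G (J (x, 1)) = (one_CP P, x - v0)" if "x \<in> P" for x
  proof -
    have c: "(x, 1) \<in> cone_over P" using cone_over_scaled[of 1 x] that by simp
    have "g (ident X (x, 1)) = ident ?T (x, 1)" using mor that by (simp add: F_morphism_def)
    then show ?thesis using G(2)[OF J_tot[OF c]] c by (simp add: ident_J[OF c] tautological_family_def)
  qed
  \<comment> \<open>A morphism is prescribed only on the slice at height 1. Shifting by
    \<open>v0\<close> raises the height to \<open>t + 1 > 0\<close>, so linearity also determines
    the points at height 0.\<close>
  have GJ: "G (J (x, t)) = (t *\<^sub>R one_CP P, x - t *\<^sub>R v0)" if xt: "(x, t) \<in> cone_over P" for x t
  proof -
    have t: "0 \<le> t" using xt mem_cone_over_iff by blast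
    have "(x, t) + (1 *\<^sub>R v0, 1) \<in> cone_over P"
      by (rule convex_cone_add[OF convex_cone_cone_over xt v0_ray]) simp
    then have xv: "(x + v0, t + 1) \<in> cone_over P" by simp
    let ?z = "(1 / (t + 1)) *\<^sub>R (x + v0)"
    have "?z \<in> P" by (rule cone_over_section[OF xv]) (use t in simp)
    then have z: "G (J (?z, 1)) = (one_CP P, ?z - v0)" by (rule GJ1)
    have v: "G (J (v0, 1)) = (one_CP P, 0)" using GJ1[OF vertex_in[OF v0]] by simp
    have zs: "(t + 1) *\<^sub>R ?z = x + v0" using t by simp
    have "J (x, t) = (t + 1) *\<^sub>R J (?z, 1) - J (v0, 1)"
      unfolding J_scale J_diff zs by simp
    then have "G (J (x, t)) = (t + 1) *\<^sub>R (one_CP P, ?z - v0) - (one_CP P, 0)"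
      by (simp only: linear_diff[OF G(1)] linear_scale[OF G(1)] z v)
    also have "\<dots> = (t *\<^sub>R one_CP P, (t + 1) *\<^sub>R ?z - (t + 1) *\<^sub>R v0)"
      by (simp add: scaleR_diff_right scaleR_add_left)
    also have "\<dots> = (t *\<^sub>R one_CP P, x - t *\<^sub>R v0)" unfolding zs by (simp add: scaleR_add_left)
    finally show ?thesis .
  qed
  have GJ0: "G (J (y, 0)) = (0, y)" if y: "y \<in> K" for y
  proof -
    obtain s where s: "0 \<le> s" "(y + s *\<^sub>R v0, s) \<in> cone_over P" using y by (auto simp: K_def)
    have "J (y, 0) = J (y + s *\<^sub>R v0, s) - J (s *\<^sub>R v0, s)" by (simp add: J_diff)
    then have "G (J (y, 0)) = G (J (y + s *\<^sub>R v0, s)) - G (J (s *\<^sub>R v0, s))" by (simp only: linear_diff[OF G(1)])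
    then show ?thesis unfolding GJ[OF s(2)] GJ[OF v0_ray[OF s(1)]] by simp
  qed
  \<comment> \<open>In the target, the decompositions of the vertices are those given by the
    vertices of the summands.\<close>
  have decT: "T.dec v \<xi> (\<xi>, vtx \<xi> v)" if v: "v \<in> vertices P" and \<xi>: "\<xi> \<in> CP P" for v \<xi>
  proof -
    have "\<xi> \<in> base ?T" "emb ?T 1 = one_CP P" using \<xi> by (simp_all add: tautological_family_def)
    then obtain \<xi>' t where \<xi>': "\<xi>' \<in> CP P" "0 < t" "\<xi> + \<xi>' = t *\<^sub>R one_CP P"
      using T.companion[of \<xi>] by (auto simp: tautological_family_def)
    have t: "0 \<le> t" using \<xi>'(2) by simp
    have "vtx \<xi> v + vtx \<xi>' v = t *\<^sub>R v - t *\<^sub>R v0"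
      using vtx_add[OF \<xi> \<xi>'(1) v] vtx_scaled_one[OF t v] by (simp add: \<xi>'(3) scaleR_diff_right)
    then have "(\<xi>, vtx \<xi> v) + (\<xi>', vtx \<xi>' v) = T.J (t *\<^sub>R v, t)"
      using JT[OF cone_over_scaled[OF t vertex_in[OF v]]] by (simp add: \<xi>'(3))
    moreover have "(\<xi>, vtx \<xi> v) \<in> tot ?T" "(\<xi>', vtx \<xi>' v) \<in> tot ?T" "proj ?T (\<xi>, vtx \<xi> v) = \<xi>"
      using vtx_in_summand[OF v] \<xi> \<xi>'(1) by (simp_all add: CtP_def tautological_family_def)
    ultimately show ?thesis unfolding T.dec_def using t by blast
  qed
  have g_sec: "g (sec v \<zeta>) = (f \<zeta>, vtx (f \<zeta>) v)" if v: "v \<in> vertices P" and \<zeta>: "\<zeta> \<in> base X" for v \<zeta>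
  proof (rule T.dec_unique[OF v])
    have f\<zeta>: "f \<zeta> \<in> CP P" using f \<zeta> by auto
    show "T.dec v (f \<zeta>) (f \<zeta>, vtx (f \<zeta>) v)" by (rule decT[OF v f\<zeta>])
    obtain y t where y: "y \<in> tot X" "0 \<le> t" "sec v \<zeta> + y = J (t *\<^sub>R v, t)" using dec_sec[OF v \<zeta>] by (auto simp: dec_def)
    have s: "sec v \<zeta> \<in> tot X" "proj X (sec v \<zeta>) = \<zeta>" using sec_tot proj_sec v \<zeta> by auto
    have c: "(t *\<^sub>R v, t) \<in> cone_over P" by (rule cone_over_scaled[OF y(2) vertex_in[OF v]])
    have "g (sec v \<zeta>) + g y = G (sec v \<zeta> + y)"
      unfolding G(2)[OF s(1)] G(2)[OF y(1)] by (rule linear_add[OF G(1), symmetric])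
    also have "\<dots> = T.J (t *\<^sub>R v, t)" unfolding y(3) GJ[OF c] JT[OF c] ..
    finally have "g (sec v \<zeta>) + g y = T.J (t *\<^sub>R v, t)" .
    moreover have gT: "g (sec v \<zeta>) \<in> tot ?T" "g y \<in> tot ?T" using g s(1) y(1) by (auto simp: tautological_family_def)
    moreover have "proj ?T (g (sec v \<zeta>)) = f \<zeta>" using over[OF s(1)] s(2) gT(1) by (simp add: tautological_family_def)
    ultimately show "T.dec v (f \<zeta>) (g (sec v \<zeta>))" unfolding T.dec_def using y(2) by blast
  qed
  \<comment> \<open>The images of the sections through \<open>v\<close> and \<open>v0\<close> have
    second components that differ by \<open>D v \<zeta>\<close>; as the one at \<open>v0\<close>
    vanishes, the vertices of the summand at \<open>f \<zeta>\<close> are those at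
    \<open>classify \<zeta>\<close>.\<close>
  have f_eq: "f \<zeta> = classify \<zeta>" if \<zeta>: "\<zeta> \<in> base X" for \<zeta>
  proof (rule CP_eqI)
    show f\<zeta>: "f \<zeta> \<in> CP P" using f \<zeta> by auto
    show "classify \<zeta> \<in> CP P" by (rule classify_CP[OF \<zeta>])
    fix v assume v: "v \<in> vertices P"
    have s: "sec v \<zeta> \<in> tot X" "proj X (sec v \<zeta>) = \<zeta>" "sec v0 \<zeta> \<in> tot X" using sec_tot proj_sec v v0 \<zeta> by auto
    have "sec v \<zeta> = sec v0 \<zeta> + J (D v \<zeta>, 0)" using rel_recover[OF s(1)] s(2) by simp
    then have "G (sec v \<zeta>) = G (sec v0 \<zeta>) + G (J (D v \<zeta>, 0))" by (metis linear_add[OF G(1)])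
    then have "g (sec v \<zeta>) = g (sec v0 \<zeta>) + (0, D v \<zeta>)"
      by (simp add: G(2) s GJ0[OF rel_spec(1)[OF s(1)]])
    then show "vtx (f \<zeta>) v = vtx (classify \<zeta>) v"
      by (simp add: g_sec[OF v \<zeta>] g_sec[OF v0 \<zeta>] vtx_v0[OF f\<zeta>] vtx_classify[OF \<zeta> v])
  qed
  show "f = restrict classify (base X)"
    using f f_eq by (intro extensionalityI[of _ "base X"]) (auto simp: PiE_def)
  have g_eq: "g x = (classify (proj X x), rel x)" if x: "x \<in> tot X" for x
  proof -
    have \<zeta>: "proj X x \<in> base X" by (rule proj_base[OF x])
    have "x = sec v0 (proj X x) + J (rel x, 0)" by (rule rel_recover[OF x])
    then have "G x = G (sec v0 (proj X x)) + G (J (rel x, 0))" by (metis linear_add[OF G(1)])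
    then have "g x = g (sec v0 (proj X x)) + (0, rel x)"
      by (simp add: G(2) x sec_tot[OF v0 \<zeta>] GJ0[OF rel_spec(1)[OF x]])
    moreover have "f (proj X x) \<in> CP P" using f \<zeta> by auto
    ultimately show ?thesis by (simp add: g_sec[OF v0 \<zeta>] vtx_v0 f_eq[OF \<zeta>])
  qed
  show "g = restrict (\<lambda>x. (classify (proj X x), rel x)) (tot X)"
    using g g_eq by (intro extensionalityI[of _ "tot X"]) (auto simp: PiE_def)
qed

lemma F_morphism_terminal:
  "(\<exists>!f. \<exists>g. F_morphism P X (tautological_family P v0) f g) \<and>
   (\<exists>!(f, g). F_morphism P X (tautological_family P v0) f g)"
proof
  show "\<exists>!f. \<exists>g. F_morphism P X (tautological_family P v0) f g"
    using F_morphism_exists F_morphism_unique(1) by (intro ex1I) blast+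
  show "\<exists>!(f, g). F_morphism P X (tautological_family P v0) f g"
  proof (rule ex1I)
    show "case (restrict classify (base X), restrict (\<lambda>x. (classify (proj X x), rel x)) (tot X)) of
        (f, g) \<Rightarrow> F_morphism P X (tautological_family P v0) f g"
      unfolding prod.case by (rule F_morphism_exists)
    fix h assume "case h of (f, g) \<Rightarrow> F_morphism P X (tautological_family P v0) f g"
    then show "h = (restrict classify (base X), restrict (\<lambda>x. (classify (proj X x), rel x)) (tot X))"
      using F_morphism_unique by (cases h) blast
  qed
qed

end

lemma rational_polyhedron_imp_polyhedron:
  fixes P :: "'a::euclidean_space set"
  assumes "rational_polyhedron N P"
  shows "polyhedron P"
proof -
  obtain H :: "('a \<times> real) set" where H: "finite H" "P = {x \<in> span N. \<forall>(u, b)\<in>H. u \<bullet> x \<le> b}"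
    using assms unfolding rational_polyhedron_def by blast
  have "polyhedron (span N)" by (intro affine_imp_polyhedron subspace_imp_affine subspace_span)
  moreover have "polyhedron (\<Inter>((\<lambda>(u, b). {x. u \<bullet> x \<le> b}) ` H))"
    using H(1) by (intro polyhedron_Inter) (auto simp: polyhedron_halfspace_le)
  moreover have "P = span N \<inter> \<Inter>((\<lambda>(u, b). {x. u \<bullet> x \<le> b}) ` H)"
    unfolding H(2) by auto
  ultimately show ?thesis by (metis polyhedron_Int)
qed

theorem proposition4p8:
  fixes N P :: "'a::euclidean_space set" and v0 :: 'a
  assumes "is_lattice N"
    and "rational_polyhedron N P"
    and "v0 \<in> vertices P"
  shows "F_family P (tautological_family P v0) \<and>
    (compact_edges P \<noteq> {} \<longrightarrow> F_object P (tautological_family P v0)) \<and>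
    (\<forall>X :: ('a, 'b::real_normed_vector, 'c::real_normed_vector) cone_family. F_object P X \<longrightarrow>
       (\<exists>!f. \<exists>g. F_morphism P X (tautological_family P v0) f g) \<and>
       (\<exists>!(f, g). F_morphism P X (tautological_family P v0) f g))"
proof -
  interpret based_polyhedron P v0
    using rational_polyhedron_imp_polyhedron[OF assms(2)] assms(3) by unfold_locales auto
  have terminal: "(\<exists>!f. \<exists>g. F_morphism P X (tautological_family P v0) f g) \<and>
      (\<exists>!(f, g). F_morphism P X (tautological_family P v0) f g)"
    if "F_object P X" for X :: "('a, 'b, 'c) cone_family"
  proof -
    interpret X: F_family_over P v0 X using that by unfold_locales (simp add: F_object_def)
    show ?thesis by (rule X.F_morphism_terminal)
  qed
  show ?thesis
  proof (intro conjI impI allI)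
    show "F_family P (tautological_family P v0)" by (rule F_family_tautological)
    show "F_object P (tautological_family P v0)" if "compact_edges P \<noteq> {}"
      using that by (rule F_object_tautological)
  qed (use terminal in blast)+
qed

end
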